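(* Every planar graph $G$ satisfies $\pi(G) \le 768$.
   Context: All graphs are finite and simple. A $k$-colouring of a graph $G$ is a function assigning one of $k$ colours to each vertex. A path $(v_1,\dots,v_{2t})$ of even order is repetitively coloured by a colouring $\phi$ if $\phi(v_i)=\phi(v_{t+i})$ for all $i\in\{1,\dots,t\}$. A colouring is nonrepetitive if no path of $G$ is repetitively coloured. The nonrepetitive chromatic number $\pi(G)$ is the minimum $k$ such that $G$ has a nonrepetitive $k$-colouring. *)

theory Defs
  imports "HOL-Analysis.Analysis"
begin

definition simple_graph :: "'a set \<Rightarrow> ('a \<Rightarrow> 'a \<Rightarrow> bool) \<Rightarrow> bool" where
  "simple_graph V E \<longleftrightarrow> finite V \<and> (\<forall>u v. E u v \<longrightarrow> u \<in> V \<and> v \<in> V)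
     \<and> (\<forall>u v. E u v \<longrightarrow> E v u) \<and> (\<forall>u. \<not> E u u)"

definition planar :: "'a set \<Rightarrow> ('a \<Rightarrow> 'a \<Rightarrow> bool) \<Rightarrow> bool" where
  "planar V E \<longleftrightarrow> (\<exists>(p :: 'a \<Rightarrow> real \<times> real) (c :: 'a set \<Rightarrow> real \<Rightarrow> real \<times> real).
     inj_on p V \<and>
     (\<forall>u v. E u v \<longrightarrow> arc (c {u, v}) \<and>
        {pathstart (c {u, v}), pathfinish (c {u, v})} = {p u, p v} \<and>
        (\<forall>w\<in>V. p w \<in> path_image (c {u, v}) \<longrightarrow> w = u \<or> w = v)) \<and>
     (\<forall>u v x y. E u v \<longrightarrow> E x y \<longrightarrow> {u, v} \<noteq> {x, y} \<longrightarrow>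
        path_image (c {u, v}) \<inter> path_image (c {x, y}) \<subseteq> p ` ({u, v} \<inter> {x, y})))"

definition graph_path :: "'a set \<Rightarrow> ('a \<Rightarrow> 'a \<Rightarrow> bool) \<Rightarrow> 'a list \<Rightarrow> bool" where
  "graph_path V E vs \<longleftrightarrow> vs \<noteq> [] \<and> distinct vs \<and> set vs \<subseteq> V \<and>
     (\<forall>i. Suc i < length vs \<longrightarrow> E (vs ! i) (vs ! Suc i))"

definition repetitively_coloured :: "('a \<Rightarrow> nat) \<Rightarrow> 'a list \<Rightarrow> bool" where
  "repetitively_coloured \<phi> vs \<longleftrightarrow> (\<exists>t\<ge>1. length vs = 2 * t \<and>
     (\<forall>i<t. \<phi> (vs ! i) = \<phi> (vs ! (t + i))))"

definition nonrepetitive :: "'a set \<Rightarrow> ('a \<Rightarrow> 'a \<Rightarrow> bool) \<Rightarrow> ('a \<Rightarrow> nat) \<Rightarrow> bool" where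
  "nonrepetitive V E \<phi> \<longleftrightarrow> (\<forall>vs. graph_path V E vs \<longrightarrow> \<not> repetitively_coloured \<phi> vs)"

definition nonrep_chromatic_number :: "'a set \<Rightarrow> ('a \<Rightarrow> 'a \<Rightarrow> bool) \<Rightarrow> nat" where
  "nonrep_chromatic_number V E =
     (LEAST k. \<exists>\<phi>. (\<forall>v\<in>V. \<phi> v < k) \<and> nonrepetitive V E \<phi>)"

end

(* Every connected planar graph embeds in the strong product of a graph of treewidth at most 3, a path
and a triangle: choose breadth-first levels from a root r, triangulate the sphere, and recursively
partition a disk whose boundary consists of at most three parts. Sperner's lemma, applied to the part
in which the breadth-first path from a vertex first meets the boundary, yields a triangle from which
three such paths (a tripod) cut the disk into three smaller disks of the same kind. A tripod meets
every level at most three times, and the quotient by the tripods has an elimination ordering with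
cliques of size at most 3.

The colour of v combines a 4-letter colour of its level, in which the halves of a repetitively
coloured walk coincide, one of 4^3 colours of its tripod, in which every such walk meets the same
part at two corresponding positions, and one of 3 colours that separates the vertices of a tripod
on one level: 4 * 64 * 3 = 768. At the position where the tripods agree the levels agree as well, so
the path repeats a vertex.

The combinatorial sphere is obtained from a drawing by adding ears to a cycle, using the Jordan curve
theorem and the theta curve lemma. Thereafter only a homological form of planarity is used: every
even edge set is a sum of face boundaries modulo 2. This applies to graphs without cut vertices;
others are glued from smaller pieces at a vertex. *)

theory Submission
  imports Defs "HOL-Library.Z2" "HOL-Complex_Analysis.Complex_Analysis"
begin

section \<open>The Thue-Morse word and square-free words derived from it\<close>

section \<open>Walks on a path\<close>

text \<open>A path of the graph projects to walks in the factors that may stand still and turn back,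
  so colourings that are merely nonrepetitive on the factors do not suffice: lazy walks have to be
  controlled. On the path factor the two halves of a repetition are forced to coincide throughout.
  On the tree-like factor one common position is enough, exactly because the levels agree
  everywhere. The power 4^3 comes from induction on width: the vertices at equal depth form a
  chordal graph of width one less, and the depth itself is coloured with the same 4-letter word.

  The obstacle on the other side is to handle disks without topology. A disk is a 2-chain over the
  two-element field with a prescribed boundary cycle that vanishes on a fixed outer triangle, which
  makes it unique. Containment and disjointness of disks are read off from the boundaries of
  products of such chains. Sums modulo 2 cannot tell whether a triangle is covered once or three
  times, so triple overlaps need an argument of their own.\<close>

fun thue_morse :: "nat \<Rightarrow> int" where
  "thue_morse n = (if n = 0 then 0 else if even n then thue_morse (n div 2) else 1 - thue_morse (n div 2))"

declare thue_morse.simps [simp del]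

lemma thue_morse_even: "thue_morse (2 * n) = thue_morse n"
  by (subst thue_morse.simps) (auto simp: thue_morse.simps[of 0])

lemma thue_morse_odd: "thue_morse (Suc (2 * n)) = 1 - thue_morse n"
  by (subst thue_morse.simps) auto

lemma thue_morse_cases: "thue_morse n = 0 \<or> thue_morse n = 1"
proof (induction n rule: less_induct)
  case (less n)
  have "n = 0 \<or> n div 2 < n" by auto
  then show ?case
  proof
    assume "n div 2 < n"
    from less[OF this] show ?thesis by (subst (1 2) thue_morse.simps) auto
  qed (simp add: thue_morse.simps[of 0])
qed

lemma thue_morse_Suc: "even n \<Longrightarrow> thue_morse (Suc n) = 1 - thue_morse n"
  using thue_morse_even thue_morse_odd by (auto elim!: evenE)

text \<open>If \<open>p\<close> is even, every second letter is again an overlap, of half the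
  period. If \<open>p\<close> is odd, one of the positions \<open>i + k\<close> and
  \<open>i + k + p\<close> is even, and a letter at an even position differs from the next one; so
  the letters alternate along the whole period, which an odd period forbids.\<close>

lemma thue_morse_overlap_free:
  assumes "p \<ge> 1" "\<And>k. k \<le> p \<Longrightarrow> thue_morse (i + k) = thue_morse (i + k + p)"
  shows False
  using assms
proof (induction p arbitrary: i rule: less_induct)
  case (less p)
  show False
  proof (cases "even p")
    case True
    then obtain q where q: "p = 2 * q" by (elim evenE)
    have "thue_morse (i div 2 + k) = thue_morse (i div 2 + k + q)" if "k \<le> q" for k
    proof -
      have eq: "thue_morse (i + 2 * k) = thue_morse (i + 2 * k + p)"
        using less.prems(2)[of "2 * k"] that q by simp
      show ?thesis
      proof (cases "even i")
        case True
        then obtain j where j: "i = 2 * j" by (elim evenE)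
        have "i + 2 * k = 2 * (j + k)" "i + 2 * k + p = 2 * (j + k + q)" using j q by auto
        with eq show ?thesis unfolding j by (simp only: thue_morse_even) simp
      next
        case False
        then obtain j where j: "i = 2 * j + 1" by (elim oddE)
        have "i + 2 * k = Suc (2 * (j + k))" "i + 2 * k + p = Suc (2 * (j + k + q))" using j q by auto
        with eq show ?thesis unfolding j by (simp only: thue_morse_odd) simp
      qed
    qed
    then show False using less.IH[of q "i div 2"] less.prems(1) q by auto
  next
    case False
    have step: "thue_morse (i + Suc k) = 1 - thue_morse (i + k)" if "k < p" for k
    proof (cases "even (i + k)")
      case True
      then show ?thesis using thue_morse_Suc[of "i + k"] by simp
    next
      case odd: False
      then have "thue_morse (Suc (i + k + p)) = 1 - thue_morse (i + k + p)"
        using False by (intro thue_morse_Suc) auto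
      then show ?thesis
        using less.prems(2)[of k] less.prems(2)[of "Suc k"] that by simp
    qed
    have "thue_morse (i + k) = (if even k then thue_morse i else 1 - thue_morse i)" if "k \<le> p" for k
      using that by (induction k) (auto simp: step simp del: add_Suc_right)
    from this[of p] less.prems(2)[of 0] False have "2 * thue_morse i = 1" by auto
    then show False by presburger
  qed
qed

text \<open>Differences of successive Thue-Morse letters; \<open>thue_morse\<close> is
  integer-valued so that -1 can occur.\<close>

definition ternary :: "nat \<Rightarrow> int" where
  "ternary n = thue_morse (Suc n) - thue_morse n"

text \<open>Telescoping turns a square of differences into translated Thue-Morse values. The letters
  at \<open>i\<close>, \<open>i + p\<close> and \<open>i + 2p\<close> are then in arithmetic
  progression, so they are equal, and the square becomes an overlap.\<close>

lemma ternary_square_free: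
  assumes "p \<ge> 1" "\<And>k. k < p \<Longrightarrow> ternary (i + k) = ternary (i + k + p)"
  shows False
proof -
  have diff: "thue_morse (i + k) - thue_morse i = thue_morse (i + k + p) - thue_morse (i + p)"
    if "k \<le> p" for k
    using that
  proof (induction k)
    case (Suc k)
    then show ?case using assms(2)[of k] by (simp add: ternary_def)
  qed simp
  have "thue_morse i = thue_morse (i + p)"
    using diff[of p] thue_morse_cases[of i] thue_morse_cases[of "i + p"] thue_morse_cases[of "i + p + p"]
    by auto
  then show False
    using thue_morse_overlap_free[OF assms(1), of i] diff by force
qed

text \<open>The letter 3 at every third place lets a walk that moves by at most one detect its direction, so that
  the two halves of a repetition cannot traverse the word in opposite directions.\<close>

definition quaternary :: "nat \<Rightarrow> nat" where
  "quaternary n = (if n mod 3 = 2 then 3 else nat (ternary (2 * (n div 3) + n mod 3) + 1))"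

lemma ternary_range: "ternary n = -1 \<or> ternary n = 0 \<or> ternary n = 1"
  using thue_morse_cases[of n] thue_morse_cases[of "Suc n"] by (auto simp: ternary_def)

lemma ternary_range': "0 \<le> ternary n + 1" "ternary n + 1 < 3" "nat (ternary n + 1) < 3"
  using ternary_range[of n] by auto

lemma quaternary_less: "quaternary n < 4"
  using ternary_range'(3)[of "2 * (n div 3) + n mod 3"] by (simp add: quaternary_def)

lemma ternary_Suc: "ternary (Suc n) \<noteq> ternary n"
  using ternary_square_free[of 1 n] by auto

lemma nat_ternary_eq: "nat (ternary m + 1) = nat (ternary n + 1) \<longleftrightarrow> ternary m = ternary n"
  using ternary_range'(1)[of n] ternary_range'(1)[of m] by auto

lemma quaternary_simps:
  "quaternary (3 * n) = nat (ternary (2 * n) + 1)"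
  "quaternary (Suc (3 * n)) = nat (ternary (Suc (2 * n)) + 1)"
  "quaternary (Suc (Suc (3 * n))) = 3"
  "quaternary (Suc (Suc (Suc (3 * n)))) = nat (ternary (Suc (Suc (2 * n))) + 1)"
  "quaternary (Suc (Suc (Suc (Suc (3 * n))))) = nat (ternary (Suc (Suc (Suc (2 * n)))) + 1)"
proof -
  have "Suc (3 * n) mod 3 = 1" "Suc (3 * n) div 3 = n" "Suc (Suc (3 * n)) mod 3 = 2"
    "Suc (Suc (Suc (3 * n))) mod 3 = 0" "Suc (Suc (Suc (3 * n))) div 3 = Suc n"
    "Suc (Suc (Suc (Suc (3 * n)))) mod 3 = 1" "Suc (Suc (Suc (Suc (3 * n)))) div 3 = Suc n"
    by presburger+
  then show
    "quaternary (3 * n) = nat (ternary (2 * n) + 1)"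
    "quaternary (Suc (3 * n)) = nat (ternary (Suc (2 * n)) + 1)"
    "quaternary (Suc (Suc (3 * n))) = 3"
    "quaternary (Suc (Suc (Suc (3 * n)))) = nat (ternary (Suc (Suc (2 * n))) + 1)"
    "quaternary (Suc (Suc (Suc (Suc (3 * n))))) = nat (ternary (Suc (Suc (Suc (2 * n)))) + 1)"
    by (simp_all add: quaternary_def)
qed

lemma mod3_cases:
  fixes n :: nat
  obtains k where "n = 3 * k" | k where "n = Suc (3 * k)" | k where "n = Suc (Suc (3 * k))"
proof -
  have "n = 3 * (n div 3) \<or> n = Suc (3 * (n div 3)) \<or> n = Suc (Suc (3 * (n div 3)))" by presburger
  then show thesis using that by blast
qed

lemma quaternary_Suc: "quaternary (Suc n) \<noteq> quaternary n"
  using ternary_range'(3) ternary_Suc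
  by (cases rule: mod3_cases[of n]) (auto simp: quaternary_simps nat_ternary_eq simp del: mult_Suc_right, (metis less_irrefl)+)

lemma quaternary_Suc_Suc: "quaternary (Suc (Suc n)) \<noteq> quaternary n"
  using ternary_range'(3) ternary_Suc
  by (cases rule: mod3_cases[of n]) (auto simp: quaternary_simps nat_ternary_eq simp del: mult_Suc_right, (metis less_irrefl)+)

text \<open>The device by which colours determine positions: letters at distance 1 or 2 differ, so
  the word contains no \<open>xx\<close> and no \<open>xyx\<close>.\<close>

lemma quaternary_inj_close:
  assumes "quaternary a = quaternary b" "a \<le> b + 2" "b \<le> a + 2" shows "a = b"
proof (rule ccontr)
  assume "a \<noteq> b"
  then consider "a = Suc b" | "a = Suc (Suc b)" | "b = Suc a" | "b = Suc (Suc a)" using assms by linarith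
  then show False by cases (use assms(1) quaternary_Suc quaternary_Suc_Suc in \<open>metis+\<close>)
qed

text \<open>The letter 3 occurs among any three successive positions and marks them modulo 3, so a
  period greater than 2 is a multiple of 3. Deleting the letters 3 then leaves a square in
  \<open>ternary\<close>.\<close>

lemma quaternary_square_free:
  assumes "p \<ge> 1" "\<And>k. k < p \<Longrightarrow> quaternary (i + k) = quaternary (i + k + p)"
  shows False
proof (cases "p \<le> 2")
  case True
  have "i = i + p" by (rule quaternary_inj_close) (use True assms(2)[of 0] assms(1) in auto)
  then show False using assms(1) by simp
next
  case False
  have mod2: "n mod 3 = 2 \<longleftrightarrow> quaternary n = 3" for n
    using ternary_range'(3)[of "2 * (n div 3) + n mod 3"] by (auto simp: quaternary_def)
  have "\<exists>k<3. (i + k) mod 3 = 2" by presburger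
  then obtain k where k: "k < 3" "(i + k) mod 3 = 2" by blast
  then have "(i + k + p) mod 3 = 2"
    using assms(2)[of k] False mod2 by simp
  with k(2) have "p mod 3 = 0" by presburger
  then obtain m where m: "p = 3 * m" by auto
  \<comment> \<open>The number of ternary letters before position \<open>i\<close>; a window of
    \<open>3 * m\<close> positions contains \<open>2 * m\<close> of them.\<close>
  define j where "j = 2 * (i div 3) + i mod 3"
  have "ternary (j + k) = ternary (j + k + 2 * m)" if "k < 2 * m" for k
  proof -
    \<comment> \<open>The position in \<open>quaternary\<close> of the ternary letter with index
      \<open>j + k\<close>.\<close>
    define n where "n = 3 * ((j + k) div 2) + (j + k) mod 2"
    define a r b s where "a = i div 3" and "r = i mod 3" and "b = (j + k) div 2" and "s = (j + k) mod 2"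
    have i: "i = 3 * a + r" "r < 3" and jk: "j + k = 2 * b + s" "s < 2" "j = 2 * a + r" and n: "n = 3 * b + s"
      by (auto simp: a_def r_def b_def s_def j_def n_def)
    have n1: "i \<le> n"
      by (cases a b rule: linorder_cases; use i jk n in linarith)
    have n2: "n < i + 3 * m"
      by (cases "a + m" b rule: linorder_cases; use i jk n that in linarith)
    have "n mod 3 = s" "n div 3 = b" using n jk(2) by auto
    with jk have n3: "n mod 3 \<noteq> 2" "2 * (n div 3) + n mod 3 = j + k" by auto
    have n4: "(n + 3 * m) mod 3 = n mod 3" "(n + 3 * m) div 3 = n div 3 + m" by auto
    have eq: "2 * (n div 3 + m) + n mod 3 = j + k + 2 * m" using n3(2) by simp
    have "quaternary n = quaternary (n + p)"
      using assms(2)[of "n - i"] n1 n2 m by simp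
    then have "ternary (2 * (n div 3) + n mod 3) = ternary (2 * (n div 3 + m) + n mod 3)"
      using n3(1) unfolding quaternary_def m n4 by (simp add: nat_ternary_eq)
    then show ?thesis unfolding eq n3(2) .
  qed
  moreover have "2 * m \<ge> 1" using m assms(1) by auto
  ultimately show False by (rule ternary_square_free[rotated])
qed

section \<open>Lazy walks on a path\<close>

definition near :: "nat \<Rightarrow> nat \<Rightarrow> bool" where
  "near a b \<longleftrightarrow> a \<le> b + 1 \<and> b \<le> a + 1"

text \<open>A descent is stated additively because subtraction on \<open>nat\<close>
  truncates.\<close>

definition straight :: "nat \<Rightarrow> (nat \<Rightarrow> nat) \<Rightarrow> bool" where
  "straight t f \<longleftrightarrow> (\<forall>k<t. f k = f 0 + k) \<or> (\<forall>k<t. f k + k = f 0)"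

lemma straightI:
  assumes "\<And>k. Suc k < t \<Longrightarrow> near (f k) (f (Suc k))" "\<And>k. Suc k < t \<Longrightarrow> f k \<noteq> f (Suc k)"
    "\<And>k. Suc (Suc k) < t \<Longrightarrow> f k \<noteq> f (Suc (Suc k))"
  shows "straight t f"
proof (cases "t > 1")
  case True
  consider "f 1 = Suc (f 0)" | "Suc (f 1) = f 0"
    using assms(1)[of 0] assms(2)[of 0] True by (fastforce simp: near_def)
  then show ?thesis
  proof cases
    case 1
    have up: "f (Suc k) = Suc (f k)" if "Suc k < t" for k
      using that
    proof (induction k)
      case (Suc k)
      then show ?case using assms(1)[of "Suc k"] assms(2)[of "Suc k"] assms(3)[of k] by (auto simp: near_def)
    qed (use 1 in simp)
    have "f k = f 0 + k" if "k < t" for k using that by (induction k) (auto simp: up)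
    then show ?thesis unfolding straight_def by blast
  next
    case 2
    have dn: "Suc (f (Suc k)) = f k" if "Suc k < t" for k
      using that
    proof (induction k)
      case (Suc k)
      then show ?case using assms(1)[of "Suc k"] assms(2)[of "Suc k"] assms(3)[of k] by (auto simp: near_def)
    qed (use 2 in simp)
    have "f k + k = f 0" if "k < t" for k using that
    proof (induction k)
      case (Suc k)
      then show ?case using dn[of k] by linarith
    qed simp
    then show ?thesis unfolding straight_def by blast
  qed
next
  case False
  then have "k = 0" if "k < t" for k using that by simp
  then have "\<forall>k<t. f k = f 0 + k" by (metis add.right_neutral)
  then show ?thesis unfolding straight_def by blast
qed

text \<open>Deleting stationary steps and turns, which the colours force to occur simultaneously in both walks,
  preserves the end points.\<close>

lemma straighten:
  assumes "t \<ge> 1" "\<And>k. Suc k < t \<Longrightarrow> near (f k) (f (Suc k))" "\<And>k. Suc k < t \<Longrightarrow> near (g k) (g (Suc k))"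
    "\<And>k. k < t \<Longrightarrow> quaternary (f k) = quaternary (g k)"
  shows "\<exists>s f' g'. s \<ge> 1 \<and> straight s f' \<and> straight s g' \<and> f' 0 = f 0 \<and> g' 0 = g 0 \<and>
    f' (s - 1) = f (t - 1) \<and> g' (s - 1) = g (t - 1) \<and> (\<forall>k<s. quaternary (f' k) = quaternary (g' k))"
  using assms
proof (induction t arbitrary: f g rule: less_induct)
  case (less t)
  note pr = less.prems
  show ?case
  \<comment> \<open>Here \<open>d = 1\<close> is a stationary step and \<open>d = 2\<close> a
    turn.\<close>
  proof (cases "\<exists>i d. 1 \<le> d \<and> d \<le> 2 \<and> i + d < t \<and> f i = f (i + d)")
    case True
    then obtain i d where d: "1 \<le> d" "d \<le> 2" "i + d < t" "f i = f (i + d)" by blast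
    have d12: "d = 1 \<or> d = 2" using d by linarith
    have gid: "g i = g (i + d)"
    proof (rule quaternary_inj_close)
      show "quaternary (g i) = quaternary (g (i + d))" using pr(4) d by (metis add_lessD1)
      have "near (g i) (g (Suc i))" using pr(3) d by simp
      moreover have "d = 2 \<Longrightarrow> near (g (Suc i)) (g (Suc (Suc i)))" using pr(3) d by simp
      ultimately show "g i \<le> g (i + d) + 2" "g (i + d) \<le> g i + 2" using d12 by (auto simp: near_def)
    qed
    \<comment> \<open>Cuts out the positions \<open>i + 1\<close> to \<open>i + d\<close>; as
      \<open>h i = h (i + d)\<close>, the rest is still a walk with the same ends, even if the cut
      reaches the last position.\<close>
    define del where "del h k = (if k \<le> i then h k else h (k + d) :: nat)" for h k
    have del_near: "near (del h k) (del h (Suc k))"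
      if "\<And>k. Suc k < t \<Longrightarrow> near (h k) (h (Suc k))" "h i = h (i + d)" "Suc k < t - d" for h k
      using that(1)[of k] that(1)[of "k + d"] that(2,3) d by (cases "k = i") (auto simp: del_def)
    have ends: "del h 0 = h 0" "del h (t - d - 1) = h (t - 1)" if "h i = h (i + d)" for h
    proof -
      consider "t - d - 1 > i" | "t - d - 1 = i" "t - 1 = i + d" using d by linarith
      then show "del h (t - d - 1) = h (t - 1)" using d that by cases (auto simp: del_def)
    qed (simp add: del_def)
    have "\<exists>s f' g'. s \<ge> 1 \<and> straight s f' \<and> straight s g' \<and> f' 0 = del f 0 \<and> g' 0 = del g 0 \<and>
      f' (s - 1) = del f (t - d - 1) \<and> g' (s - 1) = del g (t - d - 1) \<and> (\<forall>k<s. quaternary (f' k) = quaternary (g' k))"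
    proof (rule less.IH)
      show "t - d < t" "1 \<le> t - d" using d by auto
      show "near (del f k) (del f (Suc k))" "near (del g k) (del g (Suc k))" if "Suc k < t - d" for k
        using del_near[of f] del_near[of g] pr that d(4) gid by auto
      show "quaternary (del f k) = quaternary (del g k)" if "k < t - d" for k
        using pr(4)[of k] pr(4)[of "k + d"] that by (auto simp: del_def)
    qed
    then show ?thesis using ends[OF d(4)] ends[OF gid] by simp
  next
    case False
    have f1: "f k \<noteq> f (Suc k)" if "Suc k < t" for k using False that
      by (metis One_nat_def Suc_eq_plus1 le_add1 le_refl one_add_one)
    have f2: "f k \<noteq> f (Suc (Suc k))" if "Suc (Suc k) < t" for k using False that
      by (metis add_2_eq_Suc' le_refl one_le_numeral)
    have g1: "g k \<noteq> g (Suc k)" if "Suc k < t" for k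
    proof
      assume "g k = g (Suc k)"
      then have "quaternary (f k) = quaternary (f (Suc k))" using pr(4)[of k] pr(4)[of "Suc k"] that by simp
      then have "f k = f (Suc k)" using pr(2)[OF that] by - (rule quaternary_inj_close; simp add: near_def)
      then show False using f1 that by blast
    qed
    have g2: "g k \<noteq> g (Suc (Suc k))" if "Suc (Suc k) < t" for k
    proof
      assume "g k = g (Suc (Suc k))"
      then have "quaternary (f k) = quaternary (f (Suc (Suc k)))"
        using pr(4)[of k] pr(4)[of "Suc (Suc k)"] that by simp
      then have "f k = f (Suc (Suc k))" using pr(2)[of k] pr(2)[of "Suc k"] that
        by - (rule quaternary_inj_close; simp add: near_def)
      then show False using f2 that by blast
    qed
    have "straight t f" "straight t g"
      using straightI[of t f, OF pr(2) f1 f2] straightI[of t g, OF pr(3) g1 g2] by blast+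
    then show ?thesis using pr by (intro exI[of _ t] exI[of _ f] exI[of _ g]) auto
  qed
qed

text \<open>The second walk starts next to the end of the first. If the starting points differ,
  equal directions give a square in the word, and opposite directions give a palindrome, in whose
  middle two equal letters are at distance 1 or 2.\<close>

lemma straight_pair_eq:
  assumes s: "s \<ge> 1" and f: "straight s f" and g: "straight s g"
    and c: "\<And>k. k < s \<Longrightarrow> quaternary (f k) = quaternary (g k)" and n: "near (f (s - 1)) (g 0)"
  shows "f 0 = g 0"
proof (rule ccontr)
  assume ne: "f 0 \<noteq> g 0"
  have far: "\<not> near (f 0) (g 0)"
    using quaternary_inj_close[of "f 0" "g 0"] c[of 0] s ne by (auto simp: near_def)
  have s1: "s \<ge> 2" using far n s by (cases "s = 1") auto
  have sq: False if "a < b" "b \<le> a + s" "\<And>k. k < s \<Longrightarrow> quaternary (a + k) = quaternary (b + k)" for a b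
    using quaternary_square_free[of "b - a" a] that by (force simp: algebra_simps)
  have pal: False if "a < b" "b \<le> a + s" "\<And>k. k < s \<Longrightarrow> quaternary (a + k) = quaternary (b - k)" for a b
  proof (cases "even (b - a)")
    case True
    then obtain m where "b - a = 2 * m" by (elim evenE)
    with that(1) have b: "b = a + 2 * m" "m \<ge> 1" by auto
    have "a + (m - 1) = b - (m - 1)"
      by (rule quaternary_inj_close) (use that(3)[of "m - 1"] that(2) b in auto)
    then show False using b by auto
  next
    case False
    then obtain m where "b - a = 2 * m + 1" by (elim oddE)
    with that(1) have b: "b = a + 2 * m + 1" by auto
    have "a + m = b - m"
      by (rule quaternary_inj_close) (use that(3)[of m] that(2) b in auto)
    then show False using b by auto
  qed
  have sl: "s - 1 < s" using s by simp
  from f[unfolded straight_def] show False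
  proof
    assume f': "\<forall>k<s. f k = f 0 + k"
    have fl: "f (s - 1) = f 0 + (s - 1)" using f' sl by blast
    have gr: "f 0 < g 0" "g 0 \<le> f 0 + s" using n fl s1 ne by (auto simp: near_def)
    from g[unfolded straight_def] show False
    proof
      assume "\<forall>k<s. g k = g 0 + k"
      then show False using sq[OF gr] c f' by metis
    next
      assume g': "\<forall>k<s. g k + k = g 0"
      have "g k = g 0 - k" if "k < s" for k using g' that by (metis add_diff_cancel_right')
      then show False using pal[OF gr] c f' by metis
    qed
  next
    assume f': "\<forall>k<s. f k + k = f 0"
    then have f'': "f k = f 0 - k" if "k < s" for k using that by (metis add_diff_cancel_right')
    have fl: "f (s - 1) + (s - 1) = f 0" using f' sl by blast
    have gr: "g 0 < f 0" "f 0 \<le> g 0 + s" using n fl s1 ne by (auto simp: near_def)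
    from g[unfolded straight_def] show False
    proof
      assume "\<forall>k<s. g k = g 0 + k"
      then show False using pal[OF gr] c f'' by metis
    next
      assume g': "\<forall>k<s. g k + k = g 0"
      have gl: "g (s - 1) + (s - 1) = g 0" using g' sl by blast
      \<comment> \<open>Both walks descend, so the square is read backwards from their ends.\<close>
      have ord: "g (s - 1) < f (s - 1)" "f (s - 1) \<le> g (s - 1) + s" using gr gl fl by linarith+
      have "quaternary (g (s - 1) + k) = quaternary (f (s - 1) + k)" if "k < s" for k
      proof -
        have "g (s - 1 - k) + (s - 1 - k) = g 0" "f (s - 1 - k) + (s - 1 - k) = f 0"
          using f' g' sl by (meson diff_le_self le_less_trans)+
        then have "g (s - 1 - k) = g (s - 1) + k" "f (s - 1 - k) = f (s - 1) + k"
          using gl fl that by linarith+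
        then show ?thesis using c[of "s - 1 - k"] that by simp
      qed
      then show False using sq[of "g (s - 1)" "f (s - 1)"] ord by blast
    qed
  qed
qed

text \<open>Straightening both halves keeps their ends, so the halves start at the same point. From
  equal positions one step leads to positions at distance at most 2, which equal colours
  identify.\<close>

lemma quaternary_boring:
  assumes "\<And>i. Suc i < 2 * t \<Longrightarrow> near (f i) (f (Suc i))" "\<And>i. i < t \<Longrightarrow> quaternary (f i) = quaternary (f (t + i))"
    and "i < t"
  shows "f i = f (t + i)"
proof -
  have t: "t \<ge> 1" using assms(3) by simp
  define g where "g k = f (t + k)" for k
  obtain s f' g' where s: "s \<ge> 1" "straight s f'" "straight s g'" "f' 0 = f 0" "g' 0 = g 0"
    "f' (s - 1) = f (t - 1)" "g' (s - 1) = g (t - 1)" "\<forall>k<s. quaternary (f' k) = quaternary (g' k)"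
    using straighten[of t f g] assms t by (auto simp: g_def)
  have "near (f (t - 1)) (g 0)" using assms(1)[of "t - 1"] t by (simp add: g_def)
  then have "f 0 = g 0" using straight_pair_eq[of s f' g'] s by simp
  with assms(3) show ?thesis
  proof (induction i)
    case (Suc i)
    then show ?case
      using assms(1)[of i] assms(1)[of "t + i"] assms(2)[of "Suc i"]
      by - (rule quaternary_inj_close; simp add: near_def)
  qed (simp add: g_def)
qed


section \<open>Chordal graphs: colouring lazy walks by induction on the width\<close>

section \<open>Walks on chordal graphs\<close>

text \<open>A perfect elimination ordering of a chordal graph on the natural numbers: \<open>N n\<close> is the clique of
  neighbours of \<open>n\<close> that precede it.\<close>

definition elim_order :: "nat \<Rightarrow> (nat \<Rightarrow> nat set) \<Rightarrow> bool" where
  "elim_order k N \<longleftrightarrow> (\<forall>n. N n \<subseteq> {..<n} \<and> card (N n) \<le> k) \<and>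
     (\<forall>n. \<forall>a\<in>N n. \<forall>b\<in>N n. a < b \<longrightarrow> a \<in> N b)"

definition joined :: "(nat \<Rightarrow> nat set) \<Rightarrow> nat \<Rightarrow> nat \<Rightarrow> bool" where
  "joined N a b \<longleftrightarrow> a = b \<or> a \<in> N b \<or> b \<in> N a"

lemma joined_sym: "joined N a b \<Longrightarrow> joined N b a" by (auto simp: joined_def)

lemma joined_refl [simp]: "joined N a a" by (auto simp: joined_def)

text \<open>The distance to the component root. The filter \<open>m < n\<close> serves termination only: it is vacuous for
  elimination orderings.\<close>

function depth :: "(nat \<Rightarrow> nat set) \<Rightarrow> nat \<Rightarrow> nat" where
  "depth N n = (if {m\<in>N n. m < n} = {} then 0 else Suc (Min (depth N ` {m\<in>N n. m < n})))"
  by pat_completeness auto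
termination by (relation "Wellfounded.measure snd") auto

declare depth.simps [simp del]

context
  fixes k N
  assumes eo: "elim_order k N"
begin

lemma N_less: "m \<in> N n \<Longrightarrow> m < n" using eo by (auto simp: elim_order_def)

lemma N_finite: "finite (N n)"
  using eo unfolding elim_order_def by (meson finite_lessThan finite_subset)

lemma N_clique: "a \<in> N n \<Longrightarrow> b \<in> N n \<Longrightarrow> joined N a b"
  using eo unfolding elim_order_def joined_def by (metis linorder_neqE_nat)

lemma depth_eq: "depth N n = (if N n = {} then 0 else Suc (Min (depth N ` N n)))"
proof -
  have "{m\<in>N n. m < n} = N n" using N_less by auto
  then show ?thesis by (subst depth.simps) simp
qed

lemma depth_le_Suc: "m \<in> N n \<Longrightarrow> depth N n \<le> Suc (depth N m)"
  using N_finite[of n] depth_eq[of n] by auto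

lemma depth_parent: "N n \<noteq> {} \<Longrightarrow> \<exists>m\<in>N n. depth N n = Suc (depth N m)"
proof -
  assume ne: "N n \<noteq> {}"
  then have "Min (depth N ` N n) \<in> depth N ` N n" using N_finite[of n] by (intro Min_in) auto
  then obtain m where m: "m \<in> N n" "Min (depth N ` N n) = depth N m" by blast
  have "depth N n = Suc (depth N m)" using depth_eq[of n] ne m(2) by simp
  then show ?thesis using m(1) by blast
qed

text \<open>Every \<open>m\<close> in \<open>N n\<close> is joined to a predecessor
  \<open>m0\<close> of least depth. If \<open>m\<close> precedes \<open>m0\<close>, induction
  applies; if it follows, it is at most one deeper than \<open>m0\<close>, hence no deeper than
  \<open>n\<close>.\<close>

lemma depth_mono: "m \<in> N n \<Longrightarrow> depth N m \<le> depth N n"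
proof (induction n arbitrary: m rule: less_induct)
  case (less n)
  then obtain m0 where m0: "m0 \<in> N n" "depth N n = Suc (depth N m0)" using depth_parent by blast
  consider "m = m0" | "m \<in> N m0" | "m0 \<in> N m"
    using N_clique[OF less.prems m0(1)] by (auto simp: joined_def)
  then show ?case
  proof cases
    case 2
    then show ?thesis using less.IH[OF N_less[OF m0(1)] 2] m0(2) by simp
  next
    case 3
    then show ?thesis using depth_le_Suc[OF 3] m0(2) by simp
  qed (use m0 in simp)
qed

lemma joined_near: "joined N a b \<Longrightarrow> near (depth N a) (depth N b)"
  using depth_le_Suc[of a b] depth_mono[of a b] depth_le_Suc[of b a] depth_mono[of b a]
  by (auto simp: joined_def near_def)

text \<open>A predecessor of least depth lies one level higher, so restricting to a level removes at
  least one element from every nonempty \<open>N n\<close>.\<close>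

lemma elim_order_level: "elim_order (k - 1) (\<lambda>n. {m\<in>N n. depth N m = depth N n})"
proof -
  have "card {m\<in>N n. depth N m = depth N n} \<le> k - 1" for n
  proof (cases "N n = {}")
    case False
    then obtain m where m: "m \<in> N n" "depth N n = Suc (depth N m)" using depth_parent by blast
    then have "{m\<in>N n. depth N m = depth N n} \<subseteq> N n - {m}" by auto
    then have "card {m\<in>N n. depth N m = depth N n} \<le> card (N n - {m})"
      using N_finite by (intro card_mono) auto
    also have "\<dots> \<le> k - 1" using eo m N_finite by (auto simp: elim_order_def diff_le_mono)
    finally show ?thesis .
  qed simp
  moreover have "{m\<in>N n. depth N m = depth N n} \<subseteq> {..<n}" for n using N_less by auto
  moreover have "a \<in> {m\<in>N b. depth N m = depth N b}"
    if "a \<in> {m\<in>N n. depth N m = depth N n}" "b \<in> {m\<in>N n. depth N m = depth N n}" "a < b" for a b n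
    using that N_clique[of a n b] N_less[of b a] by (auto simp: joined_def)
  ultimately show ?thesis unfolding elim_order_def by blast
qed

text \<open>Repeatedly shortcut the walk at an inner vertex that comes last in the elimination ordering.\<close>

lemma shadow_complete:
  assumes "successively (joined N) (a # ms @ [b])" "\<And>m. m \<in> set ms \<Longrightarrow> depth N m > d"
    "depth N a = d" "depth N b = d"
  shows "joined N a b"
  using assms
proof (induction "length ms" arbitrary: ms)
  case 0
  then show ?case by simp
next
  case (Suc n)
  define M where "M = Max (set ms)"
  have "ms \<noteq> []" using Suc.hyps(2) by auto
  then have M: "M \<in> set ms" "\<And>m. m \<in> set ms \<Longrightarrow> m \<le> M" unfolding M_def by auto
  then obtain us vs where ms: "ms = us @ M # vs" by (meson split_list)
  \<comment> \<open>A walk neighbour of \<open>M\<close> cannot come after it: inner vertices by the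
    maximality of \<open>M\<close>, vertices of depth \<open>d\<close> because depth does not
    decrease along the ordering.\<close>
  have into: "x = M \<or> x \<in> N M" if "joined N x M" "x \<in> set ms \<or> depth N x = d" for x
  proof -
    have "M \<notin> N x"
    proof
      assume x: "M \<in> N x"
      then have "depth N x \<noteq> d" using depth_mono[OF x] Suc.prems(2)[OF M(1)] by auto
      with that(2) have "x \<in> set ms" by simp
      then show False using M(2) N_less[OF x] by fastforce
    qed
    with that(1) show ?thesis by (auto simp: joined_def)
  qed
  define x where "x = last (a # us)"
  define y where "y = hd (vs @ [b])"
  have split: "successively (joined N) (a # us)" "successively (joined N) (vs @ [b])" "joined N x M" "joined N M y"
  proof -
    have "successively (joined N) ((a # us) @ (M # vs @ [b]))" using Suc.prems(1) ms by simp
    then have "successively (joined N) (a # us)" "successively (joined N) (M # vs @ [b])" "joined N x M"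
      unfolding successively_append_iff x_def by auto
    then show "successively (joined N) (a # us)" "successively (joined N) (vs @ [b])" "joined N x M" "joined N M y"
      unfolding y_def by (auto simp: successively_Cons)
  qed
  have "x \<in> set ms \<or> depth N x = d" unfolding x_def ms using Suc.prems by auto
  moreover have "y \<in> set ms \<or> depth N y = d" unfolding y_def ms using Suc.prems by (cases vs) auto
  ultimately have "joined N x y"
    using into[OF split(3)] into[OF joined_sym[OF split(4)]] split(3,4) N_clique by metis
  then have "successively (joined N) ((a # us) @ (vs @ [b]))"
    using split unfolding x_def y_def by (subst successively_append_iff) auto
  then have "successively (joined N) (a # (us @ vs) @ [b])" by simp
  then show ?case
    by (rule Suc.hyps(1)[rotated]) (use Suc.prems Suc.hyps(2) ms in auto)
qed

end

lemma filter_upt_consecutive: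
  assumes "Suc j < length (filter P [0..<n])" "filter P [0..<n] ! j < i" "i < filter P [0..<n] ! Suc j"
  shows "\<not> P i"
proof
  let ?L = "filter P [0..<n]"
  assume "P i"
  have "?L ! Suc j \<in> set ?L" using assms(1) nth_mem by blast
  then have "i < n" using assms(3) by auto
  then have "i \<in> set ?L" using \<open>P i\<close> by simp
  then obtain l where l: "l < length ?L" "?L ! l = i" unfolding in_set_conv_nth by blast
  have s: "sorted_wrt (<) ?L" by (rule sorted_wrt_filter) simp
  have "j < l" using assms l sorted_wrt_nth_less[OF s, of l j] by (cases l j rule: linorder_cases) auto
  moreover have "l < Suc j" using assms l sorted_wrt_nth_less[OF s, of "Suc j" l] by (cases l "Suc j" rule: linorder_cases) auto
  ultimately show False by simp
qed

lemma filter_upt_double: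
  "filter P [0..<2 * t] = filter P [0..<t] @ map ((+) t) (filter (\<lambda>i. P (t + i)) [0..<t])"
proof -
  have "map ((+) t) [0..<t] = [t..<2 * t]" by (rule nth_equalityI) auto
  moreover have "[0..<2 * t] = [0..<t] @ [t..<2 * t]" using upt_add_eq_append[of 0 t t] by (simp only: mult_2)
  ultimately have "[0..<2 * t] = [0..<t] @ map ((+) t) [0..<t]" by metis
  then have "filter P [0..<2 * t] = filter P ([0..<t] @ map ((+) t) [0..<t])" by (rule arg_cong)
  then show ?thesis by (simp only: filter_append filter_map comp_def)
qed

text \<open>Each step of the induction on \<open>k\<close> spends 4 letters on the depth and leaves
  the rest to the level graphs. Since the two halves have equal depths, the visits to the least
  depth have the same offsets in both and form a shorter repetition in a level graph; a common
  position there is one of the whole walk. Asking for just one common position is what lets the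
  induction pass to a subsequence. \<open>joined\<close> is reflexive because walks may stand
  still.\<close>

theorem elim_order_strongly_nonrepetitive:
  assumes "elim_order k N"
  shows "\<exists>\<psi> :: nat \<Rightarrow> nat. (\<forall>n. \<psi> n < 4 ^ k) \<and>
    (\<forall>t x. t \<ge> 1 \<longrightarrow> (\<forall>i. Suc i < 2 * t \<longrightarrow> joined N (x i) (x (Suc i))) \<longrightarrow>
       (\<forall>i<t. \<psi> (x i) = \<psi> (x (t + i))) \<longrightarrow> (\<exists>i<t. x i = x (t + i)))"
  using assms
proof (induction k arbitrary: N)
  case 0
  then have "N n = {}" for n using N_finite[OF 0] by (auto simp: elim_order_def)
  then have j: "joined N a b \<longleftrightarrow> a = b" for a b by (auto simp: joined_def)
  have "\<exists>i<t. x i = x (t + i)" if "t \<ge> 1" "\<forall>i. Suc i < 2 * t \<longrightarrow> x i = x (Suc i)" for t and x :: "nat \<Rightarrow> nat"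
  proof -
    have step: "x (Suc i) = x i" if "Suc i < 2 * t" for i
      using \<open>\<forall>i. Suc i < 2 * t \<longrightarrow> x i = x (Suc i)\<close> that by metis
    have "x i = x 0" if "i < 2 * t" for i
      using \<open>i < 2 * t\<close> by (induction i) (auto simp: step)
    from this[of t] have "x 0 = x (t + 0)" using that(1) by simp
    then show ?thesis using that(1) by (metis less_eq_Suc_le One_nat_def)
  qed
  then show ?case unfolding j by (intro exI[of _ "\<lambda>_. 0"]) auto
next
  case (Suc k)
  define N' where "N' n = {m\<in>N n. depth N m = depth N n}" for n
  have "elim_order k N'" using elim_order_level[OF Suc.prems] by (simp add: N'_def[abs_def])
  from Suc.IH[OF this] obtain \<psi> :: "nat \<Rightarrow> nat" where \<psi>: "\<forall>n. \<psi> n < 4 ^ k"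
    "\<forall>t x. t \<ge> 1 \<longrightarrow> (\<forall>i. Suc i < 2 * t \<longrightarrow> joined N' (x i) (x (Suc i))) \<longrightarrow>
       (\<forall>i<t. \<psi> (x i) = \<psi> (x (t + i))) \<longrightarrow> (\<exists>i<t. x i = x (t + i))" by blast
  define \<phi> where "\<phi> n = quaternary (depth N n) * 4 ^ k + \<psi> n" for n
  have \<phi>_eq: "quaternary (depth N a) = quaternary (depth N b) \<and> \<psi> a = \<psi> b" if "\<phi> a = \<phi> b" for a b
  proof -
    have "\<phi> n div 4 ^ k = quaternary (depth N n)" "\<phi> n mod 4 ^ k = \<psi> n" for n
      using \<psi>(1) by (auto simp: \<phi>_def)
    then show ?thesis using that by metis
  qed
  have bound: "\<phi> n < 4 ^ Suc k" for n
  proof -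
    have "(quaternary (depth N n) + 1) * 4 ^ k \<le> 4 * 4 ^ k"
      using quaternary_less[of "depth N n"] by (intro mult_right_mono) auto
    then have "quaternary (depth N n) * 4 ^ k + 4 ^ k \<le> 4 ^ Suc k" by (simp only: distrib_right mult_1 power_Suc)
    then show ?thesis using \<psi>(1)[rule_format, of n] unfolding \<phi>_def by linarith
  qed
  have main: "\<exists>i<t. x i = x (t + i)"
    if t: "t \<ge> 1" and walk: "\<And>i. Suc i < 2 * t \<Longrightarrow> joined N (x i) (x (Suc i))"
      and rep: "\<And>i. i < t \<Longrightarrow> \<phi> (x i) = \<phi> (x (t + i))" for t x
  proof -
    define l where "l i = depth N (x i)" for i
    have l_near: "near (l i) (l (Suc i))" if "Suc i < 2 * t" for i
      using joined_near[OF Suc.prems walk[OF that]] by (simp only: l_def)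
    have l_rep: "quaternary (l i) = quaternary (l (t + i))" if "i < t" for i
      using \<phi>_eq[OF rep[OF that]] by (simp only: l_def)
    have boring: "l i = l (t + i)" if "i < t" for i
      using quaternary_boring[of t l i] l_near l_rep that by blast
    define d where "d = Min (l ` {..<2 * t})"
    have d_le: "d \<le> l i" if "i < 2 * t" for i using that by (auto simp: d_def)
    have "d \<in> l ` {..<2 * t}" unfolding d_def using t by (intro Min_in) (auto simp: lessThan_empty_iff)
    then obtain i0 where "i0 \<in> {..<2 * t}" "d = l i0" by (rule imageE)
    then have i0: "i0 < 2 * t" "l i0 = d" by simp_all
    define A where "A = filter (\<lambda>i. l i = d) [0..<t]"
    define L where "L = filter (\<lambda>i. l i = d) [0..<2 * t]"
    define s where "s = length A"
    \<comment> \<open>The second half visits the least depth exactly \<open>t\<close> positions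
      after the first half does.\<close>
    have "filter (\<lambda>i. l (t + i) = d) [0..<t] = A"
      unfolding A_def by (rule filter_cong) (simp_all add: boring)
    then have L: "L = A @ map ((+) t) A" using filter_upt_double[of "\<lambda>i. l i = d" t]
      unfolding A_def L_def by metis
    have "s \<ge> 1"
    proof -
      have "i0 \<in> set L" using i0 by (simp add: L_def)
      then have "A \<noteq> []" using L by auto
      then show ?thesis by (simp add: s_def Suc_le_eq)
    qed
    have len: "length L = 2 * s" by (simp add: L s_def)
    have L_gap: "l i \<noteq> d" if "Suc j < length L" "L ! j < i" "i < L ! Suc j" for i j
      using that unfolding L_def by (rule filter_upt_consecutive)
    have L_mem: "L ! j < 2 * t" "l (L ! j) = d" if "j < 2 * s" for j
    proof -
      have "L ! j \<in> set L" using that len by simp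
      then show "L ! j < 2 * t" "l (L ! j) = d" by (auto simp: L_def)
    qed
    \<comment> \<open>Between consecutive visits to depth \<open>d\<close> the walk is strictly
      deeper, so by \<open>shadow_complete\<close> the visits themselves form a lazy walk.\<close>
    have "\<exists>j<s. x (L ! j) = x (L ! (s + j))"
    proof (rule \<psi>(2)[rule_format, OF \<open>s \<ge> 1\<close>])
      show "joined N' (x (L ! j)) (x (L ! Suc j))" if j: "Suc j < 2 * s" for j
      proof -
        let ?p = "L ! j" and ?q = "L ! Suc j"
        have pq: "?p < ?q"
          using sorted_wrt_nth_less[of "(<)" L j "Suc j"] j len by (simp add: L_def sorted_wrt_filter)
        have q: "?q < 2 * t" using L_mem j by simp
        define ms where "ms = map x [Suc ?p..<?q]"
        have eq: "x ?p # ms @ [x ?q] = map x [?p..<Suc ?q]"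
          using pq by (simp add: ms_def upt_conv_Cons)
        have walk': "successively (joined N) (x ?p # ms @ [x ?q])"
          unfolding eq successively_conv_nth using walk q by (auto simp del: upt_Suc)
        have deep: "depth N m > d" if m: "m \<in> set ms" for m
        proof -
          have "m \<in> x ` {Suc ?p..<?q}" using m unfolding ms_def set_map set_upt .
          then obtain i where i: "m = x i" "i \<in> {Suc ?p..<?q}" by (rule imageE)
          then have "l i \<noteq> d" using L_gap[of j i] j len by simp
          moreover have "d \<le> l i" using d_le[of i] i(2) q by simp
          ultimately show ?thesis unfolding i(1) l_def by simp
        qed
        have ends: "depth N (x ?p) = d" "depth N (x ?q) = d" using L_mem(2) j by (simp_all add: l_def)
        have "joined N (x ?p) (x ?q)" by (rule shadow_complete[OF Suc.prems walk' deep ends])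
        then show ?thesis using ends unfolding joined_def N'_def by simp
      qed
      show "\<psi> (x (L ! j)) = \<psi> (x (L ! (s + j)))" if "j < s" for j
      proof -
        have "L ! (s + j) = t + L ! j" using that by (simp add: L nth_append s_def)
        moreover have "L ! j < t"
        proof -
          have "A ! j \<in> set A" using that by (simp add: s_def)
          then show ?thesis using that by (simp add: L nth_append s_def A_def)
        qed
        ultimately show ?thesis using \<phi>_eq[OF rep] by simp
      qed
    qed
    then obtain j where j: "j < s" "x (L ! j) = x (L ! (s + j))" by blast
    have "L ! (s + j) = t + L ! j" using j by (simp add: L nth_append s_def)
    moreover have "L ! j < t"
    proof -
      have "A ! j \<in> set A" using j by (simp add: s_def)
      then show ?thesis using j by (simp add: L nth_append s_def A_def)
    qed
    ultimately show ?thesis using j by auto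
  qed
  show ?case
  proof (intro exI[of _ \<phi>] conjI allI)
    show "\<phi> n < 4 ^ Suc k" for n by (rule bound)
    show "t \<ge> 1 \<longrightarrow> (\<forall>i. Suc i < 2 * t \<longrightarrow> joined N (x i) (x (Suc i))) \<longrightarrow>
       (\<forall>i<t. \<phi> (x i) = \<phi> (x (t + i))) \<longrightarrow> (\<exists>i<t. x i = x (t + i))" for t x
    proof (intro impI)
      assume a: "t \<ge> 1" and b: "\<forall>i. Suc i < 2 * t \<longrightarrow> joined N (x i) (x (Suc i))"
        and c: "\<forall>i<t. \<phi> (x i) = \<phi> (x (t + i))"
      show "\<exists>i<t. x i = x (t + i)" by (rule main[OF a b[rule_format] c[rule_format]])
    qed
  qed
qed

section \<open>Chains, boundaries and cycles over the two-element field\<close>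

section \<open>Paths and cycles modulo 2\<close>

declare add_bit_eq_xor [simp del] mult_bit_eq_and [simp del]

lemma bit_add_self [simp]: "(a :: bit) + a = 0"
  by (cases a) auto

lemma bit_add_self_left [simp]: "(a :: bit) + (a + b) = b"
  by (simp flip: add.assoc)

lemma bit_add_eq_0_iff: "(a :: bit) + b = 0 \<longleftrightarrow> a = b"
  by (cases a; cases b) auto

fun path_edges :: "'v list \<Rightarrow> 'v set set" where
  "path_edges (x # y # zs) = insert {x, y} (path_edges (y # zs))"
| "path_edges _ = {}"

text \<open>Unlike \<open>path_edges\<close> this counts traversals modulo 2, so the closed walk
  along a single edge and back has chain zero. This is why a two-vertex boundary can bound the empty
  disk.\<close>

fun chain :: "'v list \<Rightarrow> 'v set \<Rightarrow> bit" where
  "chain (x # y # zs) e = of_bool (e = {x, y}) + chain (y # zs) e"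
| "chain _ e = 0"

definition cycle_edges :: "'v list \<Rightarrow> 'v set set" where
  "cycle_edges xs = path_edges (xs @ [hd xs])"

text \<open>The boundary of the 1-chain \<open>z\<close>, evaluated at \<open>v\<close>.\<close>

definition vsum :: "'v set set \<Rightarrow> ('v set \<Rightarrow> bit) \<Rightarrow> 'v \<Rightarrow> bit" where
  "vsum F z v = (\<Sum>e\<in>{e\<in>F. v \<in> e}. z e)"

lemma path_edges_append: "path_edges (xs @ a # ys) = path_edges (xs @ [a]) \<union> path_edges (a # ys)"
  by (induction xs rule: path_edges.induct) auto

lemma chain_append: "chain (xs @ a # ys) e = chain (xs @ [a]) e + chain (a # ys) e"
  by (induction xs e rule: chain.induct) (auto simp: add.assoc)

lemma path_edges_snoc2: "path_edges (xs @ [a, b]) = insert {a, b} (path_edges (xs @ [a]))"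
  using path_edges_append[of xs a "[b]"] by auto

lemma chain_snoc2: "chain (xs @ [a, b]) e = of_bool (e = {a, b}) + chain (xs @ [a]) e"
  using chain_append[of xs a "[b]"] by (simp add: add.commute)

lemma path_edges_rev: "path_edges (rev xs) = path_edges xs"
  by (induction xs rule: path_edges.induct) (auto simp: path_edges_snoc2 insert_commute)

lemma chain_rev: "chain (rev xs) e = chain xs e"
  by (induction xs e rule: chain.induct) (auto simp: chain_snoc2 insert_commute)

lemma path_edges_finite [simp]: "finite (path_edges xs)"
  by (induction xs rule: path_edges.induct) auto

lemma cycle_edges_finite [simp]: "finite (cycle_edges xs)"
  by (simp add: cycle_edges_def)

lemma path_edges_subset: "e \<in> path_edges xs \<Longrightarrow> e \<subseteq> set xs"
  by (induction xs rule: path_edges.induct) auto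

lemma Union_path_edges: "length xs \<ge> 2 \<Longrightarrow> \<Union> (path_edges xs) = set xs"
proof (induction xs rule: path_edges.induct)
  case (1 x y zs)
  then show ?case by (cases zs) auto
qed auto

lemma card_path_edges_elem: "distinct xs \<Longrightarrow> e \<in> path_edges xs \<Longrightarrow> card e = 2"
  by (induction xs rule: path_edges.induct) auto

lemma chain_zero: "e \<notin> path_edges xs \<Longrightarrow> chain xs e = 0"
  by (induction xs e rule: chain.induct) auto

lemma chain_distinct: "distinct xs \<Longrightarrow> chain xs e = of_bool (e \<in> path_edges xs)"
proof (induction xs e rule: chain.induct)
  case (1 x y zs e)
  have "{x, y} \<notin> path_edges (y # zs)" using path_edges_subset[of "{x, y}" "y # zs"] 1 by auto
  with 1 show ?case by auto
qed auto

lemma vsum_add: "vsum F (\<lambda>e. z e + w e) v = vsum F z v + vsum F w v"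
  by (simp add: vsum_def sum.distrib)

lemma vsum_cong: "(\<And>e. e \<in> F \<Longrightarrow> v \<in> e \<Longrightarrow> z e = w e) \<Longrightarrow> vsum F z v = vsum F w v"
  unfolding vsum_def by (rule sum.cong) auto

lemma vsum_mono_neutral:
  assumes "finite G" "F \<subseteq> G" "\<And>e. e \<in> G - F \<Longrightarrow> z e = 0"
  shows "vsum G z v = vsum F z v"
  unfolding vsum_def by (rule sum.mono_neutral_right) (use assms in auto)

lemma vsum_two: "{e\<in>F. v \<in> e} = {e1, e2} \<Longrightarrow> e1 \<noteq> e2 \<Longrightarrow> vsum F z v = z e1 + z e2"
  by (simp add: vsum_def)

lemma vsum_single:
  assumes "finite F" "{x, y} \<in> F" "x \<noteq> y"
  shows "vsum F (\<lambda>e. of_bool (e = {x, y})) v = of_bool (v = x) + of_bool (v = y)"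
proof -
  have "vsum F (\<lambda>e. of_bool (e = {x, y})) v = (\<Sum>e\<in>{e\<in>F. v \<in> e}. if e = {x, y} then 1 else 0)"
    unfolding vsum_def by (rule sum.cong) auto
  also have "\<dots> = of_bool (v \<in> {x, y})"
    using assms by (subst sum.delta) auto
  also have "\<dots> = of_bool (v = x) + of_bool (v = y)" using assms by auto
  finally show ?thesis .
qed

lemma vsum_chain:
  assumes "finite F" "path_edges xs \<subseteq> F" "\<And>e. e \<in> path_edges xs \<Longrightarrow> card e = 2" "xs \<noteq> []"
  shows "vsum F (chain xs) v = of_bool (v = hd xs) + of_bool (v = last xs)"
  using assms(2-)
proof (induction xs rule: path_edges.induct)
  case (1 x y zs)
  have xy: "x \<noteq> y" "{x, y} \<in> F" using 1(3)[of "{x, y}"] 1(2) by auto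
  have "vsum F (chain (x # y # zs)) v = vsum F (\<lambda>e. of_bool (e = {x, y}) + chain (y # zs) e) v"
    by (rule vsum_cong) simp
  also have "\<dots> = of_bool (v = x) + of_bool (v = y) + (of_bool (v = y) + of_bool (v = last (y # zs)))"
    using 1 unfolding vsum_add vsum_single[OF assms(1) xy(2,1)] by simp
  also have "\<dots> = of_bool (v = x) + of_bool (v = last (y # zs))" by (simp add: add.assoc)
  finally have "vsum F (chain (x # y # zs)) v = of_bool (v = x) + of_bool (v = last (y # zs))" .
  moreover have "hd (x # y # zs) = x" "last (x # y # zs) = last (y # zs)" by simp_all
  ultimately show ?case by (simp only:)
qed (auto simp: vsum_def)

lemma vsum_closed_chain:
  assumes "finite F" "path_edges (xs @ [hd xs]) \<subseteq> F" "\<And>e. e \<in> F \<Longrightarrow> card e = 2" "xs \<noteq> []"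
  shows "vsum F (chain (xs @ [hd xs])) v = 0"
  using vsum_chain[of F "xs @ [hd xs]" v] assms by auto

text \<open>Exactly two edges of the path meet at an inner vertex, and the condition there forces
  equal values on them.\<close>

lemma path_const:
  assumes "distinct xs" "\<And>v. v \<in> set (butlast (tl xs)) \<Longrightarrow> vsum (path_edges xs) z v = 0"
  shows "\<exists>k. \<forall>e\<in>path_edges xs. z e = k"
  using assms
proof (induction xs)
  case (Cons x xs)
  consider "xs = []" | y where "xs = [y]" | y w zs where "xs = y # w # zs"
    by (metis neq_Nil_conv)
  then show ?case
  proof cases
    case (3 y w zs)
    have y_out: "y \<notin> e" if "e \<in> path_edges (w # zs)" for e
      using path_edges_subset[OF that] Cons.prems(1) 3 by auto
    have "\<exists>k. \<forall>e\<in>path_edges xs. z e = k"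
    proof (rule Cons.IH)
      fix v assume v: "v \<in> set (butlast (tl xs))"
      then have "v \<in> set (tl xs)" by (rule in_set_butlastD)
      then have "v \<noteq> x" "v \<noteq> y" using Cons.prems(1) 3 by auto
      then have "vsum (path_edges xs) z v = vsum (path_edges (x # xs)) z v"
        unfolding vsum_def by (intro sum.cong) (auto simp: 3)
      also have "\<dots> = 0" using Cons.prems(2)[of v] v 3 by auto
      finally show "vsum (path_edges xs) z v = 0" .
    qed (use Cons.prems in auto)
    then obtain k where k: "\<forall>e\<in>path_edges xs. z e = k" ..
    have "{e \<in> path_edges (x # xs). y \<in> e} = {{x, y}, {y, w}}" using y_out by (auto simp: 3)
    moreover have "{x, y} \<noteq> {y, w}" using Cons.prems(1) 3 by (auto simp: doubleton_eq_iff)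
    ultimately have "vsum (path_edges (x # xs)) z y = z {x, y} + z {y, w}" by (rule vsum_two)
    then have "z {x, y} = z {y, w}" using Cons.prems(2)[of y] 3 by (simp add: bit_add_eq_0_iff)
    then show ?thesis using k 3 by (intro exI[of _ k]) auto
  qed auto
qed auto

lemma cycle_edges_rotate: "xs \<noteq> [] \<Longrightarrow> ys \<noteq> [] \<Longrightarrow> cycle_edges (xs @ ys) = cycle_edges (ys @ xs)"
proof -
  assume "xs \<noteq> []" "ys \<noteq> []"
  then obtain x xs' y ys' where "xs = x # xs'" "ys = y # ys'" by (meson neq_Nil_conv)
  then show ?thesis
    using path_edges_append[of "x # xs'" y "ys' @ [x]"] path_edges_append[of "y # ys'" x "xs' @ [y]"]
    by (simp add: cycle_edges_def Un_commute)
qed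

lemma chain_rotate:
  assumes "xs \<noteq> []" "ys \<noteq> []"
  shows "chain ((xs @ ys) @ [hd (xs @ ys)]) e = chain ((ys @ xs) @ [hd (ys @ xs)]) e"
proof -
  obtain x xs' y ys' where "xs = x # xs'" "ys = y # ys'" using assms by (meson neq_Nil_conv)
  then show ?thesis
    using chain_append[of "x # xs'" y "ys' @ [x]" e] chain_append[of "y # ys'" x "xs' @ [y]" e]
    by (simp add: add.commute)
qed

lemma cycle_edges_Cons: "xs \<noteq> [] \<Longrightarrow> cycle_edges (x # xs) = {{x, hd xs}, {last xs, x}} \<union> path_edges xs"
proof -
  assume "xs \<noteq> []"
  then obtain y ys where xs: "xs = y # ys" by (meson neq_Nil_conv)
  have "path_edges (xs @ [x]) = insert {last xs, x} (path_edges xs)"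
    using path_edges_snoc2[of "butlast xs" "last xs" x] xs
    by (metis append.assoc append_Cons append_Nil append_butlast_last_id list.distinct(1))
  moreover have "path_edges ((x # xs) @ [hd (x # xs)]) = insert {x, hd xs} (path_edges (xs @ [x]))"
    using xs by simp
  ultimately show ?thesis unfolding cycle_edges_def by auto
qed

lemma cycle_edges_degree:
  assumes "distinct xs" "length xs \<ge> 3" "v \<in> set xs"
  obtains e1 e2 where "e1 \<noteq> e2" "{e \<in> cycle_edges xs. v \<in> e} = {e1, e2}"
proof -
  obtain us vs where xs: "xs = us @ v # vs" using assms(3) by (meson split_list)
  define ys where "ys = vs @ us"
  have d: "distinct (v # ys)" "length ys \<ge> 2" using assms xs by (auto simp: ys_def)
  have "cycle_edges xs = cycle_edges (v # ys)"
    using cycle_edges_rotate[of us "v # vs"] by (cases us) (auto simp: xs ys_def)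
  also have "\<dots> = {{v, hd ys}, {last ys, v}} \<union> path_edges ys"
    using d by (intro cycle_edges_Cons) auto
  finally have ce: "cycle_edges xs = {{v, hd ys}, {last ys, v}} \<union> path_edges ys" .
  have "{e \<in> cycle_edges xs. v \<in> e} = {{v, hd ys}, {last ys, v}}"
    using path_edges_subset[of _ ys] d unfolding ce by auto
  moreover have "hd ys \<noteq> last ys" using d by (cases ys) auto
  then have "{v, hd ys} \<noteq> {last ys, v}" by (auto simp: doubleton_eq_iff)
  ultimately show thesis by (rule that[rotated])
qed

lemma Union_cycle_edges: "length xs \<ge> 2 \<Longrightarrow> \<Union> (cycle_edges xs) = set xs"
  using Union_path_edges[of "xs @ [hd xs]"] by (cases xs) (auto simp: cycle_edges_def)

lemma cycle_edges_last:
  assumes "distinct xs" "length xs \<ge> 3"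
  shows "cycle_edges xs = insert {last xs, hd xs} (path_edges xs)" "{last xs, hd xs} \<notin> path_edges xs"
proof -
  obtain x ys where xs: "xs = x # ys" "ys \<noteq> []" using assms by (cases xs) force+
  then have p: "path_edges xs = insert {x, hd ys} (path_edges ys)" by (cases ys) auto
  then show "cycle_edges xs = insert {last xs, hd xs} (path_edges xs)"
    using xs by (auto simp: cycle_edges_Cons)
  have "hd ys \<noteq> last ys" using assms xs by (cases ys) auto
  then show "{last xs, hd xs} \<notin> path_edges xs"
    using assms xs p path_edges_subset[of "{last ys, x}" ys] by (auto simp: doubleton_eq_iff)
qed

lemma card_cycle_edges_elem: "distinct xs \<Longrightarrow> length xs \<ge> 3 \<Longrightarrow> e \<in> cycle_edges xs \<Longrightarrow> card e = 2"
proof -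
  assume a: "distinct xs" "length xs \<ge> 3" "e \<in> cycle_edges xs"
  have "hd xs \<noteq> last xs" using a(1,2) by (cases xs) auto
  then show ?thesis using a card_path_edges_elem by (auto simp: cycle_edges_last)
qed

lemma chain_cycle:
  assumes "distinct xs" "length xs \<ge> 3"
  shows "chain (xs @ [hd xs]) e = of_bool (e \<in> cycle_edges xs)"
proof -
  have "xs \<noteq> []" using assms by auto
  then obtain ys where xs: "xs = ys @ [last xs]" by (metis append_butlast_last_id)
  have "chain (xs @ [hd xs]) e = of_bool (e = {last xs, hd xs}) + chain xs e"
    using chain_snoc2[of ys "last xs" "hd xs" e] xs by (metis append.assoc append_Cons append_Nil)
  then show ?thesis using cycle_edges_last[OF assms] chain_distinct[OF assms(1)] by auto
qed

text \<open>The cycle space of a single cycle has dimension one: \<open>path_const\<close> handles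
  all but the closing edge, which is compared at the first vertex.\<close>

lemma cycle_const:
  assumes "distinct xs" "length xs \<ge> 3" "\<And>v. v \<in> set xs \<Longrightarrow> vsum (cycle_edges xs) z v = 0"
  shows "\<exists>k. \<forall>e\<in>cycle_edges xs. z e = k"
proof -
  have vs: "vsum (path_edges xs) z v = 0" if v: "v \<in> set (butlast (tl xs))" for v
  proof -
    obtain x ys where xs: "xs = x # ys" "ys \<noteq> []" using assms(2) by (cases xs) force+
    then have "v \<in> set (butlast ys)" using v by simp
    moreover have "distinct (butlast ys @ [last ys])" using assms(1) xs by simp
    ultimately have "v \<noteq> last ys" "v \<in> set ys" by (auto dest: in_set_butlastD)
    then have "v \<noteq> last xs" "v \<noteq> hd xs" "v \<in> set xs" using assms(1) xs by auto
    then have "vsum (path_edges xs) z v = vsum (cycle_edges xs) z v"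
      unfolding vsum_def by (intro sum.cong) (auto simp: cycle_edges_last(1)[OF assms(1,2)])
    then show ?thesis using assms(3) \<open>v \<in> set xs\<close> by simp
  qed
  obtain k where k: "\<forall>e\<in>path_edges xs. z e = k" using path_const[OF assms(1) vs] by blast
  obtain x y ys where xs: "xs = x # y # ys" "ys \<noteq> []"
    using assms(2) by (cases xs rule: path_edges.cases) force+
  have "{e \<in> cycle_edges xs. x \<in> e} = {{x, y}, {last xs, x}}"
    using path_edges_subset[of _ "y # ys"] assms(1) by (auto simp: xs cycle_edges_Cons)
  moreover have "{x, y} \<noteq> {last xs, x}" using assms(1) xs by (auto simp: doubleton_eq_iff)
  ultimately have "vsum (cycle_edges xs) z x = z {x, y} + z {last xs, x}" by (rule vsum_two)
  then have "z {x, y} = z {last xs, x}" using assms(3)[of x] xs by (simp add: bit_add_eq_0_iff)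
  then show ?thesis using k xs cycle_edges_last(1)[OF assms(1,2)] by (intro exI[of _ k]) auto
qed

text \<open>Reduced homology of a path vanishes in degree 0: a set of vertices of even size can be
  paired off along the path.\<close>

lemma path_join:
  assumes "distinct xs" "xs \<noteq> []" "(\<Sum>v\<in>set xs. x v) = (0 :: bit)"
  shows "\<exists>z. (\<forall>e. e \<notin> path_edges xs \<longrightarrow> z e = 0) \<and> (\<forall>v\<in>set xs. vsum (path_edges xs) z v = x v)"
  using assms
proof (induction xs arbitrary: x rule: path_edges.induct)
  case (1 a b zs)
  \<comment> \<open>The weight at \<open>a\<close> is pushed across the first edge to
    \<open>b\<close>.\<close>
  define x' where "x' = x(b := x b + x a)"
  have "(\<Sum>v\<in>set (b # zs). x' v) = x' b + (\<Sum>v\<in>set zs. x' v)" using 1 by simp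
  also have "(\<Sum>v\<in>set zs. x' v) = (\<Sum>v\<in>set zs. x v)" using 1 by (intro sum.cong) (auto simp: x'_def)
  also have "x' b + \<dots> = (\<Sum>v\<in>set (a # b # zs). x v)" using 1(2) by (simp add: x'_def add_ac)
  finally have "(\<Sum>v\<in>set (b # zs). x' v) = 0" using 1 by simp
  then obtain z where z: "\<And>e. e \<notin> path_edges (b # zs) \<Longrightarrow> z e = 0"
    "\<And>v. v \<in> set (b # zs) \<Longrightarrow> vsum (path_edges (b # zs)) z v = x' v"
    using 1(1)[of x'] 1(2) by auto
  define w where "w e = z e + x a * of_bool (e = {a, b})" for e
  let ?F = "path_edges (a # b # zs)"
  have za: "z {a, b} = 0" using z(1)[of "{a, b}"] path_edges_subset[of "{a, b}" "b # zs"] 1(2) by auto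
  have "vsum ?F w v = x v" if v: "v \<in> set (a # b # zs)" for v
  proof -
    have "vsum ?F (\<lambda>e. x a * of_bool (e = {a, b})) v = x a * vsum ?F (\<lambda>e. of_bool (e = {a, b})) v"
      by (simp add: vsum_def sum_distrib_left)
    also have "vsum ?F (\<lambda>e. of_bool (e = {a, b})) v = of_bool (v = a) + of_bool (v = b)"
      using 1(2) by (intro vsum_single) (auto intro: path_edges_finite)
    finally have A: "vsum ?F (\<lambda>e. x a * of_bool (e = {a, b})) v = x a * (of_bool (v = a) + of_bool (v = b))" .
    have B: "vsum ?F z v = vsum (path_edges (b # zs)) z v"
      by (rule vsum_mono_neutral) (use za in auto)
    have "vsum (path_edges (b # zs)) z a = 0"
      unfolding vsum_def using path_edges_subset[of _ "b # zs"] 1(2) by (intro sum.neutral) force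
    then show ?thesis
      using A B z(2)[of v] v 1(2) unfolding w_def vsum_add by (auto simp: x'_def add.assoc)
  qed
  moreover have "w e = 0" if "e \<notin> ?F" for e using that z(1)[of e] by (auto simp: w_def)
  ultimately show ?case by blast
next
  case ("2_2" v)
  then show ?case by (intro exI[of _ "\<lambda>_. 0"]) (auto simp: vsum_def)
qed auto

section \<open>Homology of a triangulated sphere\<close>

section \<open>Tripods in triangulated spheres\<close>

definition tri_edges :: "'i set \<Rightarrow> ('i \<Rightarrow> 'v set) \<Rightarrow> 'v set set" where
  "tri_edges I tv = {e. card e = 2 \<and> (\<exists>i\<in>I. e \<subseteq> tv i)}"

text \<open>The boundary of the 2-chain \<open>y\<close>, evaluated at \<open>e\<close>.\<close>

definition tri_bd :: "'i set \<Rightarrow> ('i \<Rightarrow> 'v set) \<Rightarrow> ('i \<Rightarrow> bit) \<Rightarrow> 'v set \<Rightarrow> bit" where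
  "tri_bd I tv y e = (\<Sum>i\<in>{i\<in>I. e \<subseteq> tv i}. y i)"

text \<open>A triangulated sphere: assumption \<open>fills\<close> says that the first homology over the two-element field
  vanishes, and \<open>link\<close> says that vertex links are connected.\<close>

locale triangulation =
  fixes I :: "'i set" and tv :: "'i \<Rightarrow> 'v set" and t0 :: 'i and r :: 'v
  assumes fin: "finite I"
    and card_tv: "i \<in> I \<Longrightarrow> card (tv i) = 3"
    and two: "i \<in> I \<Longrightarrow> e \<subseteq> tv i \<Longrightarrow> card e = 2 \<Longrightarrow> card {j\<in>I. e \<subseteq> tv j} = 2"
    and fills: "(\<And>v. vsum (tri_edges I tv) x v = 0) \<Longrightarrow> \<exists>y. \<forall>e\<in>tri_edges I tv. x e = tri_bd I tv y e"
    and link: "(\<And>e. e \<in> tri_edges I tv \<Longrightarrow> v \<in> e \<Longrightarrow> tri_bd I tv y e = 0) \<Longrightarrow>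
      i \<in> I \<Longrightarrow> j \<in> I \<Longrightarrow> v \<in> tv i \<Longrightarrow> v \<in> tv j \<Longrightarrow> y i = y j"
    and conn: "i \<in> I \<Longrightarrow> v \<in> tv i \<Longrightarrow> (r, v) \<in> {(u, w). {u, w} \<in> tri_edges I tv}\<^sup>*"
    and t0: "t0 \<in> I" "r \<in> tv t0"
begin

abbreviation "Ed \<equiv> tri_edges I tv"
abbreviation "bd \<equiv> tri_bd I tv"
abbreviation "VT \<equiv> \<Union>(tv ` I)"

lemma edge_triangles:
  assumes "e \<in> Ed"
  obtains i j where "i \<in> I" "j \<in> I" "i \<noteq> j" "{k\<in>I. e \<subseteq> tv k} = {i, j}" "\<And>y. bd y e = y i + y j"
proof -
  obtain i where i: "i \<in> I" "e \<subseteq> tv i" "card e = 2" using assms by (auto simp: tri_edges_def)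
  then obtain a b where ab: "{k\<in>I. e \<subseteq> tv k} = {a, b}" "a \<noteq> b"
    using two[OF i] by (auto simp: card_2_iff)
  then have "a \<in> I" "b \<in> I" by blast+
  moreover have "bd y e = y a + y b" for y unfolding tri_bd_def ab(1) using ab(2) by simp
  ultimately show thesis using that ab by blast
qed

lemma finite_tv: "i \<in> I \<Longrightarrow> finite (tv i)"
  using card_tv[of i] by (metis card.infinite zero_neq_numeral)

lemma finite_VT: "finite VT"
  using fin finite_tv by blast

lemma finite_Ed: "finite Ed"
proof (rule finite_subset)
  show "Ed \<subseteq> Pow VT" by (auto simp: tri_edges_def)
qed (use finite_VT in simp)

lemma card_Ed: "e \<in> Ed \<Longrightarrow> card e = 2"
  by (simp add: tri_edges_def)

lemma edgeI: "i \<in> I \<Longrightarrow> u \<in> tv i \<Longrightarrow> w \<in> tv i \<Longrightarrow> u \<noteq> w \<Longrightarrow> {u, w} \<in> Ed"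
  by (auto simp: tri_edges_def)

lemma edgeE:
  assumes "{u, w} \<in> Ed"
  obtains i where "i \<in> I" "u \<in> tv i" "w \<in> tv i" "u \<noteq> w"
proof -
  obtain i where i: "i \<in> I" "{u, w} \<subseteq> tv i" "card {u, w} = 2" using assms by (auto simp: tri_edges_def)
  from i(3) have "u \<noteq> w" by auto
  with i that show thesis by blast
qed

lemma edge_VT: "{u, w} \<in> Ed \<Longrightarrow> u \<in> VT \<and> w \<in> VT"
  by (elim edgeE) auto

lemma tri_sum:
  assumes "i \<in> I" "tv i = {x, y, z}" "x \<noteq> y" "y \<noteq> z" "x \<noteq> z"
  shows "(\<Sum>e\<in>{e\<in>Ed. e \<subseteq> tv i}. f e) = f {x, y} + f {y, z} + (f {x, z} :: bit)"
proof -
  have "{e\<in>Ed. e \<subseteq> tv i} = {{x, y}, {y, z}, {x, z}}" (is "?L = ?R")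
  proof
    show "?R \<subseteq> ?L" using assms edgeI[OF assms(1)] by auto
    show "?L \<subseteq> ?R"
    proof
      fix e assume "e \<in> ?L"
      then have "card e = 2" "e \<subseteq> {x, y, z}" using card_Ed assms(2) by auto
      then show "e \<in> ?R" by (auto simp: card_2_iff)
    qed
  qed
  moreover have "{x, y} \<noteq> {y, z}" "{x, y} \<noteq> {x, z}" "{y, z} \<noteq> {x, z}"
    using assms by (auto simp: doubleton_eq_iff)
  ultimately show ?thesis by (simp add: add.assoc)
qed

text \<open>Double counting of pairs of a triangle and a side: the boundary is the transpose of
  summing \<open>f\<close> over the sides of a triangle. This yields both that boundaries are cycles
  and the parity count in Sperner's lemma.\<close>

lemma sum_bd:
  "(\<Sum>e\<in>Ed. f e * bd y e) = (\<Sum>i\<in>I. y i * (\<Sum>e\<in>{e\<in>Ed. e \<subseteq> tv i}. f e))"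
proof -
  have "(\<Sum>e\<in>Ed. f e * bd y e) = (\<Sum>e\<in>Ed. \<Sum>i\<in>I. if e \<subseteq> tv i then f e * y i else 0)"
    by (simp only: tri_bd_def sum_distrib_left sum.inter_filter[OF fin]) (intro sum.cong refl, simp)
  also have "\<dots> = (\<Sum>i\<in>I. \<Sum>e\<in>Ed. if e \<subseteq> tv i then f e * y i else 0)" by (rule sum.swap)
  also have "\<dots> = (\<Sum>i\<in>I. y i * (\<Sum>e\<in>{e\<in>Ed. e \<subseteq> tv i}. f e))"
  proof (rule sum.cong[OF refl])
    fix i
    have "(\<Sum>e\<in>Ed. if e \<subseteq> tv i then f e * y i else 0) = (\<Sum>e\<in>{e\<in>Ed. e \<subseteq> tv i}. f e * y i)"
      by (simp only: sum.inter_filter[OF finite_Ed])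
    then show "(\<Sum>e\<in>Ed. if e \<subseteq> tv i then f e * y i else 0) = y i * (\<Sum>e\<in>{e\<in>Ed. e \<subseteq> tv i}. f e)"
      by (simp add: sum_distrib_left mult.commute)
  qed
  finally show ?thesis .
qed

lemma tv_cases:
  assumes "i \<in> I"
  obtains x y z where "tv i = {x, y, z}" "x \<noteq> y" "y \<noteq> z" "x \<noteq> z"
  using card_tv[OF assms] by (auto simp: card_3_iff)

lemma vsum_bd: "vsum Ed (bd y) v = 0"
proof -
  have "vsum Ed (bd y) v = (\<Sum>e\<in>Ed. of_bool (v \<in> e) * bd y e)"
    unfolding vsum_def by (subst sum.inter_filter[OF finite_Ed]) (intro sum.cong, auto)
  also have "\<dots> = (\<Sum>i\<in>I. y i * (\<Sum>e\<in>{e\<in>Ed. e \<subseteq> tv i}. of_bool (v \<in> e)))" by (rule sum_bd)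
  also have "\<dots> = 0"
  proof (rule sum.neutral, rule ballI)
    fix i assume "i \<in> I"
    then obtain a b c where t: "tv i = {a, b, c}" "a \<noteq> b" "b \<noteq> c" "a \<noteq> c" by (rule tv_cases)
    have "(\<Sum>e\<in>{e\<in>Ed. e \<subseteq> tv i}. of_bool (v \<in> e)) = (0 :: bit)"
      unfolding tri_sum[OF \<open>i \<in> I\<close> t] using t(2-) by auto
    then show "y i * (\<Sum>e\<in>{e\<in>Ed. e \<subseteq> tv i}. of_bool (v \<in> e)) = 0" by simp
  qed
  finally show ?thesis .
qed

lemma bd_add: "bd (\<lambda>i. y i + z i) e = bd y e + bd z e"
  by (simp add: tri_bd_def sum.distrib)

lemma bd_const: "e \<in> Ed \<Longrightarrow> bd (\<lambda>_. c) e = 0"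
  by (elim edge_triangles) simp

lemma bd_single:
  assumes "i \<in> I"
  shows "bd (\<lambda>j. of_bool (j = i)) e = of_bool (e \<subseteq> tv i)"
proof -
  have "bd (\<lambda>j. of_bool (j = i)) e = (\<Sum>j\<in>{j\<in>I. e \<subseteq> tv j}. if j = i then 1 else 0)"
    unfolding tri_bd_def by (rule sum.cong) auto
  also have "\<dots> = of_bool (e \<subseteq> tv i)"
    using assms fin by (subst sum.delta) auto
  finally show ?thesis .
qed

text \<open>By \<open>link\<close> the chain is constant around each vertex, and adjacent vertices
  share a triangle. Hence a 2-chain is determined by its boundary and its value at
  \<open>t0\<close>.\<close>

lemma closed_const:
  assumes "\<And>e. e \<in> Ed \<Longrightarrow> bd y e = 0" "i \<in> I"
  shows "y i = y t0"
proof -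
  have "\<forall>k\<in>I. v \<in> tv k \<longrightarrow> y k = y t0" if "(r, v) \<in> {(u, w). {u, w} \<in> Ed}\<^sup>*" for v
    using that
  proof induction
    case base
    then show ?case using link[of r y] assms(1) t0 by blast
  next
    case (step u w)
    then have "{u, w} \<in> Ed" by simp
    then obtain k where "k \<in> I" "u \<in> tv k" "w \<in> tv k" by (elim edgeE) blast
    then show ?case using step link[of w y] assms(1) by metis
  qed
  moreover obtain v where "v \<in> tv i" using card_tv[OF assms(2)] by fastforce
  ultimately show ?thesis using conn assms(2) by blast
qed

section \<open>Breadth-first levels and paths to the root\<close>

definition level :: "'v \<Rightarrow> nat" where
  "level v = (LEAST n. (r, v) \<in> {(u, w). {u, w} \<in> Ed} ^^ n)"

definition par :: "'v \<Rightarrow> 'v" where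
  "par v = (SOME w. {v, w} \<in> Ed \<and> level v = Suc (level w))"

lemma level_reach: "v \<in> VT \<Longrightarrow> (r, v) \<in> {(u, w). {u, w} \<in> Ed} ^^ level v"
proof -
  assume "v \<in> VT"
  then have "(r, v) \<in> {(u, w). {u, w} \<in> Ed}\<^sup>*" using conn by blast
  then obtain n where "(r, v) \<in> {(u, w). {u, w} \<in> Ed} ^^ n" by (metis rtrancl_imp_relpow)
  then show ?thesis unfolding level_def by (rule LeastI)
qed

lemma level_le: "(r, v) \<in> {(u, w). {u, w} \<in> Ed} ^^ n \<Longrightarrow> level v \<le> n"
  unfolding level_def by (rule Least_le)

lemma level_root [simp]: "level r = 0"
  using level_le[of r 0] by simp

lemma level_edge: "{u, w} \<in> Ed \<Longrightarrow> level w \<le> Suc (level u)"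
proof -
  assume e: "{u, w} \<in> Ed"
  then have "(r, u) \<in> {(u, w). {u, w} \<in> Ed} ^^ level u" using edge_VT level_reach by blast
  with e have "(r, w) \<in> {(u, w). {u, w} \<in> Ed} ^^ Suc (level u)" by auto
  then show ?thesis by (rule level_le)
qed

lemma par:
  assumes "v \<in> VT" "v \<noteq> r"
  shows "{v, par v} \<in> Ed" "level v = Suc (level (par v))"
proof -
  have "level v \<noteq> 0" using level_reach[OF assms(1)] assms(2) by (cases "level v") auto
  then obtain n where n: "level v = Suc n" by (cases "level v") auto
  then obtain w where w: "(r, w) \<in> {(u, w). {u, w} \<in> Ed} ^^ n" "{w, v} \<in> Ed"
    using level_reach[OF assms(1)] by auto
  have "level w = n" using level_le[OF w(1)] level_edge[OF w(2)] n by simp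
  with w n have "\<exists>w. {v, w} \<in> Ed \<and> level v = Suc (level w)" by (auto simp: insert_commute)
  then have "{v, par v} \<in> Ed \<and> level v = Suc (level (par v))" unfolding par_def by (rule someI_ex)
  then show "{v, par v} \<in> Ed" "level v = Suc (level (par v))" by auto
qed

text \<open>The breadth-first path from \<open>v\<close> towards the root, stopped before its first vertex \<open>hit Z v\<close> in \<open>Z\<close>.\<close>

definition leg :: "'v set \<Rightarrow> 'v \<Rightarrow> 'v list" where
  "leg Z v = map (\<lambda>i. (par ^^ i) v) [0..<(LEAST n. (par ^^ n) v \<in> Z)]"

definition hit :: "'v set \<Rightarrow> 'v \<Rightarrow> 'v" where
  "hit Z v = (par ^^ (LEAST n. (par ^^ n) v \<in> Z)) v"

lemma leg_in: "v \<in> Z \<Longrightarrow> leg Z v = []" and hit_in: "v \<in> Z \<Longrightarrow> hit Z v = v"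
proof -
  assume "v \<in> Z"
  then have "(LEAST n. (par ^^ n) v \<in> Z) = 0" by (intro Least_equality) auto
  then show "leg Z v = []" "hit Z v = v" by (simp_all add: leg_def hit_def)
qed

lemma reach_root: "v \<in> VT \<Longrightarrow> \<exists>n. (par ^^ n) v = r"
proof (induction "level v" arbitrary: v rule: less_induct)
  case less
  show ?case
  proof (cases "v = r")
    case True
    then show ?thesis by (intro exI[of _ 0]) simp
  next
    case False
    have "par v \<in> VT" "level (par v) < level v" using par[OF less.prems False] edge_VT by auto
    then obtain n where "(par ^^ n) (par v) = r" using less.hyps by blast
    then show ?thesis by (intro exI[of _ "Suc n"]) (simp add: funpow_Suc_right del: funpow.simps)
  qed
qed

context
  fixes Z
  assumes rZ: "r \<in> Z"
begin

lemma leg_hit_step: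
  assumes "v \<in> VT" "v \<notin> Z"
  shows "leg Z v = v # leg Z (par v)" "hit Z v = hit Z (par v)"
proof -
  obtain n where "(par ^^ n) v \<in> Z" using reach_root[OF assms(1)] rZ by metis
  then have L: "(LEAST n. (par ^^ n) v \<in> Z) = Suc (LEAST n. (par ^^ Suc n) v \<in> Z)"
    by (rule Least_Suc) (use assms in simp)
  show "leg Z v = v # leg Z (par v)" "hit Z v = hit Z (par v)"
    unfolding leg_def hit_def L funpow_Suc_right comp_def
    by (simp_all add: upt_conv_Cons map_Suc_upt[symmetric] funpow_Suc_right del: upt_Suc funpow.simps)
qed

lemma out_step:
  assumes "v \<in> VT" "v \<notin> Z"
  shows "par v \<in> VT" "level (par v) < level v" "{v, par v} \<in> Ed"
proof -
  have "v \<noteq> r" using assms rZ by auto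
  from par[OF assms(1) this] show "level (par v) < level v" and e: "{v, par v} \<in> Ed" by auto
  show "par v \<in> VT" using edge_VT[OF e] ..
qed

lemma leg_induct [consumes 1, case_names inside outside]:
  assumes "v \<in> VT" "\<And>v. v \<in> VT \<Longrightarrow> v \<in> Z \<Longrightarrow> P v"
    "\<And>v. v \<in> VT \<Longrightarrow> v \<notin> Z \<Longrightarrow> P (par v) \<Longrightarrow> P v"
  shows "P v"
  using assms(1)
proof (induction "level v" arbitrary: v rule: less_induct)
  case less
  then show ?case using assms(2,3) out_step by (cases "v \<in> Z") auto
qed

text \<open>Injectivity of \<open>level\<close> on a leg limits a tripod to three vertices per
  level; constancy of \<open>hit\<close> makes legs with different feet disjoint. The list with its
  foot appended is a path starting at \<open>v\<close>, even when the leg is empty.\<close>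

lemma leg_props:
  "v \<in> VT \<Longrightarrow> set (leg Z v) \<subseteq> VT - Z \<and> (\<forall>w\<in>set (leg Z v). hit Z w = hit Z v \<and> level w \<le> level v) \<and>
     distinct (leg Z v) \<and> inj_on level (set (leg Z v)) \<and> path_edges (leg Z v @ [hit Z v]) \<subseteq> Ed \<and>
     hd (leg Z v @ [hit Z v]) = v"
proof (induction rule: leg_induct)
  case (inside v)
  then show ?case by (simp add: leg_in hit_in)
next
  case (outside v)
  note s = leg_hit_step[OF outside(1,2)] out_step[OF outside(1,2)]
  have lt: "\<forall>w\<in>set (leg Z (par v)). level w < level v" using outside(3) s(4) by fastforce
  have "path_edges (v # leg Z (par v) @ [hit Z (par v)]) \<subseteq> Ed"
  proof (cases "leg Z (par v) @ [hit Z (par v)]")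
    case (Cons x xs)
    then have "x = par v" using outside(3) by (metis list.sel(1))
    then show ?thesis using outside(3) s(5) Cons by simp
  qed simp
  then have "path_edges (leg Z v @ [hit Z v]) \<subseteq> Ed" using s(1,2) by simp
  moreover have "set (leg Z v) \<subseteq> VT - Z" using outside unfolding s(1) by simp
  moreover have "\<forall>w\<in>set (leg Z v). hit Z w = hit Z v \<and> level w \<le> level v"
    using outside(3) lt s(2) unfolding s(1) by (metis less_imp_le order_refl set_ConsD)
  moreover have "distinct (leg Z v)" using outside(3) lt unfolding s(1) by fastforce
  moreover have "level v \<notin> level ` set (leg Z (par v))" using lt by force
  then have "inj_on level (set (leg Z v))"
    using outside(3) unfolding s(1) list.set(2) inj_on_insert by blast
  moreover have "hd (leg Z v @ [hit Z v]) = v" unfolding s(1) by simp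
  ultimately show ?case by blast
qed

end

end

lemma chain_join:
  "xs \<noteq> [] \<Longrightarrow> ys \<noteq> [] \<Longrightarrow> chain (xs @ ys) e = chain xs e + of_bool (e = {last xs, hd ys}) + chain ys e"
proof -
  assume "xs \<noteq> []" "ys \<noteq> []"
  then obtain xs' x y ys' where s: "xs = xs' @ [x]" "ys = y # ys'" by (metis neq_Nil_conv rev_exhaust)
  then have "chain (xs @ ys) e = chain (xs' @ [x]) e + chain (x # y # ys') e"
    using chain_append[of xs' x "y # ys'"] by simp
  then show ?thesis by (simp add: s add.assoc)
qed

lemma path_edges_join:
  "xs \<noteq> [] \<Longrightarrow> ys \<noteq> [] \<Longrightarrow> path_edges (xs @ ys) = path_edges xs \<union> {{last xs, hd ys}} \<union> path_edges ys"
proof -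
  assume "xs \<noteq> []" "ys \<noteq> []"
  then obtain xs' x y ys' where s: "xs = xs' @ [x]" "ys = y # ys'" by (metis neq_Nil_conv rev_exhaust)
  then have "path_edges (xs @ ys) = path_edges (xs' @ [x]) \<union> path_edges (x # y # ys')"
    using path_edges_append[of xs' x "y # ys'"] by simp
  then show ?thesis by (auto simp: s)
qed

lemma path_edges_meets: "e \<in> path_edges (xs @ [b]) \<Longrightarrow> e \<inter> set xs \<noteq> {}"
proof (induction xs)
  case (Cons x xs)
  then show ?case by (cases xs) auto
qed simp

text \<open>The feet \<open>b1\<close>, \<open>b2\<close>, \<open>b3\<close> of a tripod cut the
  boundary cycle into three arcs, the last of which runs through the start of the list.\<close>

lemma cycle_edges_three:
  assumes "W = S1 @ b1 # R1 @ S2 @ b2 # R2 @ S3 @ b3 # R3"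
  shows "cycle_edges W = path_edges (b1 # R1 @ S2 @ [b2]) \<union> path_edges (b2 # R2 @ S3 @ [b3]) \<union>
      path_edges (b3 # R3 @ S1 @ [b1])"
    and "chain (W @ [hd W]) e = chain (b1 # R1 @ S2 @ [b2]) e + chain (b2 # R2 @ S3 @ [b3]) e +
      chain (b3 # R3 @ S1 @ [b1]) e"
proof -
  define V where "V = b1 # R1 @ S2 @ b2 # R2 @ S3 @ b3 # R3"
  have W: "W = S1 @ V" "V \<noteq> []" by (simp_all add: V_def assms)
  have "cycle_edges W = cycle_edges (V @ S1)"
    unfolding W(1) using cycle_edges_rotate[of S1 V] W(2) by (cases "S1 = []") simp_all
  also have "\<dots> = path_edges ((b1 # R1 @ S2) @ [b2]) \<union> (path_edges ((b2 # R2 @ S3) @ [b3]) \<union>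
      path_edges (b3 # (R3 @ S1 @ [b1])))"
    using path_edges_append[of "b1 # R1 @ S2" b2 "R2 @ S3 @ b3 # (R3 @ S1 @ [b1])"]
      path_edges_append[of "b2 # R2 @ S3" b3 "R3 @ S1 @ [b1]"]
    by (simp add: cycle_edges_def V_def)
  finally show "cycle_edges W = path_edges (b1 # R1 @ S2 @ [b2]) \<union> path_edges (b2 # R2 @ S3 @ [b3]) \<union>
      path_edges (b3 # R3 @ S1 @ [b1])" by (simp add: Un_assoc)
  have "chain (W @ [hd W]) e = chain ((V @ S1) @ [hd (V @ S1)]) e"
    unfolding W(1) using chain_rotate[of S1 V e] W(2) by (cases "S1 = []") simp_all
  also have "\<dots> = chain ((b1 # R1 @ S2) @ [b2]) e + (chain ((b2 # R2 @ S3) @ [b3]) e +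
      chain (b3 # (R3 @ S1 @ [b1])) e)"
    using chain_append[of "b1 # R1 @ S2" b2 "R2 @ S3 @ b3 # (R3 @ S1 @ [b1])" e]
      chain_append[of "b2 # R2 @ S3" b3 "R3 @ S1 @ [b1]" e]
    by (simp add: V_def)
  finally show "chain (W @ [hd W]) e = chain (b1 # R1 @ S2 @ [b2]) e + chain (b2 # R2 @ S3 @ [b3]) e +
      chain (b3 # R3 @ S1 @ [b1]) e" by (simp add: add.assoc)
qed

section \<open>Disks as 2-chains and their division by a tripod\<close>

context triangulation
begin

text \<open>The support of \<open>y\<close> is the disk with boundary cycle \<open>W\<close> that avoids the outer triangle \<open>t0\<close>. A single
  edge counts as a cycle \<open>W\<close> of length 2 and bounds the empty disk.\<close>

definition bounded_by :: "('i \<Rightarrow> bit) \<Rightarrow> 'v list \<Rightarrow> bool" where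
  "bounded_by y W \<longleftrightarrow> distinct W \<and> W \<noteq> [] \<and> cycle_edges W \<subseteq> Ed \<and>
     (\<forall>e\<in>Ed. bd y e = chain (W @ [hd W]) e) \<and> y t0 = 0"

definition inner :: "('i \<Rightarrow> bit) \<Rightarrow> 'v list \<Rightarrow> 'v set" where
  "inner y W = {v. v \<notin> set W \<and> (\<exists>i\<in>I. y i = 1 \<and> v \<in> tv i)}"

lemma bounded_by_rotate: "bounded_by y (xs @ ys) \<Longrightarrow> bounded_by y (ys @ xs)"
  unfolding bounded_by_def
  by (cases "xs = []"; cases "ys = []") (simp_all add: cycle_edges_rotate[of xs ys] chain_rotate[of xs ys, simplified] Int_commute)

text \<open>No boundary edge meets a vertex off \<open>W\<close>, so \<open>link\<close> applies:
  such a vertex is entirely inside or entirely outside.\<close>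

lemma star_const:
  assumes "bounded_by y W" "v \<notin> set W" "i \<in> I" "j \<in> I" "v \<in> tv i" "v \<in> tv j"
  shows "y i = y j"
proof (rule link[OF _ assms(3-6)])
  fix e assume e: "e \<in> Ed" "v \<in> e"
  then have "e \<notin> path_edges (W @ [hd W])"
  proof -
    have "hd W \<in> set W" using assms(1) by (simp add: bounded_by_def)
    then have "v \<notin> set (W @ [hd W])" using assms(2) by auto
    then show ?thesis using path_edges_subset[of e "W @ [hd W]"] e(2) by blast
  qed
  then show "bd y e = 0" using assms(1) e chain_zero by (auto simp: bounded_by_def)
qed

lemma inner_neighbour:
  assumes "bounded_by y W" "v \<in> inner y W" "{v, w} \<in> Ed"
  shows "w \<in> inner y W \<union> set W"
proof -
  obtain i where i: "i \<in> I" "v \<in> tv i" "w \<in> tv i" using assms(3) by (elim edgeE)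
  obtain j where j: "j \<in> I" "y j = 1" "v \<in> tv j" "v \<notin> set W" using assms(2) by (auto simp: inner_def)
  have "y i = 1" using star_const[OF assms(1) j(4) i(1) j(1) i(2) j(3)] j(2) by simp
  then show ?thesis using i by (auto simp: inner_def)
qed

lemma bd_cycle: "bounded_by y W \<Longrightarrow> length W \<ge> 3 \<Longrightarrow> e \<in> Ed \<Longrightarrow> bd y e = of_bool (e \<in> cycle_edges W)"
  by (simp add: bounded_by_def chain_cycle)

lemma boundary_outside:
  assumes "bounded_by y W" "length W \<ge> 3" "v \<in> set W"
  shows "\<exists>i\<in>I. v \<in> tv i \<and> y i = 0"
proof -
  have "distinct W" using assms(1) by (simp add: bounded_by_def)
  then obtain e1 e2 where "{e \<in> cycle_edges W. v \<in> e} = {e1, e2}" using cycle_edges_degree assms by metis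
  then have e: "e1 \<in> cycle_edges W" "v \<in> e1" by auto
  then have "e1 \<in> Ed" using assms(1) by (auto simp: bounded_by_def)
  then obtain i j where ij: "i \<in> I" "j \<in> I" "{k\<in>I. e1 \<subseteq> tv k} = {i, j}" "bd y e1 = y i + y j"
    by (metis edge_triangles)
  then have "y i + y j = 1" using bd_cycle[OF assms(1,2) \<open>e1 \<in> Ed\<close>] e by simp
  then have "y i = 0 \<or> y j = 0" by (cases "y i"; cases "y j") auto
  moreover have "v \<in> tv i" "v \<in> tv j" using ij(3) e(2) by blast+
  ultimately show ?thesis using ij(1,2) by blast
qed

text \<open>The boundary of \<open>z\<close> is a cycle supported on \<open>W\<close>, hence empty
  or all of \<open>W\<close>. The value at \<open>t0\<close> then decides between \<open>0\<close>
  and \<open>y\<close>.\<close>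

lemma circuit:
  assumes "bounded_by y W" "length W \<ge> 3" "z t0 = 0" "\<And>e. e \<in> Ed \<Longrightarrow> e \<notin> cycle_edges W \<Longrightarrow> bd z e = 0"
  shows "(\<forall>i\<in>I. z i = 0) \<or> (\<forall>i\<in>I. z i = y i)"
proof -
  have W: "distinct W" "cycle_edges W \<subseteq> Ed" "y t0 = 0" using assms(1) by (auto simp: bounded_by_def)
  have "vsum (cycle_edges W) (bd z) v = 0" for v
    using vsum_mono_neutral[OF finite_Ed W(2), of "bd z" v] assms(4) vsum_bd by auto
  then obtain k where k: "\<forall>e\<in>cycle_edges W. bd z e = k" using cycle_const[OF W(1) assms(2)] by blast
  show ?thesis
  proof (cases "k = 0")
    case True
    then have "bd z e = 0" if "e \<in> Ed" for e using that k assms(4) by blast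
    then show ?thesis using closed_const[of z] assms(3) by simp
  next
    case False
    have "bd (\<lambda>i. z i + y i) e = 0" if "e \<in> Ed" for e
      using that k False assms(4) bd_cycle[OF assms(1,2) that] unfolding bd_add by (cases "e \<in> cycle_edges W") auto
    then have "z i + y i = 0" if "i \<in> I" for i
      using closed_const[of "\<lambda>i. z i + y i", OF _ that] assms(3) W(3) by simp
    then show ?thesis by (simp add: bit_add_eq_0_iff)
  qed
qed

context
  fixes Z
  assumes rZ: "r \<in> Z"
begin

text \<open>A step from the interior leads to the interior or to \<open>W\<close>, so the path to
  the root cannot leave the disk without meeting \<open>W\<close>, and it meets no other vertex of
  \<open>Z\<close> before.\<close>

lemma hit_disk:
  assumes "bounded_by y W" "set W \<subseteq> Z" "Z \<subseteq> VT" "inner y W \<inter> Z = {}" "v \<in> inner y W \<union> set W"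
  shows "hit Z v \<in> set W \<and> set (leg Z v) \<subseteq> inner y W"
proof -
  have "v \<in> VT" using assms(2,3,5) by (auto simp: inner_def)
  then show ?thesis using assms(5)
  proof (induction rule: leg_induct[OF rZ, consumes 1, case_names inside outside])
    case (inside v)
    then show ?case using assms(4) by (auto simp: hit_in leg_in)
  next
    case (outside v)
    then have v: "v \<in> inner y W" using assms(2) by blast
    then have "par v \<in> inner y W \<union> set W"
      using inner_neighbour[OF assms(1) v] out_step[OF rZ outside(1,2)] by blast
    then show ?case using outside v leg_hit_step[OF rZ outside(1,2)] by simp
  qed
qed

text \<open>Colour a vertex by the arc that contains its \<open>hit\<close>. The only boundary edge
  with colours 1 and 2 joins \<open>last P1\<close> to \<open>hd P2\<close>, so by
  \<open>sum_bd\<close> some triangle of the disk has an odd number of such edges. A triangle with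
  colours 1 and 2 only has an even number of them.\<close>

lemma sperner:
  assumes b: "bounded_by y (P1 @ P2 @ P3)" and ne: "P1 \<noteq> []" "P2 \<noteq> []" "P3 \<noteq> []"
    and Z: "set (P1 @ P2 @ P3) \<subseteq> Z" "Z \<subseteq> VT" and iZ: "inner y (P1 @ P2 @ P3) \<inter> Z = {}"
  obtains i a1 a2 a3 where "i \<in> I" "y i = 1" "tv i = {a1, a2, a3}" "hit Z a1 \<in> set P1" "hit Z a2 \<in> set P2" "hit Z a3 \<in> set P3"
proof -
  let ?W = "P1 @ P2 @ P3"
  define K where "K P = {v. hit Z v \<in> set P}" for P
  have dW: "distinct ?W" using b by (simp add: bounded_by_def)
  have lW: "length ?W \<ge> 3" using ne by (cases P1; cases P2; cases P3) auto
  have K_disj: "v \<notin> K P2" "v \<notin> K P3" if "v \<in> K P1" for v using that dW by (auto simp: K_def)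
  have K_disj': "v \<notin> K P3" if "v \<in> K P2" for v using that dW by (auto simp: K_def)
  define C where "C e = (\<exists>u w. e = {u, w} \<and> u \<in> K P1 \<and> w \<in> K P2)" for e
  have C_pair: "C {u, w} \<longleftrightarrow> u \<in> K P1 \<and> w \<in> K P2 \<or> w \<in> K P1 \<and> u \<in> K P2" for u w
    unfolding C_def by (auto simp: doubleton_eq_iff)
  have K_W: "v \<in> K P \<longleftrightarrow> v \<in> set P" if "v \<in> set ?W" for v P
  proof -
    have "v \<in> Z" using that Z(1) by blast
    then show ?thesis by (simp add: K_def hit_in)
  qed
  have C_W: "C e \<longleftrightarrow> e = {last P1, hd P2}" if e: "e \<in> cycle_edges ?W" for e
  proof -
    have ce: "cycle_edges ?W = path_edges P1 \<union> {{last P1, hd P2}} \<union> path_edges P2 \<union> {{last P2, hd P3}} \<union>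
        path_edges P3 \<union> {{last P3, hd P1}}"
      using ne unfolding cycle_edges_def by (simp add: path_edges_join insert_commute Un_ac)
    have ends: "last P1 \<in> set P1" "hd P1 \<in> set P1" "last P2 \<in> set P2" "hd P2 \<in> set P2" "last P3 \<in> set P3" "hd P3 \<in> set P3"
      using ne by auto
    have sub: "C e' \<Longrightarrow> e' \<subseteq> set ?W \<Longrightarrow> e' \<inter> set P1 \<noteq> {} \<and> e' \<inter> set P2 \<noteq> {} \<and> e' \<inter> set P3 = {}" for e'
    proof -
      assume "C e'" "e' \<subseteq> set ?W"
      then obtain u w where "e' = {u, w}" "u \<in> set P1" "w \<in> set P2" unfolding C_def using K_W by auto
      then show ?thesis using dW by auto
    qed
    have "C {last P1, hd P2}" unfolding C_pair using K_W ends by auto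
    moreover have "e = {last P1, hd P2}" if "C e"
    proof -
      have s: "e \<subseteq> set ?W" using ce e path_edges_subset[of e] ends by auto
      note t = sub[OF that s]
      have "e \<notin> path_edges P1" "e \<notin> path_edges P2" "e \<notin> path_edges P3"
        using t path_edges_subset[of e] dW by fastforce+
      then show ?thesis using t ends e unfolding ce by auto
    qed
    ultimately show ?thesis by auto
  qed
  have "(\<Sum>e\<in>Ed. of_bool (C e) * bd y e) = (\<Sum>e\<in>Ed. if e = {last P1, hd P2} then 1 else 0)"
  proof (rule sum.cong[OF refl])
    fix e assume e: "e \<in> Ed"
    have "{last P1, hd P2} \<in> cycle_edges ?W"
      using ne unfolding cycle_edges_def by (simp add: path_edges_join)
    then show "of_bool (C e) * bd y e = (if e = {last P1, hd P2} then 1 else 0)"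
      using C_W[of e] bd_cycle[OF b lW e] by auto
  qed
  also have "\<dots> = 1"
  proof -
    have "{last P1, hd P2} \<in> cycle_edges ?W"
      using ne unfolding cycle_edges_def by (simp add: path_edges_join)
    then have "{last P1, hd P2} \<in> Ed" using b by (auto simp: bounded_by_def)
    then show ?thesis by (simp add: finite_Ed)
  qed
  finally have "(\<Sum>i\<in>I. y i * (\<Sum>e\<in>{e\<in>Ed. e \<subseteq> tv i}. of_bool (C e))) = 1" by (simp add: sum_bd)
  then have "(\<Sum>i\<in>I. y i * (\<Sum>e\<in>{e\<in>Ed. e \<subseteq> tv i}. of_bool (C e))) \<noteq> 0" by simp
  then obtain i where i: "i \<in> I" "y i * (\<Sum>e\<in>{e\<in>Ed. e \<subseteq> tv i}. of_bool (C e)) \<noteq> 0"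
    by (rule sum.not_neutral_contains_not_neutral)
  then have yi: "y i = 1" and odd: "(\<Sum>e\<in>{e\<in>Ed. e \<subseteq> tv i}. of_bool (C e)) = (1 :: bit)" by auto
  obtain a b c where t: "tv i = {a, b, c}" "a \<noteq> b" "b \<noteq> c" "a \<noteq> c" using tv_cases[OF i(1)] .
  have col: "v \<in> K P1 \<or> v \<in> K P2 \<or> v \<in> K P3" if "v \<in> tv i" for v
  proof -
    have "v \<in> inner y ?W \<union> set ?W" using that i(1) yi by (auto simp: inner_def)
    then show ?thesis using hit_disk[OF b Z iZ] by (auto simp: K_def)
  qed
  have cols: "a \<in> K P1 \<or> a \<in> K P2 \<or> a \<in> K P3" "b \<in> K P1 \<or> b \<in> K P2 \<or> b \<in> K P3" "c \<in> K P1 \<or> c \<in> K P2 \<or> c \<in> K P3"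
    using col t(1) by auto
  have "of_bool (C {a, b}) + of_bool (C {b, c}) + of_bool (C {a, c}) = (1 :: bit)"
    using odd tri_sum[OF i(1) t, of "\<lambda>e. of_bool (C e)"] by simp
  then have sum1: "of_bool (C {a, b}) + of_bool (C {b, c}) + of_bool (C {a, c}) = (1 :: bit)" .
  have "\<exists>v\<in>tv i. v \<in> K P3"
  proof (rule ccontr)
    assume "\<not> (\<exists>v\<in>tv i. v \<in> K P3)"
    then have "a \<in> K P2 \<longleftrightarrow> a \<notin> K P1" "b \<in> K P2 \<longleftrightarrow> b \<notin> K P1" "c \<in> K P2 \<longleftrightarrow> c \<notin> K P1"
      using cols K_disj(1) t(1) by blast+
    then show False
      using sum1 unfolding C_pair by (cases "a \<in> K P1"; cases "b \<in> K P1"; cases "c \<in> K P1") simp_all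
  qed
  then obtain a3 where a3: "a3 \<in> tv i" "a3 \<in> K P3" by blast
  have "C {a, b} \<or> C {b, c} \<or> C {a, c}"
  proof (rule ccontr)
    assume "\<not> ?thesis"
    then have "\<not> C {a, b}" "\<not> C {b, c}" "\<not> C {a, c}" by blast+
    then show False using sum1 by simp
  qed
  then have "\<exists>u\<in>tv i. \<exists>w\<in>tv i. u \<in> K P1 \<and> w \<in> K P2" unfolding C_pair t(1) by blast
  then obtain a1 a2 where a12: "a1 \<in> tv i" "a2 \<in> tv i" "a1 \<in> K P1" "a2 \<in> K P2" by blast
  have "a1 \<noteq> a2" "a2 \<noteq> a3" "a1 \<noteq> a3" using a12 a3 K_disj K_disj' by blast+
  then have "card {a1, a2, a3} = card (tv i)" using card_tv[OF i(1)] by simp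
  then have "tv i = {a1, a2, a3}"
    using a12(1,2) a3(1) by (intro card_subset_eq[symmetric] finite_tv i(1)) auto
  then have "tv i = {a1, a2, a3} \<and> a1 \<in> K P1 \<and> a2 \<in> K P2 \<and> a3 \<in> K P3" using a12 a3 by blast
  then show thesis using that i(1) yi unfolding K_def by blast
qed

text \<open>\<open>W'\<close> follows the old boundary from \<open>b1\<close> to \<open>b2\<close>,
  climbs the leg of \<open>a2\<close> backwards, crosses the edge to \<open>a1\<close> and descends
  to \<open>b1\<close>. A filling exists by \<open>fills\<close>; the work is to show that it stays
  within \<open>y\<close>.\<close>

lemma subdisk:
  assumes b: "bounded_by y (P1 @ P2 @ P3)" and ne: "P1 \<noteq> []" "P2 \<noteq> []" "P3 \<noteq> []"
    and Z: "set (P1 @ P2 @ P3) \<subseteq> Z" "Z \<subseteq> VT" and iZ: "inner y (P1 @ P2 @ P3) \<inter> Z = {}"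
    and i: "i \<in> I" "y i = 1" "a1 \<in> tv i" "a2 \<in> tv i"
    and P: "P1 = S1 @ b1 # R1" "P2 = S2 @ b2 # R2" and h: "hit Z a1 = b1" "hit Z a2 = b2"
    and W': "W' = (b1 # R1) @ (S2 @ [b2]) @ (rev (leg Z a2) @ leg Z a1)"
  obtains y' where "bounded_by y' W'" "\<forall>j\<in>I. y' j = 1 \<longrightarrow> y j = 1"
    "\<forall>e\<in>Ed. bd y' e = chain (b1 # R1 @ S2 @ [b2]) e + chain (leg Z a2 @ [b2]) e + of_bool (e = {a1, a2}) +
      chain (leg Z a1 @ [b1]) e"
proof -
  let ?W = "P1 @ P2 @ P3"
  let ?L1 = "leg Z a1" and ?L2 = "leg Z a2"
  have dW: "distinct ?W" and ceW: "cycle_edges ?W \<subseteq> Ed" using b by (auto simp: bounded_by_def)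
  have lW: "length ?W \<ge> 3" using ne by (cases P1; cases P2; cases P3) auto
  have aW: "a1 \<in> inner y ?W \<union> set ?W" "a2 \<in> inner y ?W \<union> set ?W" using i by (auto simp: inner_def)
  have aV: "a1 \<in> VT" "a2 \<in> VT" using i by blast+
  note l1 = leg_props[OF rZ aV(1)] and l2 = leg_props[OF rZ aV(2)]
  have L_in: "set ?L1 \<subseteq> inner y ?W" "set ?L2 \<subseteq> inner y ?W" using hit_disk[OF b Z iZ] aW by auto
  have b12: "b1 \<noteq> b2" using dW P by auto
  then have a12: "a1 \<noteq> a2" using h by auto
  have L12: "set ?L1 \<inter> set ?L2 = {}" using l1 l2 h b12 by fastforce
  have inW: "v \<notin> set ?W" if "v \<in> inner y ?W" for v using that by (simp add: inner_def)
  have dW': "distinct W'"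
    using dW P l1 l2 L12 L_in inW unfolding W' by auto
  have ex: "W' @ [hd W'] = (b1 # R1 @ S2) @ b2 # (rev ?L2 @ ?L1 @ [b1])"
    "b2 # (rev ?L2 @ ?L1 @ [b1]) = rev (?L2 @ [b2]) @ (?L1 @ [b1])"
    unfolding W' by simp_all
  have ends: "last (rev (?L2 @ [b2])) = a2" "hd (?L1 @ [b1]) = a1" using l1 l2 unfolding h last_rev by blast+
  have pe: "path_edges (W' @ [hd W']) = path_edges (b1 # R1 @ S2 @ [b2]) \<union>
      (path_edges (?L2 @ [b2]) \<union> {{a2, a1}} \<union> path_edges (?L1 @ [b1]))"
    unfolding ex(1) path_edges_append[of "b1 # R1 @ S2" b2 "rev ?L2 @ ?L1 @ [b1]"]
    unfolding ex(2) by (subst path_edges_join) (simp_all add: ends[simplified] path_edges_rev[of "?L2 @ [b2]", simplified])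
  have ch: "chain (W' @ [hd W']) e = chain (b1 # R1 @ S2 @ [b2]) e +
      (chain (?L2 @ [b2]) e + of_bool (e = {a2, a1}) + chain (?L1 @ [b1]) e)" for e
  proof -
    have "rev (?L2 @ [b2]) \<noteq> []" "?L1 @ [b1] \<noteq> []" by simp_all
    from chain_join[OF this, of e] have "chain (rev (?L2 @ [b2]) @ (?L1 @ [b1])) e =
        chain (?L2 @ [b2]) e + of_bool (e = {a2, a1}) + chain (?L1 @ [b1]) e"
      by (simp only: chain_rev ends)
    moreover have "chain (W' @ [hd W']) e = chain ((b1 # R1 @ S2) @ [b2]) e + chain (rev (?L2 @ [b2]) @ (?L1 @ [b1])) e"
      using chain_append[of "b1 # R1 @ S2" b2 "rev ?L2 @ ?L1 @ [b1]" e] by (simp only: ex(1) ex(2)[symmetric])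
    ultimately show ?thesis by (simp only: append_Cons append_assoc)
  qed
  obtain p3 P3' where P3: "P3 = p3 # P3'" using ne by (meson neq_Nil_conv)
  have seg: "path_edges (b1 # R1 @ S2 @ [b2]) \<subseteq> cycle_edges ?W"
    using cycle_edges_three(1)[of ?W S1 b1 R1 S2 b2 R2 "[]" p3 P3'] P P3 by auto
  have edge12: "{a2, a1} \<in> Ed" using edgeI[OF i(1) i(4,3)] a12 by simp
  have sub: "cycle_edges W' \<subseteq> Ed"
    unfolding cycle_edges_def pe using seg ceW edge12 l1 l2 h by auto
  have W'ne: "W' \<noteq> []" by (simp add: W')
  have "vsum Ed (chain (W' @ [hd W'])) v = 0" for v
    by (rule vsum_closed_chain[OF finite_Ed _ card_Ed W'ne]) (use sub in \<open>auto simp: cycle_edges_def\<close>)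
  then obtain z where z: "\<forall>e\<in>Ed. chain (W' @ [hd W']) e = bd z e" using fills by blast
  \<comment> \<open>Adding a constant changes no boundary and normalises the value at
    \<open>t0\<close>.\<close>
  define y' where "y' j = z j + z t0" for j
  have bdy': "bd y' e = chain (W' @ [hd W']) e" if "e \<in> Ed" for e
    using z bd_const[OF that] that unfolding y'_def bd_add by simp
  have y'0: "y' t0 = 0" by (simp add: y'_def)
  have b': "bounded_by y' W'" unfolding bounded_by_def using dW' W'ne sub bdy' y'0 by blast
  \<comment> \<open>The part of \<open>y'\<close> outside \<open>y\<close>. Its boundary lies on the
    old cycle, so it is zero or \<open>y\<close>; it vanishes at \<open>i\<close>, where
    \<open>y\<close> is 1, hence it is zero.\<close>
  define w where "w j = y' j * (1 + y j)" for j
  have "(\<forall>j\<in>I. w j = 0) \<or> (\<forall>j\<in>I. w j = y j)"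
  proof (rule circuit[OF b lW])
    show "w t0 = 0" by (simp add: w_def y'0)
    fix e assume e: "e \<in> Ed" "e \<notin> cycle_edges ?W"
    obtain j k where jk: "j \<in> I" "k \<in> I" "{l\<in>I. e \<subseteq> tv l} = {j, k}" "\<And>y. bd y e = y j + y k"
      using edge_triangles[OF e(1)] by metis
    have yjk: "y j = y k" using bd_cycle[OF b lW e(1)] e(2) jk(4) by (simp add: bit_add_eq_0_iff)
    show "bd w e = 0"
    proof (cases "y j = 0")
      case False
      then show ?thesis using yjk unfolding jk(4) w_def by simp
    next
      case True
      have no_in: "e \<inter> inner y ?W = {}"
      proof (rule ccontr)
        assume "e \<inter> inner y ?W \<noteq> {}"
        then obtain v where v: "v \<in> e" "v \<in> inner y ?W" by blast
        then obtain l where l: "l \<in> I" "y l = 1" "v \<in> tv l" "v \<notin> set ?W" by (auto simp: inner_def)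
        have "v \<in> tv j" using jk(3) v(1) by blast
        then have "y j = 1" using star_const[OF b l(4) jk(1) l(1) _ l(3)] l(2) by simp
        then show False using True by simp
      qed
      have "e \<noteq> {a2, a1}"
      proof
        assume "e = {a2, a1}"
        then have "i \<in> {l\<in>I. e \<subseteq> tv l}" using i by simp
        then have "i = j \<or> i = k" using jk(3) by blast
        then show False using i(2) True yjk by auto
      qed
      moreover have "e \<notin> path_edges (?L1 @ [b1])" "e \<notin> path_edges (?L2 @ [b2])"
        using path_edges_meets[of e] no_in L_in by blast+
      ultimately have "e \<notin> path_edges (W' @ [hd W'])" unfolding pe using seg e(2) by blast
      then have "bd y' e = 0" using bdy'[OF e(1)] chain_zero by simp
      then show ?thesis using True yjk unfolding jk(4) w_def by simp
    qed
  qed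
  moreover have "\<not> (\<forall>j\<in>I. w j = y j)" using i(1,2) unfolding w_def by (auto intro!: bexI[of _ i])
  ultimately have w0: "\<forall>j\<in>I. w j = 0" by blast
  show thesis
  proof (rule that[OF b']; intro ballI impI)
    show "y j = 1" if "j \<in> I" "y' j = 1" for j
      using w0 that unfolding w_def by (cases "y j") auto
    show "bd y' e = chain (b1 # R1 @ S2 @ [b2]) e + chain (leg Z a2 @ [b2]) e + of_bool (e = {a1, a2}) +
      chain (leg Z a1 @ [b1]) e" if "e \<in> Ed" for e
      unfolding bdy'[OF that] ch by (simp add: add.assoc insert_commute)
  qed
qed

text \<open>Being outside spreads along a path that avoids the boundary, since consecutive vertices
  share a triangle and each star is constant.\<close>

lemma zero_along:
  assumes "bounded_by y W" "set xs \<inter> set W = {}" "path_edges xs \<subseteq> Ed" "xs \<noteq> []"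
    "i0 \<in> I" "last xs \<in> tv i0" "y i0 = 0" "v \<in> set xs" "i \<in> I" "v \<in> tv i"
  shows "y i = 0"
  using assms(2-4,6,8-)
proof (induction xs arbitrary: v i rule: path_edges.induct)
  case (1 a b zs)
  have "{a, b} \<in> Ed" using 1(3) by simp
  then obtain k where k: "k \<in> I" "a \<in> tv k" "b \<in> tv k" by (elim edgeE)
  have IH: "y i = 0" if "v \<in> set (b # zs)" "i \<in> I" "v \<in> tv i" for v i
    using 1(1)[of v i] 1(2-5) that by simp
  show ?case
  proof (cases "v \<in> set (b # zs)")
    case False
    then have "v = a" using 1(6) by simp
    then show ?thesis
      using IH[of b k] k star_const[OF assms(1) _ 1(7) k(1), of a] 1(2,8) by auto
  qed (use IH 1 in blast)
next
  case ("2_2" a)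
  then show ?case using star_const[OF assms(1) _ _ assms(5), of a i] assms(7) by auto
qed auto

text \<open>The index of a subdisk names the leg opposite to it: \<open>W1\<close> uses the feet
  \<open>b2\<close> and \<open>b3\<close>. Only the sum of the three chains is known at first; that
  the disks are disjoint is a separate matter.\<close>

lemma split_disk:
  assumes b: "bounded_by y (P1 @ P2 @ P3)" and ne: "P1 \<noteq> []" "P2 \<noteq> []" "P3 \<noteq> []"
    and Z: "set (P1 @ P2 @ P3) \<subseteq> Z" "Z \<subseteq> VT" and iZ: "inner y (P1 @ P2 @ P3) \<inter> Z = {}"
  obtains a1 a2 a3 S1 b1 R1 S2 b2 R2 S3 b3 R3 y1 y2 y3 L1 L2 L3 W1 W2 W3 Y where
    "P1 = S1 @ b1 # R1" "P2 = S2 @ b2 # R2" "P3 = S3 @ b3 # R3"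
    "a1 \<in> VT" "a2 \<in> VT" "a3 \<in> VT" "L1 = leg Z a1" "L2 = leg Z a2" "L3 = leg Z a3"
    "Y = set L1 \<union> set L2 \<union> set L3"
    "W1 = (b2 # R2) @ (S3 @ [b3]) @ (rev L3 @ L2)" "bounded_by y1 W1"
    "W2 = (b3 # R3) @ (S1 @ [b1]) @ (rev L1 @ L3)" "bounded_by y2 W2"
    "W3 = (b1 # R1) @ (S2 @ [b2]) @ (rev L2 @ L1)" "bounded_by y3 W3"
    "inner y (P1 @ P2 @ P3) = Y \<union> inner y3 W3 \<union> inner y1 W1 \<union> inner y2 W2"
    "Y \<inter> inner y1 W1 = {}" "Y \<inter> inner y2 W2 = {}" "Y \<inter> inner y3 W3 = {}"
    "inner y1 W1 \<inter> inner y2 W2 = {}" "inner y1 W1 \<inter> inner y3 W3 = {}" "inner y2 W2 \<inter> inner y3 W3 = {}"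
    "card {j\<in>I. y1 j = 1} < card {j\<in>I. y j = 1}" "card {j\<in>I. y2 j = 1} < card {j\<in>I. y j = 1}"
    "card {j\<in>I. y3 j = 1} < card {j\<in>I. y j = 1}"
proof -
  let ?W = "P1 @ P2 @ P3"
  have dW: "distinct ?W" and ceW: "cycle_edges ?W \<subseteq> Ed" using b by (auto simp: bounded_by_def)
  have lW: "length ?W \<ge> 3" using ne by (cases P1; cases P2; cases P3) auto
  obtain i a1 a2 a3 where i: "i \<in> I" "y i = 1" and tvi: "tv i = {a1, a2, a3}"
    and h: "hit Z a1 \<in> set P1" "hit Z a2 \<in> set P2" "hit Z a3 \<in> set P3"
    using sperner[OF b ne Z iZ] .
  define b1 b2 b3 where "b1 = hit Z a1" and "b2 = hit Z a2" and "b3 = hit Z a3"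
  note hb = b1_def[symmetric] b2_def[symmetric] b3_def[symmetric]
  define L1 L2 L3 where "L1 = leg Z a1" and "L2 = leg Z a2" and "L3 = leg Z a3"
  have bW: "b1 \<in> set P1" "b2 \<in> set P2" "b3 \<in> set P3" using h by (auto simp: hb)
  then obtain S1 R1 S2 R2 S3 R3 where P: "P1 = S1 @ b1 # R1" "P2 = S2 @ b2 # R2" "P3 = S3 @ b3 # R3"
    by (meson split_list)
  have a: "a1 \<in> tv i" "a2 \<in> tv i" "a3 \<in> tv i" using tvi by auto
  have aV: "a1 \<in> VT" "a2 \<in> VT" "a3 \<in> VT" using a i(1) by blast+
  have aW: "a1 \<in> inner y ?W \<union> set ?W" "a2 \<in> inner y ?W \<union> set ?W" "a3 \<in> inner y ?W \<union> set ?W"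
    using i a by (auto simp: inner_def)
  have bne: "b1 \<noteq> b2" "b2 \<noteq> b3" "b1 \<noteq> b3" using dW bW by auto
  have ane: "a1 \<noteq> a2" "a2 \<noteq> a3" "a1 \<noteq> a3" using bne unfolding b1_def b2_def b3_def by auto
  note lp = leg_props[OF rZ aV(1)] leg_props[OF rZ aV(2)] leg_props[OF rZ aV(3)]
  have L_in: "set L1 \<subseteq> inner y ?W" "set L2 \<subseteq> inner y ?W" "set L3 \<subseteq> inner y ?W"
    using hit_disk[OF b Z iZ] aW unfolding L1_def L2_def L3_def by auto
  have hit_L: "\<And>v. v \<in> set L1 \<Longrightarrow> hit Z v = b1" "\<And>v. v \<in> set L2 \<Longrightarrow> hit Z v = b2" "\<And>v. v \<in> set L3 \<Longrightarrow> hit Z v = b3"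
    using lp unfolding L1_def L2_def L3_def b1_def b2_def b3_def by blast+
  have LL: "set L1 \<inter> set L2 = {}" "set L2 \<inter> set L3 = {}" "set L1 \<inter> set L3 = {}"
    using hit_L bne by blast+
  have LW: "set L1 \<inter> set ?W = {}" "set L2 \<inter> set ?W = {}" "set L3 \<inter> set ?W = {}"
    using L_in by (auto simp: inner_def)
  have aL: "a1 \<in> set (L1 @ [b1])" "a2 \<in> set (L2 @ [b2])" "a3 \<in> set (L3 @ [b3])"
    using lp hd_in_set[of "L1 @ [b1]"] hd_in_set[of "L2 @ [b2]"] hd_in_set[of "L3 @ [b3]"]
    unfolding L1_def L2_def L3_def b1_def b2_def b3_def by fastforce+
  define W1 W2 W3 where "W1 = (b2 # R2) @ (S3 @ [b3]) @ (rev L3 @ L2)"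
    and "W2 = (b3 # R3) @ (S1 @ [b1]) @ (rev L1 @ L3)" and "W3 = (b1 # R1) @ (S2 @ [b2]) @ (rev L2 @ L1)"
  have rot: "bounded_by y (P2 @ P3 @ P1)" "bounded_by y (P3 @ P1 @ P2)"
    using bounded_by_rotate[of y P1 "P2 @ P3"] bounded_by_rotate[of y "P1 @ P2" P3] b by simp_all
  have inr: "inner y (P2 @ P3 @ P1) = inner y ?W" "inner y (P3 @ P1 @ P2) = inner y ?W"
    by (auto simp: inner_def)
  define c1 c2 c3 where "c1 = chain (b2 # R2 @ S3 @ [b3])" and "c2 = chain (b3 # R3 @ S1 @ [b1])"
    and "c3 = chain (b1 # R1 @ S2 @ [b2])"
  have Zr: "set (P2 @ P3 @ P1) \<subseteq> Z" "set (P3 @ P1 @ P2) \<subseteq> Z"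
    and ir: "inner y (P2 @ P3 @ P1) \<inter> Z = {}" "inner y (P3 @ P1 @ P2) \<inter> Z = {}"
    using Z(1) iZ inr by auto
  obtain y3 where y3': "bounded_by y3 ((b1 # R1) @ (S2 @ [b2]) @ (rev (leg Z a2) @ leg Z a1))"
    "\<forall>j\<in>I. y3 j = 1 \<longrightarrow> y j = 1"
    "\<forall>e\<in>Ed. bd y3 e = chain (b1 # R1 @ S2 @ [b2]) e + chain (leg Z a2 @ [b2]) e + of_bool (e = {a1, a2}) +
      chain (leg Z a1 @ [b1]) e"
    using subdisk[OF b ne Z iZ i a(1,2) P(1,2) hb(1,2) refl] .
  note y3 = y3'[rule_format, folded L1_def L2_def L3_def, folded W3_def c3_def]
  obtain y1 where y1': "bounded_by y1 ((b2 # R2) @ (S3 @ [b3]) @ (rev (leg Z a3) @ leg Z a2))"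
    "\<forall>j\<in>I. y1 j = 1 \<longrightarrow> y j = 1"
    "\<forall>e\<in>Ed. bd y1 e = chain (b2 # R2 @ S3 @ [b3]) e + chain (leg Z a3 @ [b3]) e + of_bool (e = {a2, a3}) +
      chain (leg Z a2 @ [b2]) e"
    using subdisk[OF rot(1) ne(2,3,1) Zr(1) Z(2) ir(1) i a(2,3) P(2,3) hb(2,3) refl] .
  note y1 = y1'[rule_format, folded L1_def L2_def L3_def, folded W1_def c1_def]
  obtain y2 where y2': "bounded_by y2 ((b3 # R3) @ (S1 @ [b1]) @ (rev (leg Z a1) @ leg Z a3))"
    "\<forall>j\<in>I. y2 j = 1 \<longrightarrow> y j = 1"
    "\<forall>e\<in>Ed. bd y2 e = chain (b3 # R3 @ S1 @ [b1]) e + chain (leg Z a1 @ [b1]) e + of_bool (e = {a3, a1}) +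
      chain (leg Z a3 @ [b3]) e"
    using subdisk[OF rot(2) ne(3,1,2) Zr(2) Z(2) ir(2) i a(3,1) P(3,1) hb(3,1) refl] .
  note y2 = y2'[rule_format, folded L1_def L2_def L3_def, folded W2_def c2_def]
  have W_eq: "?W = S1 @ b1 # R1 @ S2 @ b2 # R2 @ S3 @ b3 # R3" by (simp add: P)
  have bdy: "bd y e = c3 e + c1 e + c2 e" if "e \<in> Ed" for e
    using b that cycle_edges_three(2)[OF W_eq, of e] unfolding bounded_by_def c1_def c2_def c3_def by simp
  have y0: "y t0 = 0" "y1 t0 = 0" "y2 t0 = 0" "y3 t0 = 0" using b y1(1) y2(1) y3(1) by (auto simp: bounded_by_def)
  have tri: "of_bool (e \<subseteq> tv i) = of_bool (e = {a1, a2}) + of_bool (e = {a2, a3}) + (of_bool (e = {a3, a1}) :: bit)"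
    if e: "e \<in> Ed" for e
  proof (cases "e \<subseteq> tv i")
    case True
    then have "e = {a1, a2} \<or> e = {a2, a3} \<or> e = {a3, a1}"
      using card_Ed[OF e] unfolding tvi by (auto simp: card_2_iff)
    then show ?thesis using True ane by (elim disjE) (auto simp: doubleton_eq_iff)
  next
    case False
    then have "e \<noteq> {a1, a2}" "e \<noteq> {a2, a3}" "e \<noteq> {a3, a1}" unfolding tvi by auto
    then show ?thesis using False by simp
  qed
  \<comment> \<open>Each leg occurs in two boundaries and cancels; the sides of triangle
    \<open>i\<close> are what remains. A chain with zero boundary that vanishes at \<open>t0\<close>
    is zero.\<close>
  have sum: "y j = y1 j + y2 j + y3 j + of_bool (j = i)" if "j \<in> I" for j
  proof -
    define s where "s j = y j + (y1 j + (y2 j + (y3 j + of_bool (j = i))))" for j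
    have "bd s e = 0" if e: "e \<in> Ed" for e
      unfolding s_def bd_add bd_single[OF i(1)] tri[OF e] bdy[OF e] y1(3)[OF e] y2(3)[OF e] y3(3)[OF e]
      by (simp add: add_ac)
    moreover have "s t0 = 0" using y0 i(2) by (auto simp: s_def)
    ultimately have "s j = 0" using closed_const[of s j] that by simp
    then show ?thesis unfolding s_def bit_add_eq_0_iff by (simp add: add_ac)
  qed
  \<comment> \<open>A leg lies outside the opposite subdisk: its foot touches a triangle outside
    \<open>y\<close>, and from there \<open>zero_along\<close> carries this to the whole
    leg.\<close>
  have Q: "y' j = 0" if "bounded_by y' W'" "\<And>j. j \<in> I \<Longrightarrow> y' j = 1 \<Longrightarrow> y j = 1" "b' \<in> set ?W"
      "path_edges (L' @ [b']) \<subseteq> Ed" "set (L' @ [b']) \<inter> set W' = {}" "v \<in> set (L' @ [b'])" "j \<in> I" "v \<in> tv j"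
    for y' W' L' b' v j
  proof -
    note pr = that
    obtain i0 where i0: "i0 \<in> I" "b' \<in> tv i0" "y i0 = 0" using boundary_outside[OF b lW pr(3)] by blast
    then have "y' i0 = 0" using pr(2)[of i0] by fastforce
    then show ?thesis
      using zero_along[OF pr(1,5,4) _ i0(1) _ _ pr(6,7,8)] i0(2) by simp
  qed
  have paths: "path_edges (L1 @ [b1]) \<subseteq> Ed" "path_edges (L2 @ [b2]) \<subseteq> Ed" "path_edges (L3 @ [b3]) \<subseteq> Ed"
    using lp unfolding L1_def L2_def L3_def b1_def b2_def b3_def by blast+
  have disj: "set (L1 @ [b1]) \<inter> set W1 = {}" "set (L2 @ [b2]) \<inter> set W2 = {}" "set (L3 @ [b3]) \<inter> set W3 = {}"
    using LL LW dW unfolding W1_def W2_def W3_def P by auto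
  have Q1: "y1 j = 0" if "v \<in> set (L1 @ [b1])" "j \<in> I" "v \<in> tv j" for v j
    by (rule Q[OF y1(1,2) _ paths(1) disj(1) that]) (use bW in auto)
  have Q2: "y2 j = 0" if "v \<in> set (L2 @ [b2])" "j \<in> I" "v \<in> tv j" for v j
    by (rule Q[OF y2(1,2) _ paths(2) disj(2) that]) (use bW in auto)
  have Q3: "y3 j = 0" if "v \<in> set (L3 @ [b3])" "j \<in> I" "v \<in> tv j" for v j
    by (rule Q[OF y3(1,2) _ paths(3) disj(3) that]) (use bW in auto)
  have yi0: "y1 i = 0" "y2 i = 0" "y3 i = 0" using Q1 Q2 Q3 aL a i(1) by blast+
  \<comment> \<open>The sum formula does not exclude a triangle that lies in all three disks. The
    product \<open>z\<close> of the chains has zero boundary: an edge of such a triangle meets no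
    leg and no foot, and on the old cycle it would have to belong to two arcs that share only a
    foot. As \<open>z\<close> vanishes at \<open>t0\<close>, it is zero.\<close>
  have triple: "\<not> (y1 j = 1 \<and> y2 j = 1 \<and> y3 j = 1)" if "j \<in> I" for j
  proof -
    define z where "z j = y1 j * (y2 j * y3 j)" for j
    have z1: "z j = 1 \<longleftrightarrow> y1 j = 1 \<and> y2 j = 1 \<and> y3 j = 1" for j
      unfolding z_def by (cases "y1 j"; cases "y2 j"; cases "y3 j") auto
    have step: "z k = 1" if e: "e \<in> Ed" and jk: "j \<in> I" "k \<in> I" "e \<subseteq> tv j" "\<And>y. bd y e = y j + y k" and zj: "z j = 1" for e j k
    proof -
      have yj: "y1 j = 1" "y2 j = 1" "y3 j = 1" "y j = 1" using zj z1 y1(2) jk(1) by auto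
      have noQ: "e \<inter> set (L1 @ [b1]) = {}" "e \<inter> set (L2 @ [b2]) = {}" "e \<inter> set (L3 @ [b3]) = {}"
        using Q1[OF _ jk(1)] Q2[OF _ jk(1)] Q3[OF _ jk(1)] yj jk(3) by (metis disjoint_iff subsetD zero_neq_one)+
      have "chain (L1 @ [b1]) e = 0" "chain (L2 @ [b2]) e = 0" "chain (L3 @ [b3]) e = 0"
        using noQ path_edges_meets[of e] by (intro chain_zero; fastforce)+
      moreover have "e \<noteq> {a1, a2}" "e \<noteq> {a2, a3}" "e \<noteq> {a3, a1}" using noQ aL by blast+
      ultimately have bdc: "bd y1 e = c1 e" "bd y2 e = c2 e" "bd y3 e = c3 e"
        using y1(3)[OF e] y2(3)[OF e] y3(3)[OF e] by simp_all
      show ?thesis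
      proof (cases "c1 e = 0 \<and> c2 e = 0 \<and> c3 e = 0")
        case True
        then have "y1 j + y1 k = 0" "y2 j + y2 k = 0" "y3 j + y3 k = 0" using bdc jk(4) by metis+
        then show ?thesis using yj z1 by (simp add: bit_add_eq_0_iff)
      next
        case False
        then have "e \<in> path_edges (b1 # R1 @ S2 @ [b2]) \<union> path_edges (b2 # R2 @ S3 @ [b3]) \<union> path_edges (b3 # R3 @ S1 @ [b1])"
          using chain_zero[of e] unfolding c1_def c2_def c3_def by blast
        then have "e \<in> cycle_edges ?W" using cycle_edges_three(1)[OF W_eq] by simp
        then have "y j + y k = 1" using bd_cycle[OF b lW e] jk(4)[of y] by simp
        then have "y k = 0" using yj by (cases "y k") auto
        then have "y1 k = 0" "y3 k = 0" using y1(2)[OF jk(2)] y3(2)[OF jk(2)] by force+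
        then have "c1 e = 1" "c3 e = 1" using bdc(1,3) jk(4) yj by simp_all
        then have "e \<in> path_edges (b2 # R2 @ S3 @ [b3])" "e \<in> path_edges (b1 # R1 @ S2 @ [b2])"
          using chain_zero[of e] unfolding c1_def c3_def by fastforce+
        then have "e \<subseteq> set (b2 # R2 @ S3 @ [b3])" "e \<subseteq> set (b1 # R1 @ S2 @ [b2])"
          using path_edges_subset by blast+
        moreover have "b1 \<notin> e" "b2 \<notin> e" "b3 \<notin> e" using noQ by auto
        ultimately have "e \<subseteq> (set R2 \<union> set S3) \<inter> (set R1 \<union> set S2)" by auto
        moreover have "(set R2 \<union> set S3) \<inter> (set R1 \<union> set S2) = {}" using dW unfolding P by auto
        ultimately have "e = {}" by blast
        then show ?thesis using card_Ed[OF e] by simp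
      qed
    qed
    have "bd z e = 0" if eE: "e \<in> Ed" for e
    proof -
      obtain j k where jk: "j \<in> I" "k \<in> I" "{l\<in>I. e \<subseteq> tv l} = {j, k}" "\<And>y. bd y e = y j + y k"
        using edge_triangles[OF eE] by metis
      have sub: "e \<subseteq> tv j" "e \<subseteq> tv k" using jk(3) by blast+
      have sym: "bd y e = y k + y j" for y using jk(4) by (simp add: add.commute)
      have "z j = 1 \<longleftrightarrow> z k = 1"
        using step[OF eE jk(1,2) sub(1) jk(4)] step[OF eE jk(2,1) sub(2) sym] by blast
      then show ?thesis unfolding jk(4) by (cases "z j"; cases "z k") auto
    qed
    then have "z j = 0" using closed_const[of z j] that y0 by (simp add: z_def)
    then show ?thesis using z1[of j] by auto
  qed
  have ex: "y1 j = 1 \<or> y2 j = 1 \<or> y3 j = 1" if "j \<in> I" "y j = 1" "j \<noteq> i" for j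
    using sum[OF that(1)] that by (cases "y1 j"; cases "y2 j"; cases "y3 j") auto
  have excl: "\<not> (y1 j = 1 \<and> y2 j = 1)" "\<not> (y1 j = 1 \<and> y3 j = 1)" "\<not> (y2 j = 1 \<and> y3 j = 1)" if "j \<in> I" for j
  proof -
    have "j \<noteq> i" if "y1 j = 1 \<or> y2 j = 1 \<or> y3 j = 1" using that yi0 by auto
    then show "\<not> (y1 j = 1 \<and> y2 j = 1)" "\<not> (y1 j = 1 \<and> y3 j = 1)" "\<not> (y2 j = 1 \<and> y3 j = 1)"
      using sum[OF that] triple[OF that] y1(2)[OF that] y2(2)[OF that]
      by (cases "y1 j"; cases "y2 j"; cases "y3 j"; simp)+
  qed
  define Y where "Y = set L1 \<union> set L2 \<union> set L3"
  have U_sub: "inner y' W' \<subseteq> inner y ?W - Y"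
    if bw: "bounded_by y' W'" and sub: "\<And>j. j \<in> I \<Longrightarrow> y' j = 1 \<Longrightarrow> y j = 1"
      and L: "Y \<subseteq> set W' \<union> set L" and q: "\<And>v j. v \<in> set L \<Longrightarrow> j \<in> I \<Longrightarrow> v \<in> tv j \<Longrightarrow> y' j = 0" for y' W' L
  proof
    fix v assume "v \<in> inner y' W'"
    then obtain j where j: "v \<notin> set W'" "j \<in> I" "y' j = 1" "v \<in> tv j" by (auto simp: inner_def)
    have all: "y' k = 1" if "k \<in> I" "v \<in> tv k" for k
      using star_const[OF bw j(1) that(1) j(2) that(2) j(4)] j(3) by simp
    have "v \<notin> set ?W"
    proof
      assume "v \<in> set ?W"
      then obtain k where "k \<in> I" "v \<in> tv k" "y k = 0" using boundary_outside[OF b lW] by blast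
      then show False using all[of k] sub[of k] by auto
    qed
    moreover have "v \<notin> set L" using q[of v j] j by auto
    ultimately show "v \<in> inner y ?W - Y" using j sub L by (auto simp: inner_def)
  qed
  have U1: "inner y1 W1 \<subseteq> inner y ?W - Y"
    by (rule U_sub[OF y1(1,2), of L1]) (use Q1 in \<open>auto simp: Y_def W1_def\<close>)
  have U2: "inner y2 W2 \<subseteq> inner y ?W - Y"
    by (rule U_sub[OF y2(1,2), of L2]) (use Q2 in \<open>auto simp: Y_def W2_def\<close>)
  have U3: "inner y3 W3 \<subseteq> inner y ?W - Y"
    by (rule U_sub[OF y3(1,2), of L3]) (use Q3 in \<open>auto simp: Y_def W3_def\<close>)
  have cover: "v \<in> inner y3 W3 \<union> inner y1 W1 \<union> inner y2 W2" if v: "v \<in> inner y ?W" "v \<notin> Y" for v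
  proof -
    obtain j where j: "v \<notin> set ?W" "j \<in> I" "y j = 1" "v \<in> tv j" using v(1) by (auto simp: inner_def)
    have "j \<noteq> i"
    proof
      assume "j = i"
      then have "v \<in> {a1, a2, a3}" using j(4) tvi by simp
      then show False using aL v(2) j(1) bW by (auto simp: Y_def)
    qed
    then have "y1 j = 1 \<or> y2 j = 1 \<or> y3 j = 1" using ex j by blast
    moreover have "v \<notin> set W1" "v \<notin> set W2" "v \<notin> set W3"
      using j(1) v(2) by (auto simp: W1_def W2_def W3_def Y_def P)
    ultimately show ?thesis using j by (auto simp: inner_def)
  qed
  have U_disj: "inner y' W' \<inter> inner y'' W'' = {}"
    if bw: "bounded_by y'' W''" and x: "\<And>j. j \<in> I \<Longrightarrow> \<not> (y' j = 1 \<and> y'' j = 1)" for y' y'' W' W''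
  proof (rule ccontr)
    assume "inner y' W' \<inter> inner y'' W'' \<noteq> {}"
    then obtain v j k where "v \<notin> set W''" "j \<in> I" "y' j = 1" "v \<in> tv j" "k \<in> I" "y'' k = 1" "v \<in> tv k"
      by (auto simp: inner_def)
    then show False using star_const[OF bw, of v j k] x[of j] by auto
  qed
  have card_less: "card {j\<in>I. y' j = 1} < card {j\<in>I. y j = 1}"
    if "\<And>j. j \<in> I \<Longrightarrow> y' j = 1 \<Longrightarrow> y j = 1" "y' i = 0" for y' :: "'i \<Rightarrow> bit"
  proof (rule psubset_card_mono)
    have "i \<in> {j\<in>I. y j = 1}" "i \<notin> {j\<in>I. y' j = 1}" using i by (simp_all add: that(2))
    then show "{j\<in>I. y' j = 1} \<subset> {j\<in>I. y j = 1}" using that(1) by blast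
  qed (use fin in simp)
  show thesis
  proof (rule that[OF P aV L1_def L2_def L3_def Y_def W1_def y1(1) W2_def y2(1) W3_def y3(1)])
    show "inner y ?W = Y \<union> inner y3 W3 \<union> inner y1 W1 \<union> inner y2 W2"
      using cover U1 U2 U3 L_in unfolding Y_def by blast
    show "Y \<inter> inner y1 W1 = {}" "Y \<inter> inner y2 W2 = {}" "Y \<inter> inner y3 W3 = {}" using U1 U2 U3 by blast+
    show "inner y1 W1 \<inter> inner y2 W2 = {}" "inner y1 W1 \<inter> inner y3 W3 = {}" "inner y2 W2 \<inter> inner y3 W3 = {}"
      by (rule U_disj; use y2(1) y3(1) excl in blast)+
    show "card {j\<in>I. y1 j = 1} < card {j\<in>I. y j = 1}" "card {j\<in>I. y2 j = 1} < card {j\<in>I. y j = 1}"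
      "card {j\<in>I. y3 j = 1} < card {j\<in>I. y j = 1}"
      by (rule card_less; use y1 y2 y3 yi0 in blast)+
  qed
qed

end

end

section \<open>Recursive partition of a disk into tripods\<close>

context triangulation
begin

text \<open>A partition of \<open>Z\<close> into the parts \<open>0, \<dots>, M - 1\<close>, together with a chordal completion \<open>N\<close> of its
  quotient graph; the part of the root is a singleton.\<close>

definition part_state :: "'v set \<Rightarrow> ('v \<Rightarrow> nat) \<Rightarrow> (nat \<Rightarrow> nat set) \<Rightarrow> nat \<Rightarrow> bool" where
  "part_state Z \<pi> N M \<longleftrightarrow> Z \<subseteq> VT \<and> r \<in> Z \<and> (\<forall>v\<in>Z. \<pi> v < M) \<and> elim_order 3 N \<and> (\<forall>n\<ge>M. N n = {}) \<and>
     (\<forall>u\<in>Z. \<forall>w\<in>Z. {u, w} \<in> Ed \<longrightarrow> joined N (\<pi> u) (\<pi> w)) \<and>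
     (\<forall>n l. card {v\<in>Z. \<pi> v = n \<and> level v = l} \<le> 3) \<and> \<pi> r = 0 \<and> (\<forall>v\<in>Z. \<pi> v = 0 \<longrightarrow> v = r)"

text \<open>The new part \<open>M\<close> comes last and its earlier neighbours are completed to a
  clique \<open>C\<close> of existing parts, so the perfect elimination ordering is kept.\<close>

lemma part_state_extend:
  assumes st: "part_state Z \<pi> N M" and Y: "Y \<subseteq> VT" "Y \<inter> Z = {}"
    and C: "C \<subseteq> {..<M}" "card C \<le> 3" "\<And>a b. a \<in> C \<Longrightarrow> b \<in> C \<Longrightarrow> joined N a b"
    and nb: "\<And>u w. u \<in> Y \<Longrightarrow> w \<in> Z \<Longrightarrow> {u, w} \<in> Ed \<Longrightarrow> \<pi> w \<in> C"
    and lv: "\<And>l. card {v\<in>Y. level v = l} \<le> 3"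
  shows "part_state (Z \<union> Y) (\<lambda>v. if v \<in> Y then M else \<pi> v) (N(M := C)) (Suc M)"
proof -
  let ?\<pi> = "\<lambda>v. if v \<in> Y then M else \<pi> v" and ?N = "N(M := C)"
  note s = st[unfolded part_state_def]
  have less: "\<pi> v < M" if "v \<in> Z" for v using s that by blast
  have eo: "elim_order 3 N" using s by blast
  have NM: "N n = {}" if "n \<ge> M" for n using s that by blast
  have N_sub: "N n \<subseteq> {..<n}" "card (N n) \<le> 3" for n using eo by (auto simp: elim_order_def)
  have N_cl: "a \<in> N b" if "a \<in> N n" "b \<in> N n" "a < b" for a b n
    using eo that unfolding elim_order_def by blast
  have root: "r \<in> Z" "\<pi> r = 0" "Z \<subseteq> VT" using s by blast+
  have zero: "v = r" if "v \<in> Z" "\<pi> v = 0" for v using s that by blast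
  have edge: "joined N (\<pi> u) (\<pi> w)" if "u \<in> Z" "w \<in> Z" "{u, w} \<in> Ed" for u w using s that by blast
  have card: "card {v\<in>Z. \<pi> v = n \<and> level v = l} \<le> 3" for n l using s by blast
  have M0: "M > 0" using less[OF root(1)] by simp
  have eo': "elim_order 3 ?N"
    unfolding elim_order_def
  proof (intro conjI allI ballI impI)
    fix n
    show "?N n \<subseteq> {..<n}" "card (?N n) \<le> 3" using C N_sub by auto
    fix a b assume ab: "a \<in> ?N n" "b \<in> ?N n" "a < b"
    have "b < M"
    proof (cases "n = M")
      case False
      then have "b \<in> N n" using ab by simp
      then have "n < M" "b < n" using NM[of n] N_sub(1)[of n] by (auto simp: not_less[symmetric])
      then show ?thesis by simp
    qed (use ab C in auto)
    moreover have "a \<in> N b"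
    proof (cases "n = M")
      case True
      then have "joined N a b" using C(3) ab by simp
      then show ?thesis using ab(3) N_sub(1)[of a] by (auto simp: joined_def)
    qed (use ab N_cl[of a n b] in simp)
    ultimately show "a \<in> ?N b" by simp
  qed
  have jo: "joined ?N a b" if "joined N a b" "a < M" "b < M" for a b
    using that by (auto simp: joined_def)
  have edges: "joined ?N (?\<pi> u) (?\<pi> w)" if uw: "u \<in> Z \<union> Y" "w \<in> Z \<union> Y" "{u, w} \<in> Ed" for u w
  proof -
    consider "u \<in> Y" "w \<in> Y" | "u \<in> Y" "w \<in> Z" "w \<notin> Y" | "u \<in> Z" "u \<notin> Y" "w \<in> Y" | "u \<in> Z" "u \<notin> Y" "w \<in> Z" "w \<notin> Y"
      using uw by blast
    then show ?thesis
    proof cases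
      case 2
      then show ?thesis using nb[of u w] uw(3) by (simp add: joined_def)
    next
      case 3
      then show ?thesis using nb[of w u] uw(3) by (simp add: joined_def insert_commute)
    next
      case 4
      then have "joined N (\<pi> u) (\<pi> w)" using edge uw(3) by blast
      then show ?thesis using 4 jo less by simp
    qed simp
  qed
  have cards: "card {v \<in> Z \<union> Y. ?\<pi> v = n \<and> level v = l} \<le> 3" for n l
  proof (cases "n = M")
    case True
    have "\<pi> v \<noteq> M" if "v \<in> Z" for v using less[OF that] by simp
    then have "{v \<in> Z \<union> Y. ?\<pi> v = n \<and> level v = l} = {v \<in> Y. level v = l}"
      using True by auto
    then show ?thesis using lv by simp
  next
    case False
    then have "{v \<in> Z \<union> Y. ?\<pi> v = n \<and> level v = l} = {v \<in> Z. \<pi> v = n \<and> level v = l}"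
      using Y by auto
    then show ?thesis using card by simp
  qed
  have "r \<notin> Y" using root(1) Y by blast
  moreover have "\<forall>v\<in>Z \<union> Y. ?\<pi> v = 0 \<longrightarrow> v = r"
  proof (intro ballI impI)
    fix v assume "v \<in> Z \<union> Y" "?\<pi> v = 0"
    then show "v = r" using zero[of v] M0 by (cases "v \<in> Y") auto
  qed
  moreover have "\<forall>v\<in>Z \<union> Y. ?\<pi> v < Suc M" using less by (auto simp: less_Suc_eq)
  moreover have "\<forall>n\<ge>Suc M. ?N n = {}" using NM by auto
  ultimately show ?thesis
    unfolding part_state_def using Y(1) eo' edges cards root by simp
qed

text \<open>Sperner's lemma needs three nonempty arcs. If the third is empty, a vertex is split off
  one of the others, which adds no part.\<close>

lemma regroup:
  assumes "P1 \<noteq> []" "P2 \<noteq> []" "length (P1 @ P2 @ P3) \<ge> 3"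
    "\<forall>v\<in>set P1. \<pi> v = p1" "\<forall>v\<in>set P2. \<pi> v = p2" "\<forall>v\<in>set P3. \<pi> v = p3"
  obtains Q1 Q2 Q3 q1 q2 q3 where "Q1 @ Q2 @ Q3 = P1 @ P2 @ P3" "Q1 \<noteq> []" "Q2 \<noteq> []" "Q3 \<noteq> []"
    "\<forall>v\<in>set Q1. \<pi> v = q1" "\<forall>v\<in>set Q2. \<pi> v = q2" "\<forall>v\<in>set Q3. \<pi> v = q3" "{q1, q2, q3} \<subseteq> {p1, p2, p3 :: nat}"
proof -
  consider "P3 \<noteq> []" | x R where "P3 = []" "P1 = x # R" "R \<noteq> []" | S l where "P3 = []" "P2 = S @ [l]" "S \<noteq> []"
  proof (cases "P3 = []")
    case True
    obtain x R S l where "P1 = x # R" "P2 = S @ [l]" using assms by (metis neq_Nil_conv rev_exhaust)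
    moreover have "R \<noteq> [] \<or> S \<noteq> []" using assms(3) True calculation by auto
    ultimately show thesis using that True by blast
  qed (use that in blast)
  then show thesis
  proof cases
    case 1
    then show thesis using assms by (intro that[of P1 P2 P3 p1 p2 p3]) auto
  next
    case (2 x R)
    then show thesis using assms by (intro that[of "[x]" R P2 p1 p1 p2]) auto
  next
    case (3 S l)
    then show thesis using assms by (intro that[of P1 S "[l]" p1 p2 p2]) auto
  qed
qed

lemma leg_level_card:
  assumes "r \<in> Z" "v \<in> VT"
  shows "card {w \<in> set (leg Z v). level w = l} \<le> 1"
proof -
  have "inj_on level (set (leg Z v))" using leg_props[OF assms] by blast
  then have "\<And>u w. u \<in> {w \<in> set (leg Z v). level w = l} \<Longrightarrow> w \<in> {w \<in> set (leg Z v). level w = l} \<Longrightarrow> u = w"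
    by (auto dest: inj_onD)
  then show ?thesis by (simp add: card_le_Suc0_iff_eq)
qed

text \<open>The boundary is covered by at most three pairwise joined parts; \<open>P3\<close> may be
  empty. Each smaller disk is bounded by two old arcs and two legs of the new part, so it has the
  same form. The disks are filled in turn while \<open>Z\<close> grows, which is possible as their
  interiors are disjoint; that old values are preserved keeps the later boundaries valid.\<close>

lemma fill_disk:
  assumes "part_state Z \<pi> N M" "bounded_by y (P1 @ P2 @ P3)" "P1 \<noteq> []" "P2 \<noteq> []" "set (P1 @ P2 @ P3) \<subseteq> Z"
    "inner y (P1 @ P2 @ P3) \<inter> Z = {}"
    "\<forall>v\<in>set P1. \<pi> v = p1" "\<forall>v\<in>set P2. \<pi> v = p2" "\<forall>v\<in>set P3. \<pi> v = p3"
    "{p1, p2, p3} \<subseteq> {..<M}" "\<forall>a\<in>{p1, p2, p3}. \<forall>b\<in>{p1, p2, p3}. joined N a b"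
  shows "\<exists>\<pi>' N' M'. part_state (Z \<union> inner y (P1 @ P2 @ P3)) \<pi>' N' M' \<and> (\<forall>v\<in>Z. \<pi>' v = \<pi> v) \<and>
    (\<forall>n<M. N' n = N n) \<and> M \<le> M'"
  using assms
proof (induction "card {i\<in>I. y i = 1}" arbitrary: Z \<pi> N M y P1 P2 P3 p1 p2 p3 rule: less_induct)
  case less
  note st = less.prems(1)
  let ?W = "P1 @ P2 @ P3"
  show ?case
  proof (cases "length ?W \<ge> 3")
    case False
    then obtain a b where W: "?W = [a, b]" using less.prems(3,4)
      by (cases P1; cases P2; cases P3) (auto simp: not_le less_Suc_eq numeral_3_eq_3)
    \<comment> \<open>On a two-vertex cycle the edge is traversed twice, so the disk has zero
      boundary and is empty.\<close>
    have "bd y e = 0" if "e \<in> Ed" for e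
      using less.prems(2) that unfolding bounded_by_def W by (simp add: insert_commute)
    then have "y i = 0" if "i \<in> I" for i
      using closed_const[of y i] that less.prems(2) by (simp add: bounded_by_def)
    then have "inner y ?W = {}" by (auto simp: inner_def)
    then show ?thesis using st by (intro exI[of _ \<pi>] exI[of _ N] exI[of _ M]) simp
  next
    case True
    obtain Q1 Q2 Q3 q1 q2 q3 where Q: "Q1 @ Q2 @ Q3 = ?W" "Q1 \<noteq> []" "Q2 \<noteq> []" "Q3 \<noteq> []"
      "\<forall>v\<in>set Q1. \<pi> v = q1" "\<forall>v\<in>set Q2. \<pi> v = q2" "\<forall>v\<in>set Q3. \<pi> v = q3" "{q1, q2, q3} \<subseteq> {p1, p2, p3}"
      using regroup[OF less.prems(3,4) True less.prems(7-9)] by metis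
    have rZ: "r \<in> Z" and ZV: "Z \<subseteq> VT" and \<pi>_less: "\<And>v. v \<in> Z \<Longrightarrow> \<pi> v < M" using st by (auto simp: part_state_def)
    have bQ: "bounded_by y (Q1 @ Q2 @ Q3)" and QZ: "set (Q1 @ Q2 @ Q3) \<subseteq> Z" and iQ: "inner y (Q1 @ Q2 @ Q3) \<inter> Z = {}"
      using less.prems(2,5,6) Q(1) by simp_all
    obtain a1 a2 a3 S1 b1 R1 S2 b2 R2 S3 b3 R3 y1 y2 y3 L1 L2 L3 W1 W2 W3 Y where sp:
      "Q1 = S1 @ b1 # R1" "Q2 = S2 @ b2 # R2" "Q3 = S3 @ b3 # R3"
      "a1 \<in> VT" "a2 \<in> VT" "a3 \<in> VT" "L1 = leg Z a1" "L2 = leg Z a2" "L3 = leg Z a3"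
      and Y: "Y = set L1 \<union> set L2 \<union> set L3"
      and W1: "W1 = (b2 # R2) @ (S3 @ [b3]) @ (rev L3 @ L2)" "bounded_by y1 W1"
      and W2: "W2 = (b3 # R3) @ (S1 @ [b1]) @ (rev L1 @ L3)" "bounded_by y2 W2"
      and W3: "W3 = (b1 # R1) @ (S2 @ [b2]) @ (rev L2 @ L1)" "bounded_by y3 W3"
      and inn: "inner y (Q1 @ Q2 @ Q3) = Y \<union> inner y3 W3 \<union> inner y1 W1 \<union> inner y2 W2"
      and YU: "Y \<inter> inner y1 W1 = {}" "Y \<inter> inner y2 W2 = {}" "Y \<inter> inner y3 W3 = {}"
      and UU: "inner y1 W1 \<inter> inner y2 W2 = {}" "inner y1 W1 \<inter> inner y3 W3 = {}" "inner y2 W2 \<inter> inner y3 W3 = {}"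
      and cards: "card {j\<in>I. y1 j = 1} < card {j\<in>I. y j = 1}" "card {j\<in>I. y2 j = 1} < card {j\<in>I. y j = 1}"
        "card {j\<in>I. y3 j = 1} < card {j\<in>I. y j = 1}"
      by (rule split_disk[OF rZ bQ Q(2-4) QZ ZV iQ])
    \<comment> \<open>A neighbour of the tripod in \<open>Z\<close> lies on the boundary cycle,
      hence in one of these parts.\<close>
    define C where "C = {q1, q2, q3}"
    have C: "C \<subseteq> {..<M}" "\<And>a b. a \<in> C \<Longrightarrow> b \<in> C \<Longrightarrow> joined N a b"
      using Q(8) less.prems(10,11) unfolding C_def by blast+
    have cC: "card C \<le> 3" by (simp add: C_def card_insert_if)
    have Y_in: "Y \<subseteq> inner y (Q1 @ Q2 @ Q3)" using inn by blast
    then have YV: "Y \<subseteq> VT" and YZ: "Y \<inter> Z = {}" using iQ by (auto simp: inner_def)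
    define \<pi>' where "\<pi>' v = (if v \<in> Y then M else \<pi> v)" for v
    define N' where "N' = N(M := C)"
    have st': "part_state (Z \<union> Y) \<pi>' N' (Suc M)"
      unfolding \<pi>'_def[abs_def] N'_def
    proof (rule part_state_extend[OF st YV YZ C(1) cC C(2)])
      show "\<pi> w \<in> C" if "u \<in> Y" "w \<in> Z" "{u, w} \<in> Ed" for u w
      proof -
        have "w \<in> set (Q1 @ Q2 @ Q3)"
          using inner_neighbour[OF bQ _ that(3)] that(1,2) Y_in iQ by blast
        then show ?thesis using Q(5-7) by (auto simp: C_def)
      qed
      show "card {v \<in> Y. level v = l} \<le> 3" for l
      proof -
        let ?A = "\<lambda>L. {v \<in> set L. level v = l}"
        have eq: "{v \<in> Y. level v = l} = ?A L1 \<union> ?A L2 \<union> ?A L3" unfolding Y by auto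
        have "card {v \<in> Y. level v = l} \<le> card (?A L1) + card (?A L2) + card (?A L3)"
          unfolding eq using card_Un_le[of "?A L1 \<union> ?A L2" "?A L3"] card_Un_le[of "?A L1" "?A L2"] by linarith
        moreover have "card (?A L1) \<le> 1" "card (?A L2) \<le> 1" "card (?A L3) \<le> 1"
          using leg_level_card[OF rZ] sp(4-9) by simp_all
        ultimately show ?thesis by linarith
      qed
    qed
    have \<pi>'_Z: "\<pi>' v = \<pi> v" if "v \<in> Z" for v using that YZ by (auto simp: \<pi>'_def)
    have \<pi>'_Y: "\<pi>' v = M" if "v \<in> Y" for v using that by (simp add: \<pi>'_def)
    have jN': "joined N' a b" if "a \<in> insert M C" "b \<in> insert M C" for a b
    proof (cases "a = M \<or> b = M")
      case True
      then show ?thesis using that by (auto simp: joined_def N'_def)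
    next
      case False
      then have "joined N a b" "a \<noteq> M" "b \<noteq> M" using C(2) that by blast+
      then show ?thesis by (auto simp: joined_def N'_def)
    qed
    text \<open>One of the three subdisks, filled after parts of the others may have been filled already.\<close>
    have fill: "\<exists>\<pi>1 N1 M1. part_state (Z0 \<union> inner y' (A @ B @ L)) \<pi>1 N1 M1 \<and> (\<forall>v\<in>Z0. \<pi>1 v = \<pi>0 v) \<and>
        (\<forall>n<M0. N1 n = N0 n) \<and> M0 \<le> M1"
      if st0: "part_state Z0 \<pi>0 N0 M0" and ZY: "Z \<union> Y \<subseteq> Z0" and ext: "\<forall>v\<in>Z \<union> Y. \<pi>0 v = \<pi>' v" "\<forall>n<Suc M. N0 n = N' n" "Suc M \<le> M0"
        and b': "bounded_by y' (A @ B @ L)" and AB: "A \<noteq> []" "B \<noteq> []" and cd: "card {j\<in>I. y' j = 1} < card {j\<in>I. y j = 1}"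
        and i0: "inner y' (A @ B @ L) \<inter> Z0 = {}" and subs: "set A \<subseteq> set QA" "set B \<subseteq> set QB" "set L \<subseteq> Y"
        and QQ: "set QA \<subseteq> Z" "set QB \<subseteq> Z" "\<forall>v\<in>set QA. \<pi> v = qa" "\<forall>v\<in>set QB. \<pi> v = qb" "qa \<in> C" "qb \<in> C"
      for Z0 \<pi>0 N0 M0 y' A B L QA QB qa qb
    proof (rule less.hyps[OF cd st0 b' AB _ i0, of qa qb M])
      have z0: "\<pi>0 v = \<pi> v" if "v \<in> Z" for v using ext(1) \<pi>'_Z that by simp
      have A: "v \<in> Z \<and> \<pi>0 v = qa" if "v \<in> set A" for v
      proof -
        have "v \<in> set QA" using that subs(1) by blast
        then show ?thesis using z0[of v] QQ(1,3) by auto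
      qed
      have B: "v \<in> Z \<and> \<pi>0 v = qb" if "v \<in> set B" for v
      proof -
        have "v \<in> set QB" using that subs(2) by blast
        then show ?thesis using z0[of v] QQ(2,4) by auto
      qed
      have L: "v \<in> Y \<and> \<pi>0 v = M" if "v \<in> set L" for v
      proof -
        have "v \<in> Y" using that subs(3) by blast
        then show ?thesis using ext(1) \<pi>'_Y by simp
      qed
      show "set (A @ B @ L) \<subseteq> Z0" using A B L ZY by auto
      show "\<forall>v\<in>set A. \<pi>0 v = qa" "\<forall>v\<in>set B. \<pi>0 v = qb" "\<forall>v\<in>set L. \<pi>0 v = M" using A B L by blast+
      show "{qa, qb, M} \<subseteq> {..<M0}" using QQ C(1) ext(3) by auto
      have "joined N0 a b" if "a \<in> insert M C" "b \<in> insert M C" for a b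
      proof -
        have "a < Suc M" "b < Suc M" using that C(1) by auto
        then show ?thesis using jN'[OF that] ext(2) by (simp add: joined_def)
      qed
      then show "\<forall>a\<in>{qa, qb, M}. \<forall>b\<in>{qa, qb, M}. joined N0 a b" using QQ by blast
    qed
    have qC: "q1 \<in> C" "q2 \<in> C" "q3 \<in> C" by (auto simp: C_def)
    have QsZ: "set Q1 \<subseteq> Z" "set Q2 \<subseteq> Z" "set Q3 \<subseteq> Z" using QZ by auto
    have iZ: "inner y1 W1 \<inter> (Z \<union> Y) = {}" "inner y2 W2 \<inter> (Z \<union> Y) = {}" "inner y3 W3 \<inter> (Z \<union> Y) = {}"
      using inn iQ YU by blast+
    have ext1: "\<forall>v\<in>Z \<union> Y. \<pi>' v = \<pi>' v" by simp
    have "\<exists>p f m. part_state (Z \<union> Y \<union> inner y3 W3) p f m \<and> (\<forall>v\<in>Z \<union> Y. p v = \<pi>' v) \<and>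
        (\<forall>n<Suc M. f n = N' n) \<and> Suc M \<le> m"
      unfolding W3(1)
    proof (rule fill[OF st' _ _ _ _ W3(2)[unfolded W3(1)] _ _ cards(3) _ _ _ _ QsZ(1) QsZ(2) Q(5) Q(6) qC(1) qC(2)])
      show "inner y3 ((b1 # R1) @ (S2 @ [b2]) @ (rev L2 @ L1)) \<inter> (Z \<union> Y) = {}"
        unfolding W3(1)[symmetric] using iZ(3) UU by blast
    qed (use ext1 sp(1-3) in \<open>auto simp: Y\<close>)
    then obtain \<pi>1 N1 M1 where s1: "part_state (Z \<union> Y \<union> inner y3 W3) \<pi>1 N1 M1"
      "\<forall>v\<in>Z \<union> Y. \<pi>1 v = \<pi>' v" "\<forall>n<Suc M. N1 n = N' n" "Suc M \<le> M1" by blast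
    have ext2: "\<forall>v\<in>Z \<union> Y. \<pi>1 v = \<pi>' v" "\<forall>n<Suc M. N1 n = N' n" "Suc M \<le> M1" using s1 by auto
    have "\<exists>p f m. part_state (Z \<union> Y \<union> inner y3 W3 \<union> inner y1 W1) p f m \<and> (\<forall>v\<in>Z \<union> Y \<union> inner y3 W3. p v = \<pi>1 v) \<and>
        (\<forall>n<M1. f n = N1 n) \<and> M1 \<le> m"
      unfolding W1(1)
    proof (rule fill[OF s1(1) _ _ _ _ W1(2)[unfolded W1(1)] _ _ cards(1) _ _ _ _ QsZ(2) QsZ(3) Q(6) Q(7) qC(2) qC(3)])
      show "inner y1 ((b2 # R2) @ (S3 @ [b3]) @ (rev L3 @ L2)) \<inter> (Z \<union> Y \<union> inner y3 W3) = {}"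
        unfolding W1(1)[symmetric] using iZ(1) UU by blast
    qed (use ext2 sp(1-3) in \<open>auto simp: Y\<close>)
    then obtain \<pi>2 N2 M2 where s2: "part_state (Z \<union> Y \<union> inner y3 W3 \<union> inner y1 W1) \<pi>2 N2 M2"
      "\<forall>v\<in>Z \<union> Y \<union> inner y3 W3. \<pi>2 v = \<pi>1 v" "\<forall>n<M1. N2 n = N1 n" "M1 \<le> M2" by blast
    have ext3: "\<forall>v\<in>Z \<union> Y. \<pi>2 v = \<pi>' v" "\<forall>n<Suc M. N2 n = N' n" "Suc M \<le> M2" using s1 s2 by auto
    have "\<exists>p f m. part_state (Z \<union> Y \<union> inner y3 W3 \<union> inner y1 W1 \<union> inner y2 W2) p f m \<and> (\<forall>v\<in>Z \<union> Y \<union> inner y3 W3 \<union> inner y1 W1. p v = \<pi>2 v) \<and>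
        (\<forall>n<M2. f n = N2 n) \<and> M2 \<le> m"
      unfolding W2(1)
    proof (rule fill[OF s2(1) _ _ _ _ W2(2)[unfolded W2(1)] _ _ cards(2) _ _ _ _ QsZ(3) QsZ(1) Q(7) Q(5) qC(3) qC(1)])
      show "inner y2 ((b3 # R3) @ (S1 @ [b1]) @ (rev L1 @ L3)) \<inter> (Z \<union> Y \<union> inner y3 W3 \<union> inner y1 W1) = {}"
        unfolding W2(1)[symmetric] using iZ(2) UU by blast
    qed (use ext3 sp(1-3) in \<open>auto simp: Y\<close>)
    then obtain \<pi>3 N3 M3 where s3: "part_state (Z \<union> Y \<union> inner y3 W3 \<union> inner y1 W1 \<union> inner y2 W2) \<pi>3 N3 M3"
      "\<forall>v\<in>Z \<union> Y \<union> inner y3 W3 \<union> inner y1 W1. \<pi>3 v = \<pi>2 v" "\<forall>n<M2. N3 n = N2 n" "M2 \<le> M3" by blast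
    have all: "Z \<union> inner y ?W = Z \<union> Y \<union> inner y3 W3 \<union> inner y1 W1 \<union> inner y2 W2"
      using inn Q(1) by auto
    have "\<forall>v\<in>Z. \<pi>3 v = \<pi> v" using s1(2) s2(2) s3(2) \<pi>'_Z by simp
    moreover have "\<forall>n<M. N3 n = N n" using s1(3,4) s2(3,4) s3(3,4) by (simp add: N'_def)
    moreover have "M \<le> M3" using s1(4) s2(4) s3(4) by simp
    ultimately show ?thesis using s3(1) unfolding all by blast
  qed
qed

text \<open>The corners of \<open>t0\<close> are the first three parts, each a singleton, with the
  root in part 0; everything except \<open>t0\<close> is the disk to be filled.\<close>

theorem triangulation_partition:
  shows "\<exists>\<pi> N M. part_state VT \<pi> N M"
proof -
  obtain a b c where abc: "tv t0 = {a, b, c}" "a \<noteq> b" "b \<noteq> c" "a \<noteq> c" using tv_cases[OF t0(1)] .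
  have "\<exists>s q. tv t0 = {r, s, q} \<and> r \<noteq> s \<and> s \<noteq> q \<and> r \<noteq> q"
  proof -
    have "r = a \<or> r = b \<or> r = c" using abc t0(2) by auto
    then show ?thesis using abc by (elim disjE) (metis insert_commute)+
  qed
  then obtain s q where sq: "tv t0 = {r, s, q}" "r \<noteq> s" "s \<noteq> q" "r \<noteq> q" by blast
  define y where "y i = (1 + of_bool (i = t0) :: bit)" for i
  define \<pi> where "\<pi> = (\<lambda>v. 0 :: nat)(s := 1, q := 2)"
  define N where "N = (\<lambda>_ :: nat. {} :: nat set)(1 := {0}, 2 := {0, 1})"
  let ?W = "[r] @ [s] @ [q]"
  have y1: "y i = 1 \<longleftrightarrow> i \<noteq> t0" for i by (simp add: y_def)
  have N_simps: "N n = (if n = 1 then {0} else if n = 2 then {0, 1} else {})" for n by (simp add: N_def)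
  have sub3: "card A \<le> 3" if "A \<subseteq> {r, s, q}" for A
    using card_mono[OF _ that] sq by simp
  have joinN: "joined N x z" if "x \<in> {0, 1, 2}" "z \<in> {0, 1, 2}" for x z
    using that by (auto simp: joined_def N_simps)
  have \<pi>_simps: "\<pi> r = 0" "\<pi> s = 1" "\<pi> q = 2" using sq by (simp_all add: \<pi>_def)
  have st: "part_state {r, s, q} \<pi> N 3"
    unfolding part_state_def
  proof (intro conjI allI ballI impI)
    show "{r, s, q} \<subseteq> VT" using sq(1) t0(1) by blast
    show "\<pi> v < 3" if "v \<in> {r, s, q}" for v using that \<pi>_simps by auto
    show "elim_order 3 N" unfolding elim_order_def N_simps by (auto simp: less_Suc_eq)
    show "N n = {}" if "n \<ge> 3" for n using that by (simp add: N_simps)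
    show "joined N (\<pi> u) (\<pi> w)" if "u \<in> {r, s, q}" "w \<in> {r, s, q}" for u w
      using that \<pi>_simps by (intro joinN) auto
    show "card {v \<in> {r, s, q}. \<pi> v = n \<and> level v = l} \<le> 3" for n l by (rule sub3) auto
    show "v = r" if "v \<in> {r, s, q}" "\<pi> v = 0" for v using that \<pi>_simps by auto
  qed (use \<pi>_simps in auto)
  have b: "bounded_by y ?W"
    unfolding bounded_by_def
  proof (intro conjI ballI)
    show "distinct ?W" using sq by simp
    show "cycle_edges ?W \<subseteq> Ed" using edgeI[OF t0(1)] sq by (auto simp: cycle_edges_def)
    show "y t0 = 0" by (simp add: y_def)
    fix e assume e: "e \<in> Ed"
    have "bd y e = of_bool (e \<subseteq> tv t0)"
      unfolding y_def bd_add bd_single[OF t0(1)] using bd_const[OF e] by simp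
    also have "\<dots> = of_bool (e \<in> cycle_edges ?W)"
      using card_Ed[OF e] sq by (auto simp: cycle_edges_def card_2_iff)
    also have "\<dots> = chain (?W @ [hd ?W]) e"
      by (rule chain_cycle[symmetric]) (use sq in auto)
    finally show "bd y e = chain (?W @ [hd ?W]) e" .
  qed simp
  have inn: "{r, s, q} \<union> inner y ?W = VT"
  proof
    show "VT \<subseteq> {r, s, q} \<union> inner y ?W"
    proof
      fix v assume "v \<in> VT"
      then obtain i where i: "i \<in> I" "v \<in> tv i" by blast
      then show "v \<in> {r, s, q} \<union> inner y ?W" using sq(1) y1[of i] by (cases "i = t0") (auto simp: inner_def)
    qed
    have "{r, s, q} \<subseteq> VT" using sq(1) t0(1) by blast
    then show "{r, s, q} \<union> inner y ?W \<subseteq> VT" by (auto simp: inner_def)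
  qed
  have "\<exists>\<pi>' N' M'. part_state ({r, s, q} \<union> inner y ?W) \<pi>' N' M' \<and> (\<forall>v\<in>{r, s, q}. \<pi>' v = \<pi> v) \<and>
    (\<forall>n<3. N' n = N n) \<and> 3 \<le> M'"
    by (rule fill_disk[OF st b, of 0 1 2]) (use \<pi>_simps joinN in \<open>auto simp: inner_def\<close>)
  then show ?thesis unfolding inn by blast
qed

end

section \<open>Spheres with polygonal faces and their cone triangulation\<close>

section \<open>Combinatorial spheres\<close>

text \<open>The strong product is spelled out: \<open>l\<close> maps to the path,
  \<open>\<pi>\<close> to the chordal graph, and the bound 3 on the cells stands for the triangle.
  The conditions on \<open>r\<close> make two structures compatible when they are glued at a
  vertex.\<close>

definition product_structured :: "'a set \<Rightarrow> ('a \<Rightarrow> 'a \<Rightarrow> bool) \<Rightarrow> 'a \<Rightarrow> bool" where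
  "product_structured V E r \<longleftrightarrow> (\<exists>l \<pi> N. elim_order 3 N \<and>
     (\<forall>u w. E u w \<longrightarrow> near (l u) (l w) \<and> joined N (\<pi> u) (\<pi> w)) \<and>
     (\<forall>n k. card {v\<in>V. \<pi> v = n \<and> l v = k} \<le> 3) \<and> l r = 0 \<and> \<pi> r = 0 \<and> (\<forall>v\<in>V. \<pi> v = 0 \<longrightarrow> v = r))"

text \<open>The boundary of a 2-chain of faces. Faces are pairs because the two faces of a single
  cycle have the same edges and differ in the second component only.\<close>

definition face_bd :: "('a set set \<times> 'b) set \<Rightarrow> ('a set set \<times> 'b \<Rightarrow> bit) \<Rightarrow> 'a set \<Rightarrow> bit" where
  "face_bd \<Phi> y e = (\<Sum>f\<in>\<Phi>. if e \<in> fst f then y f else 0)"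

text \<open>The faces of a plane graph with edge set \<open>F\<close>, each given by its bounding cycle and a label.
  The conditions are those of a triangulated sphere, before the faces are triangulated.\<close>

definition sphere :: "'a set set \<Rightarrow> ('a set set \<times> 'b) set \<Rightarrow> bool" where
  "sphere F \<Phi> \<longleftrightarrow> finite F \<and> finite \<Phi> \<and>
     (\<forall>f\<in>\<Phi>. fst f \<subseteq> F \<and> (\<exists>xs. distinct xs \<and> length xs \<ge> 3 \<and> fst f = cycle_edges xs)) \<and>
     (\<forall>e\<in>F. card {f\<in>\<Phi>. e \<in> fst f} = 2) \<and>
     (\<forall>x. (\<forall>v. vsum F x v = 0) \<longrightarrow> (\<exists>y. \<forall>e\<in>F. x e = face_bd \<Phi> y e)) \<and>
     (\<forall>v y. (\<forall>e\<in>F. v \<in> e \<longrightarrow> face_bd \<Phi> y e = 0) \<longrightarrow>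
        (\<forall>f\<in>\<Phi>. \<forall>g\<in>\<Phi>. v \<in> \<Union>(fst f) \<longrightarrow> v \<in> \<Union>(fst g) \<longrightarrow> y f = y g))"

lemma face_bd_add: "face_bd \<Phi> (\<lambda>f. y f + z f) e = face_bd \<Phi> y e + face_bd \<Phi> z e"
  unfolding face_bd_def sum.distrib[symmetric] by (rule sum.cong) auto

text \<open>A new vertex \<open>Inr f\<close> in every face \<open>f\<close>, joined to the whole bounding cycle; triangles are
  pairs of a face and one of its edges.\<close>

context
  fixes F :: "'a set set" and \<Phi> :: "('a set set \<times> 'b) set"
  assumes sph: "sphere F \<Phi>"
begin

abbreviation "hub_index \<equiv> Sigma \<Phi> fst"

abbreviation hub_tri :: "('a set set \<times> 'b) \<times> 'a set \<Rightarrow> ('a + 'a set set \<times> 'b) set" where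
  "hub_tri i \<equiv> insert (Inr (fst i)) (Inl ` snd i)"

abbreviation spoke :: "'a set set \<times> 'b \<Rightarrow> 'a \<Rightarrow> ('a + 'a set set \<times> 'b) set" where
  "spoke f u \<equiv> {Inr f, Inl u}"

lemma sphere_finite: "finite F" "finite \<Phi>" "f \<in> \<Phi> \<Longrightarrow> finite (fst f)"
  using sph unfolding sphere_def by (auto intro: finite_subset)

lemma sphere_fills: "(\<And>v. vsum F x v = 0) \<Longrightarrow> \<exists>y. \<forall>e\<in>F. x e = face_bd \<Phi> y e"
proof -
  assume v: "\<And>v. vsum F x v = 0"
  have "\<forall>x. (\<forall>v. vsum F x v = 0) \<longrightarrow> (\<exists>y. \<forall>e\<in>F. x e = face_bd \<Phi> y e)"
    using sph unfolding sphere_def by (elim conjE)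
  then show ?thesis using v by (elim allE impE) simp_all
qed

lemma sphere_face:
  assumes "f \<in> \<Phi>"
  obtains xs where "distinct xs" "length xs \<ge> 3" "fst f = cycle_edges xs" "set xs = \<Union>(fst f)" "fst f \<subseteq> F"
proof -
  obtain xs where xs: "distinct xs" "length xs \<ge> 3" "fst f = cycle_edges xs" "fst f \<subseteq> F"
    using sph assms unfolding sphere_def by metis
  have s: "set xs = \<Union>(fst f)" using Union_cycle_edges[of xs] xs by simp
  show thesis by (rule that[OF xs(1-3) s xs(4)])
qed

lemma sphere_edge: "e \<in> F \<Longrightarrow> \<exists>f\<in>\<Phi>. e \<in> fst f" "e \<in> F \<Longrightarrow> card e = 2"
proof -
  assume e: "e \<in> F"
  then have "card {f\<in>\<Phi>. e \<in> fst f} = 2" using sph by (simp add: sphere_def)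
  then have "{f\<in>\<Phi>. e \<in> fst f} \<noteq> {}" by force
  then show ex: "\<exists>f\<in>\<Phi>. e \<in> fst f" by blast
  then obtain f where f: "f \<in> \<Phi>" "e \<in> fst f" by blast
  from f(1) obtain xs where "distinct xs" "length xs \<ge> 3" "fst f = cycle_edges xs" by (rule sphere_face)
  with f(2) show "card e = 2" using card_cycle_edges_elem by blast
qed

lemma face_degree:
  assumes "f \<in> \<Phi>" "u \<in> \<Union>(fst f)"
  obtains e1 e2 where "e1 \<noteq> e2" "{e\<in>fst f. u \<in> e} = {e1, e2}"
proof -
  from assms(1) obtain xs where "distinct xs" "length xs \<ge> 3" "fst f = cycle_edges xs" "set xs = \<Union>(fst f)"
    by (rule sphere_face)
  then show thesis using cycle_edges_degree[of xs u] assms(2) that by metis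
qed

lemma image_Inl_eq [simp]: "(Inl ` e :: ('a + 'c) set) = Inl ` e' \<longleftrightarrow> e = e'"
  by (rule inj_image_eq_iff) simp

lemma rim_edge:
  assumes e: "e \<in> F"
  shows "Inl ` e \<in> tri_edges hub_index hub_tri"
proof -
  obtain f where "f \<in> \<Phi>" "e \<in> fst f" using sphere_edge(1)[OF e] by blast
  then have "(f, e) \<in> hub_index" "Inl ` e \<subseteq> hub_tri (f, e)" by auto
  moreover have "card (Inl ` e) = 2" using sphere_edge(2)[OF e] by (simp add: card_image)
  ultimately show ?thesis unfolding tri_edges_def by blast
qed

lemma spoke_edge:
  assumes "f \<in> \<Phi>" "u \<in> \<Union>(fst f)"
  shows "spoke f u \<in> tri_edges hub_index hub_tri"
proof -
  obtain e where "e \<in> fst f" "u \<in> e" using assms(2) by blast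
  then have "(f, e) \<in> hub_index" "spoke f u \<subseteq> hub_tri (f, e)" using assms(1) by auto
  moreover have "card (spoke f u) = 2" by simp
  ultimately show ?thesis unfolding tri_edges_def by blast
qed

lemma hub_edge_cases:
  assumes "d \<in> tri_edges hub_index hub_tri"
  obtains e where "e \<in> F" "d = Inl ` e" | f u where "f \<in> \<Phi>" "u \<in> \<Union>(fst f)" "d = spoke f u"
proof -
  obtain f e where fe: "f \<in> \<Phi>" "e \<in> fst f" "d \<subseteq> insert (Inr f) (Inl ` e)" "card d = 2"
    using assms by (auto simp: tri_edges_def)
  then have "fst f \<subseteq> F" by (elim sphere_face)
  then have eF: "e \<in> F" using fe by blast
  obtain a b where e: "e = {a, b}" "a \<noteq> b" using sphere_edge(2)[OF eF] by (auto simp: card_2_iff)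
  have d: "d \<subseteq> {Inr f, Inl a, Inl b}" using fe(3) e(1) by auto
  obtain p q where "d = {p, q}" "p \<noteq> q" using fe(4) by (auto simp: card_2_iff)
  with d consider "d = {Inl a, Inl b}" | "d = spoke f a" | "d = spoke f b" by auto
  then show thesis
  proof cases
    case 1
    then show thesis using e eF by (intro that(1)[of e]) auto
  next
    case 2
    then show thesis using e fe by (intro that(2)[of f a]) auto
  next
    case 3
    then show thesis using e fe by (intro that(2)[of f b]) auto
  qed
qed

lemma hub_at_rim: "e \<in> F \<Longrightarrow> {i\<in>hub_index. Inl ` e \<subseteq> hub_tri i} = (\<lambda>f. (f, e)) ` {f\<in>\<Phi>. e \<in> fst f}"
proof -
  assume e: "e \<in> F"
  have "e' = e" if "f \<in> \<Phi>" "e' \<in> fst f" "Inl ` e \<subseteq> insert (Inr f) (Inl ` e')" for f e'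
  proof -
    have "e \<subseteq> e'" using that(3) by auto
    moreover have "e' \<in> F" using that(1,2) by (elim sphere_face) blast
    ultimately show ?thesis using sphere_edge(2)[OF e] sphere_edge(2)[of e']
      by (metis card_subset_eq card.infinite zero_neq_numeral)
  qed
  then show ?thesis by fastforce
qed

lemma hub_at_spoke: "f \<in> \<Phi> \<Longrightarrow> {i\<in>hub_index. spoke f u \<subseteq> hub_tri i} = (\<lambda>e. (f, e)) ` {e\<in>fst f. u \<in> e}"
  by auto

lemma hub_bd_rim:
  assumes "e \<in> F"
  shows "tri_bd hub_index hub_tri y (Inl ` e) = face_bd \<Phi> (\<lambda>f. y (f, e)) e"
proof -
  have "tri_bd hub_index hub_tri y (Inl ` e) = (\<Sum>f\<in>{f\<in>\<Phi>. e \<in> fst f}. y (f, e))"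
    unfolding tri_bd_def hub_at_rim[OF assms] by (subst sum.reindex) (auto simp: inj_on_def)
  also have "\<dots> = face_bd \<Phi> (\<lambda>f. y (f, e)) e"
    unfolding face_bd_def by (rule sum.inter_filter) (rule sphere_finite)
  finally show ?thesis .
qed

lemma hub_bd_spoke:
  assumes "f \<in> \<Phi>"
  shows "tri_bd hub_index hub_tri y (spoke f u) = vsum (fst f) (\<lambda>e. y (f, e)) u"
  unfolding tri_bd_def vsum_def hub_at_spoke[OF assms] by (subst sum.reindex) (auto simp: inj_on_def)

lemma hub_vsum_rim:
  "vsum (tri_edges hub_index hub_tri) x (Inl v) =
     vsum F (\<lambda>e. x (Inl ` e)) v + (\<Sum>f\<in>{f\<in>\<Phi>. v \<in> \<Union>(fst f)}. x (spoke f v))"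
proof -
  have eq: "{d \<in> tri_edges hub_index hub_tri. Inl v \<in> d} =
      (`) Inl ` {e\<in>F. v \<in> e} \<union> (\<lambda>f. spoke f v) ` {f\<in>\<Phi>. v \<in> \<Union>(fst f)}" (is "?A = ?B")
  proof (intro equalityI subsetI)
    fix d assume d: "d \<in> ?A"
    then have "d \<in> tri_edges hub_index hub_tri" by simp
    then show "d \<in> ?B"
    proof (cases rule: hub_edge_cases)
      case (1 e)
      then have "v \<in> e" using d by auto
      then show ?thesis using 1 by blast
    next
      case (2 f u)
      then have "u = v" using d by auto
      then show ?thesis using 2 by blast
    qed
  next
    fix d assume "d \<in> ?B"
    then show "d \<in> ?A" using rim_edge spoke_edge by fast
  qed
  have "(\<Sum>d\<in>{d \<in> tri_edges hub_index hub_tri. Inl v \<in> d}. x d) =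
      (\<Sum>d\<in>(`) Inl ` {e\<in>F. v \<in> e}. x d) + (\<Sum>d\<in>(\<lambda>f. spoke f v) ` {f\<in>\<Phi>. v \<in> \<Union>(fst f)}. x d)"
    unfolding eq by (rule sum.union_disjoint) (use sphere_finite in auto)
  also have "(\<Sum>d\<in>(`) Inl ` {e\<in>F. v \<in> e}. x d) = (\<Sum>e\<in>{e\<in>F. v \<in> e}. x (Inl ` e))"
    by (subst sum.reindex) (auto simp: inj_on_def)
  also have "(\<Sum>d\<in>(\<lambda>f. spoke f v) ` {f\<in>\<Phi>. v \<in> \<Union>(fst f)}. x d) = (\<Sum>f\<in>{f\<in>\<Phi>. v \<in> \<Union>(fst f)}. x (spoke f v))"
    by (subst sum.reindex) (auto simp: inj_on_def doubleton_eq_iff)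
  finally show ?thesis by (simp add: vsum_def)
qed

lemma hub_vsum_hub:
  assumes "f \<in> \<Phi>"
  shows "vsum (tri_edges hub_index hub_tri) x (Inr f) = (\<Sum>u\<in>\<Union>(fst f). x (spoke f u))"
proof -
  have "{d \<in> tri_edges hub_index hub_tri. Inr f \<in> d} = spoke f ` \<Union>(fst f)" (is "?A = ?B")
  proof (intro equalityI subsetI)
    fix d assume d: "d \<in> ?A"
    then have "d \<in> tri_edges hub_index hub_tri" by simp
    then show "d \<in> ?B"
    proof (cases rule: hub_edge_cases)
      case (2 g u)
      then have "g = f" using d by auto
      then show ?thesis using 2 by blast
    qed (use d in auto)
  next
    fix d assume "d \<in> ?B"
    then show "d \<in> ?A" using spoke_edge[OF assms] by fast
  qed
  then have "vsum (tri_edges hub_index hub_tri) x (Inr f) = sum x (spoke f ` \<Union>(fst f))" by (simp add: vsum_def)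
  also have "\<dots> = (\<Sum>u\<in>\<Union>(fst f). x (spoke f u))"
    by (subst sum.reindex) (auto simp: inj_on_def doubleton_eq_iff)
  finally show ?thesis .
qed

text \<open>The spokes of a face carry an even total, so \<open>path_join\<close> finds triangles in
  that face whose boundary agrees with \<open>x\<close> on the spokes. What is left of
  \<open>x\<close> is a cycle on \<open>F\<close>, which is filled by whole faces; constants on
  faces do not affect spokes.\<close>

lemma hub_fills:
  assumes x: "\<And>v. vsum (tri_edges hub_index hub_tri) x v = 0"
  shows "\<exists>y. \<forall>d\<in>tri_edges hub_index hub_tri. x d = tri_bd hub_index hub_tri y d"
proof -
  have "\<exists>z. \<forall>u\<in>\<Union>(fst f). vsum (fst f) z u = x (spoke f u)" if f: "f \<in> \<Phi>" for f
  proof -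
    from f obtain xs where xs: "distinct xs" "length xs \<ge> 3" "fst f = cycle_edges xs" "set xs = \<Union>(fst f)" by (rule sphere_face)
    have "(\<Sum>u\<in>set xs. x (spoke f u)) = 0" using x[of "Inr f"] unfolding hub_vsum_hub[OF f] xs(4) .
    then obtain z where z: "\<forall>e. e \<notin> path_edges xs \<longrightarrow> z e = 0" "\<forall>v\<in>set xs. vsum (path_edges xs) z v = x (spoke f v)"
      using path_join[of xs "\<lambda>u. x (spoke f u)"] xs(1,2) by fastforce
    have "vsum (fst f) z u = vsum (path_edges xs) z u" for u
      unfolding xs(3) by (rule vsum_mono_neutral) (use z(1) cycle_edges_last(1)[OF xs(1,2)] in auto)
    then show ?thesis using z(2) xs(4) by (intro exI[of _ z]) simp
  qed
  then obtain z where z: "\<And>f u. f \<in> \<Phi> \<Longrightarrow> u \<in> \<Union>(fst f) \<Longrightarrow> vsum (fst f) (z f) u = x (spoke f u)" by metis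
  define x' where "x' e = x (Inl ` e) + face_bd \<Phi> (\<lambda>f. z f e) e" for e
  have "vsum F x' v = 0" for v
  proof -
    have "vsum F (\<lambda>e. face_bd \<Phi> (\<lambda>f. z f e) e) v = (\<Sum>f\<in>\<Phi>. \<Sum>e\<in>{e\<in>F. v \<in> e}. if e \<in> fst f then z f e else 0)"
      unfolding vsum_def face_bd_def by (rule sum.swap)
    also have "\<dots> = (\<Sum>f\<in>\<Phi>. if v \<in> \<Union>(fst f) then x (spoke f v) else 0)"
    proof (rule sum.cong[OF refl])
      fix f assume f: "f \<in> \<Phi>"
      then have "fst f \<subseteq> F" by (elim sphere_face)
      then have "{e\<in>fst f. v \<in> e} = {e \<in> {e\<in>F. v \<in> e}. e \<in> fst f}" by blast
      then have "vsum (fst f) (z f) v = (\<Sum>e\<in>{e\<in>F. v \<in> e}. if e \<in> fst f then z f e else 0)"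
        unfolding vsum_def by (simp only:) (rule sum.inter_filter, use sphere_finite in simp)
      moreover have "vsum (fst f) (z f) v = (if v \<in> \<Union>(fst f) then x (spoke f v) else 0)"
      proof (cases "v \<in> \<Union>(fst f)")
        case False
        then have "{e\<in>fst f. v \<in> e} = {}" by blast
        then show ?thesis using False by (simp only: vsum_def sum.empty if_False)
      qed (use z[OF f, of v] in simp)
      ultimately show "(\<Sum>e\<in>{e\<in>F. v \<in> e}. if e \<in> fst f then z f e else 0) = (if v \<in> \<Union>(fst f) then x (spoke f v) else 0)"
        by simp
    qed
    also have "\<dots> = (\<Sum>f\<in>{f\<in>\<Phi>. v \<in> \<Union>(fst f)}. x (spoke f v))"
      by (rule sum.inter_filter[symmetric]) (rule sphere_finite)
    finally show ?thesis using x[of "Inl v"] unfolding hub_vsum_rim x'_def vsum_add by simp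
  qed
  then obtain d where d: "\<forall>e\<in>F. x' e = face_bd \<Phi> d e" using sphere_fills by blast
  define y where "y i = z (fst i) (snd i) + d (fst i)" for i
  have rim: "x (Inl ` e) = tri_bd hub_index hub_tri y (Inl ` e)" if e: "e \<in> F" for e
  proof -
    have "tri_bd hub_index hub_tri y (Inl ` e) = face_bd \<Phi> (\<lambda>f. z f e) e + x' e"
      using d e unfolding hub_bd_rim[OF e] by (simp add: y_def face_bd_add)
    then show ?thesis unfolding x'_def by (simp add: add_ac)
  qed
  have sp: "x (spoke f u) = tri_bd hub_index hub_tri y (spoke f u)" if f: "f \<in> \<Phi>" "u \<in> \<Union>(fst f)" for f u
  proof -
    obtain e1 e2 where "e1 \<noteq> e2" "{e\<in>fst f. u \<in> e} = {e1, e2}" using face_degree[OF f] .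
    then have "vsum (fst f) (\<lambda>e. d f) u = 0" by (simp add: vsum_def)
    then show ?thesis using z[OF f] unfolding hub_bd_spoke[OF f(1)] y_def by (simp add: vsum_add)
  qed
  have "x d = tri_bd hub_index hub_tri y d" if "d \<in> tri_edges hub_index hub_tri" for d
    using that by (rule hub_edge_cases) (simp_all only: rim sp)
  then show ?thesis by blast
qed

text \<open>At an old vertex the two triangles of one face agree across their common spoke, so
  \<open>y\<close> becomes a function of the face, and the link condition of the sphere applies. At
  a hub the link is the bounding cycle.\<close>

lemma hub_link:
  assumes y: "\<And>d. d \<in> tri_edges hub_index hub_tri \<Longrightarrow> p \<in> d \<Longrightarrow> tri_bd hub_index hub_tri y d = 0"
    and ij: "i \<in> hub_index" "j \<in> hub_index" "p \<in> hub_tri i" "p \<in> hub_tri j"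
  shows "y i = y j"
proof (cases p)
  case (Inl v)
  have same: "y (f, e) = y (f, e')" if f: "f \<in> \<Phi>" "e \<in> fst f" "e' \<in> fst f" "v \<in> e" "v \<in> e'" for f e e'
  proof -
    have u: "v \<in> \<Union>(fst f)" using f by blast
    then have "vsum (fst f) (\<lambda>e. y (f, e)) v = 0"
      using y[of "spoke f v"] spoke_edge[OF f(1) u] unfolding hub_bd_spoke[OF f(1)] by (simp add: Inl)
    moreover obtain e1 e2 where e12: "e1 \<noteq> e2" "{e\<in>fst f. v \<in> e} = {e1, e2}" using face_degree[OF f(1) u] .
    ultimately have "y (f, e1) = y (f, e2)" using vsum_two[OF e12(2,1)] by (simp add: bit_add_eq_0_iff)
    moreover have "e \<in> {e1, e2}" "e' \<in> {e1, e2}" using e12(2) f by blast+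
    ultimately show ?thesis by auto
  qed
  define w where "w f = y (f, SOME e. e \<in> fst f \<and> v \<in> e)" for f
  have w: "y (f, e) = w f" if "f \<in> \<Phi>" "e \<in> fst f" "v \<in> e" for f e
  proof -
    have "(SOME e. e \<in> fst f \<and> v \<in> e) \<in> fst f \<and> v \<in> (SOME e. e \<in> fst f \<and> v \<in> e)"
      by (rule someI[of "\<lambda>e. e \<in> fst f \<and> v \<in> e" e]) (use that in simp)
    then show ?thesis unfolding w_def using same that by blast
  qed
  have "face_bd \<Phi> w e = 0" if e: "e \<in> F" "v \<in> e" for e
  proof -
    have "face_bd \<Phi> w e = face_bd \<Phi> (\<lambda>f. y (f, e)) e"
      unfolding face_bd_def by (rule sum.cong) (use w e in auto)
    also have "\<dots> = 0" using y[of "Inl ` e"] e rim_edge[OF e(1)] unfolding hub_bd_rim[OF e(1)] by (simp add: Inl)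
    finally show ?thesis .
  qed
  then have c: "w f = w g" if "f \<in> \<Phi>" "g \<in> \<Phi>" "v \<in> \<Union>(fst f)" "v \<in> \<Union>(fst g)" for f g
    using sph that unfolding sphere_def by blast
  obtain f e g e' where fg: "i = (f, e)" "j = (g, e')" by (cases i; cases j)
  then have "f \<in> \<Phi>" "g \<in> \<Phi>" "e \<in> fst f" "e' \<in> fst g" "v \<in> e" "v \<in> e'" using ij Inl by auto
  then show ?thesis using w c[of f g] fg by auto
next
  case (Inr f)
  then obtain e e' where fe: "i = (f, e)" "j = (f, e')" "f \<in> \<Phi>" "e \<in> fst f" "e' \<in> fst f"
    using ij by auto
  from fe(3) obtain xs where xs: "distinct xs" "length xs \<ge> 3" "fst f = cycle_edges xs" "set xs = \<Union>(fst f)" by (rule sphere_face)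
  have "vsum (cycle_edges xs) (\<lambda>e. y (f, e)) v = 0" if "v \<in> set xs" for v
    using y[of "spoke f v"] that spoke_edge[OF fe(3)] unfolding hub_bd_spoke[OF fe(3)] xs(3)[symmetric] xs(4) by (simp add: Inr)
  then show ?thesis using cycle_const[OF xs(1,2), of "\<lambda>e. y (f, e)"] fe xs(3) by metis
qed

lemma hub_triangulation:
  assumes conn: "\<And>v. v \<in> \<Union>F \<Longrightarrow> (r, v) \<in> {(u, w). {u, w} \<in> F}\<^sup>*"
    and t0: "t0 \<in> hub_index" "r \<in> snd t0"
  shows "triangulation hub_index hub_tri t0 (Inl r)"
proof
  show "finite hub_index" using sphere_finite by blast
  show "card (hub_tri i) = 3" if "i \<in> hub_index" for i
  proof -
    have "snd i \<in> F" using that by (auto elim!: sphere_face)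
    then have c: "card (snd i) = 2" by (rule sphere_edge)
    then have "finite (snd i)" by (metis card.infinite zero_neq_numeral)
    then show ?thesis using c by (subst card_insert_disjoint) (auto simp: card_image)
  qed
  show "card {j\<in>hub_index. d \<subseteq> hub_tri j} = 2" if "i \<in> hub_index" "d \<subseteq> hub_tri i" "card d = 2" for i d
  proof -
    have "d \<in> tri_edges hub_index hub_tri" using that unfolding tri_edges_def by blast
    then show ?thesis
    proof (cases rule: hub_edge_cases)
      case (1 e)
      have "card {f\<in>\<Phi>. e \<in> fst f} = 2" using sph 1(1) by (simp add: sphere_def)
      then show ?thesis unfolding 1(2) hub_at_rim[OF 1(1)] by (subst card_image) (auto simp: inj_on_def)
    next
      case (2 f u)
      obtain e1 e2 where "e1 \<noteq> e2" "{e\<in>fst f. u \<in> e} = {e1, e2}" using face_degree[OF 2(1,2)] .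
      then show ?thesis unfolding 2(3) hub_at_spoke[OF 2(1)] by (subst card_image) (auto simp: inj_on_def)
    qed
  qed
  show "\<exists>y. \<forall>e\<in>tri_edges hub_index hub_tri. x e = tri_bd hub_index hub_tri y e"
    if "\<And>v. vsum (tri_edges hub_index hub_tri) x v = 0" for x
    using hub_fills[OF that] .
  show "y i = y j"
    if "\<And>e. e \<in> tri_edges hub_index hub_tri \<Longrightarrow> v \<in> e \<Longrightarrow> tri_bd hub_index hub_tri y e = 0"
      "i \<in> hub_index" "j \<in> hub_index" "v \<in> hub_tri i" "v \<in> hub_tri j" for v y i j
    using hub_link[OF that] .
  let ?R = "{(u, w). {u, w} \<in> tri_edges hub_index hub_tri}"
  have rim: "(Inl r, Inl v) \<in> ?R\<^sup>*" if "v \<in> \<Union>F" for v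
    using conn[OF that]
  proof induction
    case (step u w)
    have "Inl ` {u, w} \<in> tri_edges hub_index hub_tri" using step(2) by (intro rim_edge) simp
    then have "(Inl u, Inl w) \<in> ?R" by simp
    then show ?case using step(3) by (rule rtrancl_into_rtrancl[rotated])
  qed simp
  show "(Inl r, v) \<in> ?R\<^sup>*" if i: "i \<in> hub_index" "v \<in> hub_tri i" for i v
  proof -
    obtain f e where fe: "i = (f, e)" "f \<in> \<Phi>" "e \<in> fst f" using i(1) by blast
    have eF: "e \<in> F" using fe(2,3) by (elim sphere_face) blast
    then obtain u where u: "u \<in> e" using sphere_edge(2)[OF eF] by fastforce
    show ?thesis
    proof (cases v)
      case (Inl w)
      then show ?thesis using rim i(2) fe(1) eF by auto
    next
      case (Inr g)
      then have "g = f" using i(2) fe(1) by auto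
      moreover have "spoke f u \<in> tri_edges hub_index hub_tri" using fe u by (intro spoke_edge) auto
      ultimately have "(Inl u, v) \<in> ?R" using Inr by (simp add: insert_commute)
      moreover have "(Inl r, Inl u) \<in> ?R\<^sup>*" using rim u eF by blast
      ultimately show ?thesis by (rule rtrancl_into_rtrancl[rotated])
    qed
  qed
  show "t0 \<in> hub_index" by fact
  show "Inl r \<in> hub_tri t0" using t0 by simp
qed

theorem sphere_product_structured:
  assumes conn: "\<And>v. v \<in> \<Union>F \<Longrightarrow> (r, v) \<in> {(u, w). {u, w} \<in> F}\<^sup>*"
    and r: "r \<in> \<Union>F" and V: "V \<subseteq> \<Union>F" and E: "\<And>u w. E u w \<Longrightarrow> {u, w} \<in> F"
  shows "product_structured V E r"
proof -
  obtain e where e: "e \<in> F" "r \<in> e" using r by blast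
  then obtain f where "f \<in> \<Phi>" "e \<in> fst f" using sphere_edge by blast
  then have t0: "(f, e) \<in> hub_index" "r \<in> snd (f, e)" using e by auto
  interpret triangulation hub_index hub_tri "(f, e)" "Inl r"
    by (rule hub_triangulation[OF conn t0])
  obtain \<pi> N M where st: "part_state VT \<pi> N M" using triangulation_partition by blast
  note s = st[unfolded part_state_def]
  have VT: "Inl v \<in> VT" if v: "v \<in> \<Union>F" for v
  proof -
    obtain e' where e': "e' \<in> F" "v \<in> e'" using v by blast
    then obtain f' where "f' \<in> \<Phi>" "e' \<in> fst f'" using sphere_edge by blast
    then have "(f', e') \<in> hub_index" "Inl v \<in> hub_tri (f', e')" using e' by auto
    then show ?thesis by blast
  qed
  have edge: "{Inl u, Inl w} \<in> Ed" if "E u w" for u w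
  proof -
    have "Inl ` {u, w} \<in> Ed" by (rule rim_edge[OF E[OF that]])
    then show ?thesis by simp
  qed
  show ?thesis
    unfolding product_structured_def
  proof (rule exI[of _ "\<lambda>v. level (Inl v)"], rule exI[of _ "\<lambda>v. \<pi> (Inl v)"], rule exI[of _ N],
      intro conjI allI impI ballI)
    show "elim_order 3 N" using s by blast
    show "near (level (Inl u)) (level (Inl w))" if "E u w" for u w
      using level_edge[OF edge[OF that]] level_edge[of "Inl w" "Inl u"] edge[OF that]
      by (simp add: near_def insert_commute)
    show "joined N (\<pi> (Inl u)) (\<pi> (Inl w))" if "E u w" for u w
      using s edge[OF that] edge_VT[OF edge[OF that]] by blast
    show "card {v\<in>V. \<pi> (Inl v) = n \<and> level (Inl v) = k} \<le> 3" for n k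
    proof -
      have "Inl ` {v\<in>V. \<pi> (Inl v) = n \<and> level (Inl v) = k} \<subseteq> {v\<in>VT. \<pi> v = n \<and> level v = k}"
      proof (rule image_subsetI)
        fix v assume v: "v \<in> {v\<in>V. \<pi> (Inl v) = n \<and> level (Inl v) = k}"
        then have "Inl v \<in> VT" using V by (intro VT) auto
        then show "Inl v \<in> {v\<in>VT. \<pi> v = n \<and> level v = k}" using v by simp
      qed
      then have "card (Inl ` {v\<in>V. \<pi> (Inl v) = n \<and> level (Inl v) = k} :: ('a + 'a set set \<times> 'b) set) \<le>
          card {v\<in>VT. \<pi> v = n \<and> level v = k}"
        by (rule card_mono[rotated]) (rule finite_subset[OF _ finite_VT], blast)
      also have "\<dots> \<le> 3" using s by blast
      finally show ?thesis by (simp add: card_image)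
    qed
    show "v = r" if "v \<in> V" "\<pi> (Inl v) = 0" for v
    proof -
      have "Inl v \<in> VT" using that(1) V VT by blast
      then have "Inl v = (Inl r :: 'a + 'a set set \<times> 'b)" using s that(2) by blast
      then show ?thesis by simp
    qed
  qed (use s in auto)
qed

end

section \<open>Spheres built by adding ears\<close>

lemma vsum_cycle_edges:
  assumes "distinct xs" "length xs \<ge> 3"
  shows "vsum (cycle_edges xs) (\<lambda>_. k) v = 0"
proof (cases "v \<in> set xs")
  case True
  then obtain e1 e2 where "e1 \<noteq> e2" "{e \<in> cycle_edges xs. v \<in> e} = {e1, e2}" using cycle_edges_degree assms by metis
  then show ?thesis by (simp add: vsum_def)
next
  case False
  have "length xs \<ge> 2" using assms by simp
  then have "v \<notin> \<Union>(cycle_edges xs)" using False Union_cycle_edges[of xs] by simp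
  then have "{e \<in> cycle_edges xs. v \<in> e} = {}" by blast
  then show ?thesis by (simp only: vsum_def sum.empty)
qed

lemma sphere_cycle:
  assumes xs: "distinct xs" "length xs \<ge> 3"
  shows "sphere (cycle_edges xs) {(cycle_edges xs, True), (cycle_edges xs, False)}"
  unfolding sphere_def
proof (intro conjI ballI allI impI)
  let ?C = "cycle_edges xs"
  let ?\<Phi> = "{(?C, True), (?C, False)}"
  have bd: "face_bd ?\<Phi> y e = y (?C, True) + y (?C, False)" if "e \<in> ?C" for y e
    using that by (simp add: face_bd_def)
  show "finite ?C" "finite ?\<Phi>" by simp_all
  show "fst f \<subseteq> ?C" "\<exists>ys. distinct ys \<and> length ys \<ge> 3 \<and> fst f = cycle_edges ys" if "f \<in> ?\<Phi>" for f
    using that xs by auto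
  show "card {f\<in>?\<Phi>. e \<in> fst f} = 2" if "e \<in> ?C" for e
  proof -
    have "{f\<in>?\<Phi>. e \<in> fst f} = ?\<Phi>" using that by auto
    then show ?thesis by simp
  qed
  show "\<exists>y. \<forall>e\<in>?C. x e = face_bd ?\<Phi> y e" if x: "\<forall>v. vsum ?C x v = 0" for x
  proof -
    obtain k where k: "\<forall>e\<in>?C. x e = k" using cycle_const[OF xs, of x] x by blast
    then have "\<forall>e\<in>?C. x e = face_bd ?\<Phi> (\<lambda>f. if snd f then k else 0) e" by (simp add: bd)
    then show ?thesis by blast
  qed
  fix v y f g
  assume z: "\<forall>e\<in>?C. v \<in> e \<longrightarrow> face_bd ?\<Phi> y e = 0" and f: "f \<in> ?\<Phi>" "g \<in> ?\<Phi>" "v \<in> \<Union>(fst f)"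
  then obtain e where "e \<in> ?C" "v \<in> e" by auto
  then have "y (?C, True) = y (?C, False)" using z bd[of e y] by (simp add: bit_add_eq_0_iff)
  then show "y f = y g" using f by auto
qed

text \<open>The ear \<open>P\<close> divides the face \<open>f\<close> into \<open>f1\<close> and
  \<open>f2\<close>. Conditions for the new graph are reduced to the old one by transferring chains
  between \<open>f\<close> and the pair. The labels \<open>s1\<close> and \<open>s2\<close> are
  arbitrary here; the drawing determines them.\<close>

lemma sphere_ear:
  fixes F :: "'a set set" and \<Phi> :: "('a set set \<times> bool) set"
  assumes sph: "sphere F \<Phi>" and f: "f \<in> \<Phi>" and d: "distinct (a # ys @ b # ws)" and fc: "fst f = cycle_edges (a # ys @ b # ws)"
    and dp: "distinct (a # ps @ [b])" and P: "P = path_edges (a # ps @ [b])" "P \<inter> F = {}" and ps: "set ps \<inter> \<Union>F = {}"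
    and f1: "f1 = (path_edges (a # ys @ [b]) \<union> P, s1)" and f2: "f2 = (path_edges (b # ws @ [a]) \<union> P, s2)"
  shows "sphere (F \<union> P) (insert f1 (insert f2 (\<Phi> - {f})))"
proof -
  let ?A1 = "path_edges (a # ys @ [b])" and ?A2 = "path_edges (b # ws @ [a])"
  let ?\<Phi> = "insert f1 (insert f2 (\<Phi> - {f}))"
  note fin = sphere_finite[OF sph]
  have fF: "fst f \<subseteq> F" using sphere_face[OF sph f] by metis
  have fA: "fst f = ?A1 \<union> ?A2"
    unfolding fc cycle_edges_def using path_edges_append[of "a # ys" b "ws @ [a]"] by simp
  have AF: "?A1 \<subseteq> F" "?A2 \<subseteq> F" using fA fF by auto
  obtain xs where xs: "distinct xs" "length xs \<ge> 3" "fst f = cycle_edges xs" using sphere_face[OF sph f] by metis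
  have "set xs = set (a # ys @ b # ws)"
    using Union_cycle_edges[of xs] Union_cycle_edges[of "a # ys @ b # ws"] xs fc by simp
  then have len: "length (a # ys @ b # ws) \<ge> 3" using xs(1,2) d by (metis distinct_card)
  have dA: "distinct (a # ys @ [b])" "distinct (b # ws @ [a])" using d by auto
  have A12: "e \<notin> ?A2" if "e \<in> ?A1" for e
  proof
    assume e: "e \<in> ?A2"
    have "chain ((a # ys @ b # ws) @ [hd (a # ys @ b # ws)]) e = chain (a # ys @ [b]) e + chain (b # ws @ [a]) e"
      using chain_append[of "a # ys" b "ws @ [a]" e] by simp
    also have "\<dots> = 0" using chain_distinct[OF dA(1)] chain_distinct[OF dA(2)] e that by simp
    finally show False using chain_cycle[OF d len, of e] e fc fA by auto
  qed
  have U1: "\<Union>?A1 = set (a # ys @ [b])" and U2: "\<Union>?A2 = set (b # ws @ [a])" and UP: "\<Union>P = set (a # ps @ [b])"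
    unfolding P(1) by (rule Union_path_edges, simp)+
  have Pfin: "finite P" unfolding P(1) by simp
  have Pne: "P \<noteq> {}" unfolding P(1) by (cases ps) auto
  have PF: "e \<notin> F" if "e \<in> P" for e using P(2) that by blast
  have f12: "f1 \<noteq> f2"
  proof
    assume "f1 = f2"
    then have "?A1 \<union> P = ?A2 \<union> P" using f1 f2 by simp
    then have "?A1 \<subseteq> P" using A12 by blast
    moreover have "?A1 \<noteq> {}" by (cases ys) auto
    ultimately show False using PF AF(1) by blast
  qed
  have old: "fst g \<subseteq> F" if "g \<in> \<Phi>" for g using sphere_face[OF sph that] by metis
  have new: "f1 \<notin> \<Phi>" "f2 \<notin> \<Phi>" using old f1 f2 Pne PF by fastforce+
  have f1e: "e \<in> fst f1 \<longleftrightarrow> e \<in> ?A1 \<or> e \<in> P" and f2e: "e \<in> fst f2 \<longleftrightarrow> e \<in> ?A2 \<or> e \<in> P" for e using f1 f2 by auto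
  have bd': "face_bd ?\<Phi> y e = (if e \<in> fst f1 then y f1 else 0) + ((if e \<in> fst f2 then y f2 else 0) +
      face_bd (\<Phi> - {f}) y e)" for y e
    unfolding face_bd_def using f12 new fin(2) by simp
  have bd: "face_bd \<Phi> y e = (if e \<in> fst f then y f else 0) + face_bd (\<Phi> - {f}) y e" for y e
    unfolding face_bd_def by (rule sum.remove) (use fin(2) f in auto)
  have bd_P: "face_bd ?\<Phi> y e = y f1 + y f2" if "e \<in> P" for y e
  proof -
    have "face_bd (\<Phi> - {f}) y e = 0"
      unfolding face_bd_def by (rule sum.neutral) (use old PF[OF that] in auto)
    then show ?thesis unfolding bd' using that f1e f2e by simp
  qed
  have bd_F: "face_bd ?\<Phi> y e = (if e \<in> ?A1 then y f1 else 0) + ((if e \<in> ?A2 then y f2 else 0) + face_bd (\<Phi> - {f}) y e)"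
    if "e \<in> F" for y e
    unfolding bd' using that f1e f2e PF by auto
  have cyc1: "fst f1 = cycle_edges (a # ys @ b # rev ps)" and cyc2: "fst f2 = cycle_edges (b # ws @ a # ps)"
  proof -
    have "path_edges (b # rev ps @ [a]) = P" unfolding P(1) using path_edges_rev[of "a # ps @ [b]"] by simp
    then show "fst f1 = cycle_edges (a # ys @ b # rev ps)"
      unfolding f1 cycle_edges_def using path_edges_append[of "a # ys" b "rev ps @ [a]"] by simp
    show "fst f2 = cycle_edges (b # ws @ a # ps)"
      unfolding f2 cycle_edges_def P(1) using path_edges_append[of "b # ws" a "ps @ [b]"] by simp
  qed
  have VF: "set (a # ys @ b # ws) \<subseteq> \<Union>F"
  proof -
    have "set (a # ys @ b # ws) = \<Union>(fst f)" using Union_cycle_edges[of "a # ys @ b # ws"] len fc by simp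
    then show ?thesis using fF by blast
  qed
  have dc: "distinct (a # ys @ b # rev ps)" "distinct (b # ws @ a # ps)" using d dp ps VF by auto
  \<comment> \<open>An ear without inner vertices is a new edge, so it is parallel to no edge of
    \<open>f\<close>, and neither new cycle degenerates to length 2.\<close>
  have lc: "length (a # ys @ b # rev ps) \<ge> 3" "length (b # ws @ a # ps) \<ge> 3"
  proof -
    have "\<not> (ys = [] \<and> ps = [])" "\<not> (ws = [] \<and> ps = [])"
      using PF[of "{a, b}"] AF P(1) by (auto simp: insert_commute)
    then show "length (a # ys @ b # rev ps) \<ge> 3" "length (b # ws @ a # ps) \<ge> 3" by (cases ys; cases ps; cases ws; auto)+
  qed
  show ?thesis
    unfolding sphere_def
  proof (intro conjI ballI allI impI)
    show "finite (F \<union> P)" "finite ?\<Phi>" using fin Pfin by auto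
    show "fst g \<subseteq> F \<union> P" if "g \<in> ?\<Phi>" for g
      using that old[of g] AF f1 f2 by (cases "g \<in> \<Phi>") auto
    show "\<exists>xs. distinct xs \<and> length xs \<ge> 3 \<and> fst g = cycle_edges xs" if g: "g \<in> ?\<Phi>" for g
    proof -
      consider "g = f1" | "g = f2" | "g \<in> \<Phi>" using g by blast
      then show ?thesis
      proof cases
        case 3
        then show ?thesis using sphere_face[OF sph 3] by metis
      qed (use cyc1 cyc2 dc lc in blast)+
    qed
    show "card {g\<in>?\<Phi>. e \<in> fst g} = 2" if e: "e \<in> F \<union> P" for e
    proof (cases "e \<in> P")
      case True
      have "e \<notin> fst g" if "g \<in> \<Phi>" for g using old[OF that] PF[OF True] by blast
      then have "{g\<in>?\<Phi>. e \<in> fst g} = {f1, f2}" using f1e f2e True by blast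
      then show ?thesis using f12 by simp
    next
      case False
      then have eF: "e \<in> F" using e by blast
      have c2: "card {g\<in>\<Phi>. e \<in> fst g} = 2" using sph eF by (simp add: sphere_def)
      define h where "h = (if e \<in> ?A1 then f1 else f2)"
      show ?thesis
      proof (cases "e \<in> fst f")
        case True
        then have "{g\<in>?\<Phi>. e \<in> fst g} = insert h ({g\<in>\<Phi>. e \<in> fst g} - {f})"
          using f1e f2e False fA A12 by (auto simp: h_def)
        moreover have "h \<notin> \<Phi>" using new by (simp add: h_def)
        moreover have "card ({g\<in>\<Phi>. e \<in> fst g} - {f}) = 1" using c2 True f by simp
        ultimately show ?thesis using fin(2) by simp
      next
        case nf: False
        then have "{g\<in>?\<Phi>. e \<in> fst g} = {g\<in>\<Phi>. e \<in> fst g}" using f1e f2e False fA by auto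
        then show ?thesis using c2 by simp
      qed
    qed
    show "\<exists>y. \<forall>e\<in>F \<union> P. x e = face_bd ?\<Phi> y e" if x: "\<forall>v. vsum (F \<union> P) x v = 0" for x
    proof -
      have "vsum P x v = 0" if v: "v \<in> set ps" for v
      proof -
        have "{e\<in>F \<union> P. v \<in> e} = {e\<in>P. v \<in> e}" using ps v by auto
        then have "vsum (F \<union> P) x v = vsum P x v" by (simp only: vsum_def)
        then show ?thesis using x by simp
      qed
      then obtain k where k: "\<forall>e\<in>P. x e = k" using path_const[OF dp, of x] unfolding P(1) by auto
      \<comment> \<open>Adding \<open>k\<close> times the cycle of \<open>f1\<close> clears the ear
        and leaves a cycle on \<open>F\<close>.\<close>
      define x' where "x' e = x e + k * of_bool (e \<in> fst f1)" for e
      have "vsum F x' v = 0" for v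
      proof -
        have "vsum (F \<union> P) (\<lambda>e. k * of_bool (e \<in> fst f1)) v = vsum (fst f1) (\<lambda>e. k * of_bool (e \<in> fst f1)) v"
          by (rule vsum_mono_neutral) (use fin Pfin AF f1 in auto)
        also have "\<dots> = vsum (fst f1) (\<lambda>_. k) v" by (rule vsum_cong) simp
        also have "\<dots> = 0" unfolding cyc1 by (rule vsum_cycle_edges[OF dc(1) lc(1)])
        finally have "vsum (F \<union> P) x' v = 0" using x unfolding x'_def vsum_add by simp
        moreover have "vsum (F \<union> P) x' v = vsum F x' v"
          by (rule vsum_mono_neutral) (use fin Pfin k f1e in \<open>auto simp: x'_def\<close>)
        ultimately show ?thesis by simp
      qed
      then obtain y where y: "\<forall>e\<in>F. x' e = face_bd \<Phi> y e" using sphere_fills[OF sph] by blast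
      \<comment> \<open>Both halves inherit the value of \<open>f\<close>; the extra
        \<open>k\<close> on \<open>f1\<close> restores the value on the ear.\<close>
      define y' where "y' g = (if g = f1 then y f + k else if g = f2 then y f else y g)" for g
      have y': "y' f1 = y f + k" "y' f2 = y f" using f12 by (auto simp: y'_def)
      have rest: "face_bd (\<Phi> - {f}) y' e = face_bd (\<Phi> - {f}) y e" for e
        unfolding face_bd_def by (rule sum.cong) (use new in \<open>auto simp: y'_def\<close>)
      have "x e = face_bd ?\<Phi> y' e" if e: "e \<in> F \<union> P" for e
      proof (cases "e \<in> P")
        case True
        then have "face_bd ?\<Phi> y' e = k" unfolding bd_P[OF True] y' by (simp add: add_ac)
        then show ?thesis using k True by simp
      next
        case False
        then have eF: "e \<in> F" using e by blast
        have "x e = face_bd \<Phi> y e + k * of_bool (e \<in> fst f1)"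
          using y eF unfolding x'_def by (metis add.assoc add.commute bit_add_self_left)
        also have "\<dots> = face_bd ?\<Phi> y' e"
          unfolding bd bd_F[OF eF] rest y' fA using f1e[of e] False A12[of e] by (auto simp: add_ac)
        finally show ?thesis .
      qed
      then show ?thesis by blast
    qed
    fix v y g h
    assume z: "\<forall>e\<in>F \<union> P. v \<in> e \<longrightarrow> face_bd ?\<Phi> y e = 0" and gh: "g \<in> ?\<Phi>" "h \<in> ?\<Phi>" "v \<in> \<Union>(fst g)" "v \<in> \<Union>(fst h)"
    have onP: "y f1 = y f2" if "v \<in> set (a # ps @ [b])"
    proof -
      have "v \<in> \<Union>P" using that UP by simp
      then obtain e where "e \<in> P" "v \<in> e" by blast
      then show ?thesis using z bd_P[of e y] by (simp add: bit_add_eq_0_iff)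
    qed
    show "y g = y h"
    proof (cases "v \<in> \<Union>F")
      case False
      have "g \<in> {f1, f2}" "h \<in> {f1, f2}" using gh old False by blast+
      then have fg: "fst g = ?A1 \<union> P \<or> fst g = ?A2 \<union> P" using f1 f2 by auto
      have nA: "v \<notin> \<Union>?A1" "v \<notin> \<Union>?A2" using False AF by blast+
      have "v \<in> \<Union>P" using fg
      proof
        assume "fst g = ?A1 \<union> P"
        then show ?thesis using gh(3) nA(1) by blast
      next
        assume "fst g = ?A2 \<union> P"
        then show ?thesis using gh(3) nA(2) by blast
      qed
      then have "y f1 = y f2" by (intro onP) (simp only: UP)
      then show ?thesis using \<open>g \<in> {f1, f2}\<close> \<open>h \<in> {f1, f2}\<close> by auto
    next
      case vF: True
      then have vp: "v \<notin> set ps" using ps by blast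
      \<comment> \<open>Near \<open>v\<close> the face \<open>f\<close> takes the value of the half
        that contains \<open>v\<close>. If both contain it, \<open>v\<close> is an end of the ear,
        and the ear edge at \<open>v\<close> forces equal values.\<close>
      define y0 where "y0 k = (if k = f then (if v \<in> \<Union>?A1 then y f1 else y f2) else y k)" for k
      have y0f: "(v \<in> \<Union>?A1 \<longrightarrow> y f1 = y0 f) \<and> (v \<in> \<Union>?A2 \<longrightarrow> y f2 = y0 f)"
      proof -
        have "y f1 = y f2" if "v \<in> \<Union>?A1" "v \<in> \<Union>?A2"
        proof (rule onP)
          show "v \<in> set (a # ps @ [b])" using that d unfolding U1 U2 by auto
        qed
        then show ?thesis unfolding y0_def by presburger
      qed
      have y0: "face_bd \<Phi> y0 e = 0" if e: "e \<in> F" "v \<in> e" for e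
      proof -
        have rest: "face_bd (\<Phi> - {f}) y0 e = face_bd (\<Phi> - {f}) y e"
          unfolding face_bd_def by (rule sum.cong) (auto simp: y0_def)
        have "face_bd \<Phi> y0 e = face_bd ?\<Phi> y e"
          unfolding bd bd_F[OF e(1)] rest fA using y0f e A12[of e] by auto
        then show ?thesis using z e by simp
      qed
      have lk: "y0 k = y0 l" if kl: "k \<in> \<Phi>" "l \<in> \<Phi>" "v \<in> \<Union>(fst k)" "v \<in> \<Union>(fst l)" for k l
      proof -
        have "\<forall>v y. (\<forall>e\<in>F. v \<in> e \<longrightarrow> face_bd \<Phi> y e = 0) \<longrightarrow>
          (\<forall>f\<in>\<Phi>. \<forall>g\<in>\<Phi>. v \<in> \<Union>(fst f) \<longrightarrow> v \<in> \<Union>(fst g) \<longrightarrow> y f = y g)"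
          using sph unfolding sphere_def by (elim conjE)
        from this[rule_format, of v y0 k l] show ?thesis using y0 kl by blast
      qed
      have tr: "\<exists>k\<in>\<Phi>. v \<in> \<Union>(fst k) \<and> y q = y0 k" if q: "q \<in> ?\<Phi>" "v \<in> \<Union>(fst q)" for q
      proof -
        have aA: "a \<in> \<Union>?A1" "b \<in> \<Union>?A1" "a \<in> \<Union>?A2" "b \<in> \<Union>?A2" unfolding U1 U2 by auto
        consider "q = f1" | "q = f2" | "q \<in> \<Phi>" "q \<noteq> f" using q(1) by blast
        then show ?thesis
        proof cases
          case 1
          then have "fst q = ?A1 \<union> P" using f1 by simp
          then have "v \<in> \<Union>?A1 \<or> v \<in> set (a # ps @ [b])" using q(2) UP by blast
          then have vA: "v \<in> \<Union>?A1" using vp aA by fastforce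
          then have "v \<in> \<Union>(fst f)" unfolding fA by blast
          then show ?thesis using 1 f vA y0f by blast
        next
          case 2
          then have "fst q = ?A2 \<union> P" using f2 by simp
          then have "v \<in> \<Union>?A2 \<or> v \<in> set (a # ps @ [b])" using q(2) UP by blast
          then have vA: "v \<in> \<Union>?A2" using vp aA by fastforce
          then have "v \<in> \<Union>(fst f)" unfolding fA by blast
          then show ?thesis using 2 f vA y0f by blast
        next
          case 3
          then show ?thesis using q(2) by (intro bexI[of _ q]) (auto simp: y0_def)
        qed
      qed
      show ?thesis using tr[OF gh(1,3)] tr[OF gh(2,4)] lk by metis
    qed
  qed
qed

section \<open>Theta curves in the plane\<close>

section \<open>Plane drawings\<close>

definition region :: "bool \<Rightarrow> complex set \<Rightarrow> complex set" where
  "region s S = (if s then inside S else outside S)"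

lemma connected_in_region:
  assumes "connected T" "T \<inter> S = {}" "x \<in> T" "x \<in> region s S"
  shows "T \<subseteq> region s S"
proof
  fix y assume "y \<in> T"
  then have c: "connected_component (- S) x y"
    unfolding connected_component_def using assms by (intro exI[of _ T]) auto
  show "y \<in> region s S"
    using assms(4) inside_same_component[OF c] outside_same_component[OF c] by (auto simp: region_def)
qed

lemma region_disjoint: "region s S \<inter> S = {}"
  using inside_no_overlap[of S] outside_no_overlap[of S] by (auto simp: region_def)

lemma region_opposite: "region True S \<inter> region False S = {}"
  using inside_Int_outside[of S] by (simp add: region_def)

lemma two_arcs_loop:
  assumes "arc c1" "pathstart c1 = a" "pathfinish c1 = b" "arc c2" "pathstart c2 = a" "pathfinish c2 = b"
    "path_image c1 \<inter> path_image c2 = {a, b}"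
  shows "simple_path (c1 +++ reversepath c2)" "pathfinish (c1 +++ reversepath c2) = pathstart (c1 +++ reversepath c2)"
    "path_image (c1 +++ reversepath c2) = path_image c1 \<union> path_image c2"
  using assms by (auto simp: simple_path_join_loop_eq arc_reversepath path_image_join)

text \<open>The inside of the first loop is connected and misses
  \<open>path_image c2 \<union> K3\<close>. Were it inside that set, its closure, which contains
  \<open>c1\<close>, would be inside or on the set, contrary to \<open>out\<close>.\<close>

lemma inside_avoids:
  fixes c1 c2 :: "real \<Rightarrow> complex"
  assumes c1: "arc c1" "pathstart c1 = a" "pathfinish c1 = b" and c2: "arc c2" "pathstart c2 = a" "pathfinish c2 = b"
    and K12: "path_image c1 \<inter> path_image c2 = {a, b}"
    and K3: "closed K3" "K3 \<inter> inside (path_image c1 \<union> path_image c2) = {}"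
    and out: "path_image c1 - {a, b} \<subseteq> outside (path_image c2 \<union> K3)"
  shows "inside (path_image c1 \<union> path_image c2) \<subseteq> outside (path_image c2 \<union> K3)"
proof
  let ?W = "inside (path_image c1 \<union> path_image c2)" and ?S = "path_image c2 \<union> K3"
  note loop = two_arcs_loop[OF c1 c2 K12]
  have J: "connected ?W" "frontier ?W = path_image c1 \<union> path_image c2"
    using Jordan_inside_outside[OF loop(1,2)] unfolding loop(3) by auto
  fix w assume w: "w \<in> ?W"
  have dis: "?W \<inter> ?S = {}" using K3(2) inside_no_overlap[of "path_image c1 \<union> path_image c2"] by blast
  show "w \<in> outside ?S"
  proof (rule ccontr)
    assume "w \<notin> outside ?S"
    then have "w \<in> inside ?S" using w dis inside_Un_outside[of ?S] by blast
    then have "?W \<subseteq> inside ?S"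
      using connected_in_region[OF J(1) dis w, of True] by (simp add: region_def)
    then have cl: "closure ?W \<subseteq> closure (inside ?S)" by (rule closure_mono)
    obtain x where x: "x \<in> path_image c1" "x \<notin> {a, b}"
      using nonempty_simple_path_endless[OF arc_imp_simple_path[OF c1(1)]] c1 by auto
    have "x \<in> frontier ?W" using J(2) x by blast
    then have "x \<in> closure (inside ?S)" using cl by (auto simp: frontier_def)
    moreover have "closed ?S" using c2(1) K3(1) by (simp add: closed_arc_image closed_Un)
    ultimately have "x \<in> ?S \<union> inside ?S" using closure_inside_subset by blast
    then have "x \<notin> outside ?S"
      using inside_Int_outside[of ?S] outside_no_overlap[of ?S] by blast
    then show False using out x by blast
  qed
qed

text \<open>A point \<open>w\<close> inside the loop of \<open>c1\<close> and \<open>c2\<close> is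
  outside both loops formed with \<open>c3\<close>. So \<open>c1\<close> and \<open>c2\<close> have
  the same winding number about \<open>w\<close> as \<open>c3\<close>, and their loop has winding
  number 0, although it must be 1 or -1.\<close>

lemma theta_winding:
  fixes c1 c2 c3 :: "real \<Rightarrow> complex"
  assumes c1: "arc c1" "pathstart c1 = a" "pathfinish c1 = b"
    and c2: "arc c2" "pathstart c2 = a" "pathfinish c2 = b"
    and c3: "arc c3" "pathstart c3 = a" "pathfinish c3 = b"
    and K12: "path_image c1 \<inter> path_image c2 = {a, b}"
    and o1: "path_image c1 - {a, b} \<subseteq> outside (path_image c2 \<union> path_image c3)"
    and o2: "path_image c2 - {a, b} \<subseteq> outside (path_image c1 \<union> path_image c3)"
    and o3: "path_image c3 \<inter> inside (path_image c1 \<union> path_image c2) = {}"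
  shows False
proof -
  note loop = two_arcs_loop[OF c1 c2 K12]
  have paths: "path c1" "path c2" "path c3" using c1 c2 c3 by (auto simp: arc_imp_path)
  obtain w where w: "w \<in> inside (path_image c1 \<union> path_image c2)"
    using Jordan_inside_outside[OF loop(1,2)] unfolding loop(3) by auto
  have cl: "closed (path_image c3)" using c3(1) by (rule closed_arc_image)
  have w23: "w \<in> outside (path_image c2 \<union> path_image c3)"
    using inside_avoids[OF c1 c2 K12 cl o3 o1] w by blast
  have w13: "w \<in> outside (path_image c1 \<union> path_image c3)"
    using inside_avoids[OF c2 c1 _ cl _ o2] K12 o3 w by (auto simp: Int_commute Un_commute)
  have nw: "w \<notin> path_image c1" "w \<notin> path_image c2" "w \<notin> path_image c3"
    using w13 w23 outside_no_overlap by blast+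
  have z: "winding_number (d +++ reversepath c3) w = 0"
    if "path d" "pathstart d = a" "pathfinish d = b" "w \<in> outside (path_image d \<union> path_image c3)" for d
    by (rule winding_number_zero_in_outside) (use that paths c3 in \<open>auto simp: path_image_join\<close>)
  have j: "winding_number (d +++ reversepath d') w = winding_number d w - winding_number d' w"
    if "path d" "path d'" "pathfinish d = pathfinish d'" "w \<notin> path_image d" "w \<notin> path_image d'" for d d'
    using that by (simp add: winding_number_join winding_number_reversepath)
  have "winding_number c1 w = winding_number c3 w" "winding_number c2 w = winding_number c3 w"
    using z[of c1] z[of c2] j[of c1 c3] j[of c2 c3] paths c1 c2 c3 w13 w23 nw by auto
  then have "winding_number (c1 +++ reversepath c2) w = 0"
    using j[of c1 c2] paths c1 c2 nw by simp
  moreover have "norm (winding_number (c1 +++ reversepath c2) w) = 1"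
    by (rule simple_closed_path_norm_winding_number_inside[OF loop(1)]) (use w loop(3) in simp)
  ultimately show False by simp
qed

text \<open>The set algebra for the outer region. \<open>D1\<close>, \<open>D2\<close>,
  \<open>K3\<close> are three arcs with ends \<open>a\<close>, \<open>b\<close>; \<open>A\<close>,
  \<open>B\<close>, \<open>C\<close> are the insides of \<open>K3 \<union> D1\<close>,
  \<open>D2 \<union> D1\<close>, \<open>D2 \<union> K3\<close>; \<open>Q\<close> and
  \<open>R\<close> are the outsides of \<open>D2 \<union> K3\<close> and
  \<open>D1 \<union> D2\<close>.\<close>

lemma theta_sets:
  assumes "B \<inter> A = {}" "B \<union> A \<union> (D1 - {a, b}) = C" "A \<inter> (K3 \<union> D1) = {}"
    "C \<union> Q = - (D2 \<union> K3)" "C \<inter> Q = {}" "B \<union> R = - (D1 \<union> D2)" "B \<inter> R = {}"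
    "{a, b} \<subseteq> D1" "{a, b} \<subseteq> K3" "K3 - {a, b} \<subseteq> R"
  shows "A \<inter> Q = {}" "R = A \<union> Q \<union> (K3 - {a, b})"
proof -
  show "A \<inter> Q = {}" using assms by blast
  have "x \<in> A \<union> Q \<union> (K3 - {a, b})" if "x \<in> R" for x
  proof -
    have "x \<notin> B" "x \<notin> D1" "x \<notin> D2" using that assms(6,7) by blast+
    moreover have "x \<in> K3 \<or> x \<in> C \<or> x \<in> Q" using calculation(3) assms(4) by blast
    ultimately show ?thesis using assms(2,8) by blast
  qed
  moreover have "x \<in> R" if "x \<in> A" for x
  proof -
    have "x \<in> C" using that assms(2) by blast
    then have "x \<notin> D2" "x \<notin> D1" "x \<notin> B" using that assms(1,3,4) by blast+
    then show ?thesis using assms(6) by blast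
  qed
  moreover have "x \<in> R" if "x \<in> Q" for x
  proof -
    have "x \<notin> C" "x \<notin> D2" "x \<notin> K3" using that assms(4,5) by blast+
    then have "x \<notin> B" "x \<notin> D1" using assms(2,9) by blast+
    then show ?thesis using assms(6) \<open>x \<notin> D2\<close> by blast
  qed
  ultimately show "R = A \<union> Q \<union> (K3 - {a, b})" using assms(10) by blast
qed

text \<open>For the inside this is the splitting of a Jordan interior by a cross-cut. For the
  outside, \<open>theta_winding\<close> shows that \<open>c1\<close> or \<open>c2\<close> enters the
  inside of the loop of the other two arcs; that inside is split along it, and complements give the
  claim. The labels \<open>s1\<close>, \<open>s2\<close> record which side of each new curve is
  meant.\<close>

lemma theta_regions:
  fixes c1 c2 c3 :: "real \<Rightarrow> complex"
  assumes c1: "arc c1" "pathstart c1 = a" "pathfinish c1 = b"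
    and c2: "arc c2" "pathstart c2 = a" "pathfinish c2 = b"
    and c3: "arc c3" "pathstart c3 = a" "pathfinish c3 = b"
    and K12: "path_image c1 \<inter> path_image c2 = {a, b}"
    and K13: "path_image c1 \<inter> path_image c3 = {a, b}"
    and K23: "path_image c2 \<inter> path_image c3 = {a, b}"
    and r: "path_image c3 - {a, b} \<subseteq> region s (path_image c1 \<union> path_image c2)"
  shows "\<exists>s1 s2. region s1 (path_image c1 \<union> path_image c3) \<inter> region s2 (path_image c2 \<union> path_image c3) = {} \<and>
    region s (path_image c1 \<union> path_image c2) =
      region s1 (path_image c1 \<union> path_image c3) \<union> region s2 (path_image c2 \<union> path_image c3) \<union> (path_image c3 - {a, b})"
proof -
  let ?K1 = "path_image c1" and ?K2 = "path_image c2" and ?K3 = "path_image c3"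
  have ab: "a \<noteq> b" using arc_distinct_ends[OF c1(1)] c1 by simp
  note sp = arc_imp_simple_path[OF c1(1)] arc_imp_simple_path[OF c2(1)] arc_imp_simple_path[OF c3(1)]
  have ne: "\<exists>x\<in>?K1. x \<notin> {a, b}" "\<exists>x\<in>?K2. x \<notin> {a, b}" "\<exists>x\<in>?K3. x \<notin> {a, b}"
    using nonempty_simple_path_endless[OF sp(1)] nonempty_simple_path_endless[OF sp(2)]
      nonempty_simple_path_endless[OF sp(3)] c1 c2 c3 by auto
  have split: "inside (path_image d1 \<union> path_image d) \<inter> inside (path_image d2 \<union> path_image d) = {} \<and>
      inside (path_image d1 \<union> path_image d) \<union> inside (path_image d2 \<union> path_image d) \<union> (path_image d - {a, b}) =
        inside (path_image d1 \<union> path_image d2)"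
    if "simple_path d1" "pathstart d1 = a" "pathfinish d1 = b" "simple_path d2" "pathstart d2 = a" "pathfinish d2 = b"
      "simple_path d" "pathstart d = a" "pathfinish d = b" "path_image d1 \<inter> path_image d2 = {a, b}"
      "path_image d1 \<inter> path_image d = {a, b}" "path_image d2 \<inter> path_image d = {a, b}"
      "path_image d \<inter> inside (path_image d1 \<union> path_image d2) \<noteq> {}" for d1 d2 d :: "real \<Rightarrow> complex"
    using split_inside_simple_closed_curve[OF that(1-9) ab that(10-13)] by metis
  show ?thesis
  proof (cases s)
    case True
    have "?K3 \<inter> inside (?K1 \<union> ?K2) \<noteq> {}" using r ne(3) True by (auto simp: region_def)
    then show ?thesis
      using split[OF sp(1) c1(2,3) sp(2) c2(2,3) sp(3) c3(2,3) K12 K13 K23] True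
      by (intro exI[of _ True]) (simp add: region_def)
  next
    case False
    have r': "?K3 - {a, b} \<subseteq> outside (?K1 \<union> ?K2)" using r False by (simp add: region_def)
    have out: "?K3 \<inter> inside (?K1 \<union> ?K2) = {}"
    proof -
      have "a \<in> ?K1" "b \<in> ?K1" using K12 by auto
      then show ?thesis using r' inside_no_overlap[of "?K1 \<union> ?K2"] inside_Int_outside[of "?K1 \<union> ?K2"] by blast
    qed
    have one: "\<exists>s1 s2. region s1 (path_image d1 \<union> ?K3) \<inter> region s2 (path_image d2 \<union> ?K3) = {} \<and>
        outside (path_image d1 \<union> path_image d2) =
          region s1 (path_image d1 \<union> ?K3) \<union> region s2 (path_image d2 \<union> ?K3) \<union> (?K3 - {a, b})"
      if d: "simple_path d1" "pathstart d1 = a" "pathfinish d1 = b" "simple_path d2" "pathstart d2 = a" "pathfinish d2 = b"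
        and K: "path_image d1 \<inter> path_image d2 = {a, b}" "path_image d1 \<inter> ?K3 = {a, b}" "path_image d2 \<inter> ?K3 = {a, b}"
        and m: "path_image d1 \<inter> inside (path_image d2 \<union> ?K3) \<noteq> {}"
        and o: "?K3 - {a, b} \<subseteq> outside (path_image d1 \<union> path_image d2)" for d1 d2
    proof -
      let ?D1 = "path_image d1" and ?D2 = "path_image d2"
      have S: "inside (?D2 \<union> ?D1) \<inter> inside (?K3 \<union> ?D1) = {}"
        "inside (?D2 \<union> ?D1) \<union> inside (?K3 \<union> ?D1) \<union> (?D1 - {a, b}) = inside (?D2 \<union> ?K3)"
        using split[OF d(4-6) sp(3) c3(2,3) d(1-3) K(3)] K(1,2) m unfolding Int_commute[of ?D2 ?D1] Int_commute[of ?K3 ?D1]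
        by blast+
      have nn: "inside T \<inter> T = {}" "inside T \<union> outside T = - T" "inside T \<inter> outside T = {}" for T :: "complex set"
        using inside_Int_outside[of T] inside_no_overlap[of T] inside_Un_outside[of T] by auto
      have e: "{a, b} \<subseteq> ?D1" "{a, b} \<subseteq> ?K3" using K by blast+
      have c: "inside (?D2 \<union> ?D1) \<union> outside (?D1 \<union> ?D2) = - (?D1 \<union> ?D2)" "inside (?D2 \<union> ?D1) \<inter> outside (?D1 \<union> ?D2) = {}"
        unfolding Un_commute[of ?D2 ?D1] by (rule nn)+
      note T = theta_sets[OF S nn(1) nn(2,3) c e o]
      have "inside (?D1 \<union> ?K3) \<inter> outside (?D2 \<union> ?K3) = {}" using T(1) unfolding Un_commute[of ?K3 ?D1] .
      moreover have "outside (?D1 \<union> ?D2) = inside (?D1 \<union> ?K3) \<union> outside (?D2 \<union> ?K3) \<union> (?K3 - {a, b})"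
        using T(2) unfolding Un_commute[of ?K3 ?D1] .
      ultimately show ?thesis by (intro exI[of _ True] exI[of _ False]) (simp add: region_def)
    qed
    have cases: "?K1 \<inter> inside (?K2 \<union> ?K3) \<noteq> {} \<or> ?K2 \<inter> inside (?K1 \<union> ?K3) \<noteq> {}"
    proof (rule ccontr)
      assume "\<not> ?thesis"
      then have n: "?K1 \<inter> inside (?K2 \<union> ?K3) = {}" "?K2 \<inter> inside (?K1 \<union> ?K3) = {}" by blast+
      have out_of: "L - {a, b} \<subseteq> outside (M \<union> ?K3)" if "L \<inter> M = {a, b}" "L \<inter> ?K3 = {a, b}" "L \<inter> inside (M \<union> ?K3) = {}" for L M
      proof
        fix x assume x: "x \<in> L - {a, b}"
        then have "x \<in> - (M \<union> ?K3)" using that(1,2) by auto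
        then have "x \<in> inside (M \<union> ?K3) \<union> outside (M \<union> ?K3)" by (simp only: inside_Un_outside)
        moreover have "x \<notin> inside (M \<union> ?K3)" using that(3) x by blast
        ultimately show "x \<in> outside (M \<union> ?K3)" by blast
      qed
      have o1: "?K1 - {a, b} \<subseteq> outside (?K2 \<union> ?K3)" by (rule out_of[OF K12 K13 n(1)])
      have o2: "?K2 - {a, b} \<subseteq> outside (?K1 \<union> ?K3)"
        by (rule out_of[OF _ K23 n(2)]) (use K12 in \<open>simp add: Int_commute\<close>)
      show False by (rule theta_winding[OF c1 c2 c3 K12 o1 o2 out])
    qed
    have ro: "region s S = outside S" for S using False by (simp add: region_def)
    from cases show ?thesis
    proof
      assume m: "?K1 \<inter> inside (?K2 \<union> ?K3) \<noteq> {}"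
      show ?thesis unfolding ro by (rule one[OF sp(1) c1(2,3) sp(2) c2(2,3) K12 K13 K23 m r'])
    next
      assume m: "?K2 \<inter> inside (?K1 \<union> ?K3) \<noteq> {}"
      have "?K2 \<inter> ?K1 = {a, b}" "?K3 - {a, b} \<subseteq> outside (?K2 \<union> ?K1)"
        using K12 r' by (simp_all only: Un_commute[of ?K2 ?K1] Int_commute[of ?K2 ?K1])
      from one[OF sp(2) c2(2,3) sp(1) c1(2,3) this(1) K23 K13 m this(2)] obtain s1 s2 where
        A: "region s1 (?K2 \<union> ?K3) \<inter> region s2 (?K1 \<union> ?K3) = {}" and
        B: "outside (?K2 \<union> ?K1) = region s1 (?K2 \<union> ?K3) \<union> region s2 (?K1 \<union> ?K3) \<union> (?K3 - {a, b})" by metis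
      have "region s2 (?K1 \<union> ?K3) \<inter> region s1 (?K2 \<union> ?K3) = {}" using A by (simp only: Int_commute)
      moreover have "outside (?K1 \<union> ?K2) = region s2 (?K1 \<union> ?K3) \<union> region s1 (?K2 \<union> ?K3) \<union> (?K3 - {a, b})"
        using B by (simp only: Un_commute[of ?K1 ?K2] Un_commute[of "region s2 (?K1 \<union> ?K3)"])
      ultimately show ?thesis unfolding ro by blast
    qed
  qed
qed

section \<open>Drawings, their face regions and the insertion of ears\<close>

locale drawing =
  fixes p :: "'a \<Rightarrow> complex" and c :: "'a set \<Rightarrow> real \<Rightarrow> complex" and E :: "'a set set"
  assumes inj: "inj_on p (\<Union>E)"
    and edge_arc0: "{u, v} \<in> E \<Longrightarrow> arc (c {u, v}) \<and> {pathstart (c {u, v}), pathfinish (c {u, v})} = {p u, p v}"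
    and vertex: "e \<in> E \<Longrightarrow> w \<in> \<Union>E \<Longrightarrow> p w \<in> path_image (c e) \<Longrightarrow> w \<in> e"
    and cross: "e \<in> E \<Longrightarrow> e' \<in> E \<Longrightarrow> e \<noteq> e' \<Longrightarrow> path_image (c e) \<inter> path_image (c e') \<subseteq> p ` (e \<inter> e')"
begin

definition picture :: "'a set set \<Rightarrow> complex set" where
  "picture A = (\<Union>e\<in>A. path_image (c e))"

lemma picture_Un: "picture (A \<union> B) = picture A \<union> picture B"
  by (auto simp: picture_def)

lemma picture_inter:
  assumes "A \<subseteq> E" "B \<subseteq> E" "A \<inter> B = {}"
  shows "picture A \<inter> picture B \<subseteq> p ` (\<Union>A \<inter> \<Union>B)"
proof
  fix x assume "x \<in> picture A \<inter> picture B"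
  then obtain e e' where e: "e \<in> A" "e' \<in> B" "x \<in> path_image (c e)" "x \<in> path_image (c e')" by (auto simp: picture_def)
  then have "e \<noteq> e'" using assms(3) by blast
  then have "x \<in> p ` (e \<inter> e')" using cross[of e e'] e assms by blast
  then show "x \<in> p ` (\<Union>A \<inter> \<Union>B)" using e by blast
qed

lemma edge_arc:
  assumes "{u, v} \<in> E"
  shows "\<exists>g. arc g \<and> pathstart g = p u \<and> pathfinish g = p v \<and> path_image g = path_image (c {u, v})"
proof -
  have a: "arc (c {u, v})" "{pathstart (c {u, v}), pathfinish (c {u, v})} = {p u, p v}"
    using edge_arc0[OF assms] by auto
  from a(2) consider "pathstart (c {u, v}) = p u" "pathfinish (c {u, v}) = p v"
    | "pathstart (c {u, v}) = p v" "pathfinish (c {u, v}) = p u" by (auto simp: doubleton_eq_iff)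
  then show ?thesis
  proof cases
    case 1
    then show ?thesis using a(1) by blast
  next
    case 2
    then show ?thesis using a(1) by (intro exI[of _ "reversepath (c {u, v})"]) (simp add: arc_reversepath)
  qed
qed

lemma picture_vertex:
  assumes "A \<subseteq> E" "v \<in> \<Union>E" "\<And>e. e \<in> A \<Longrightarrow> card e = 2"
  shows "p v \<in> picture A \<longleftrightarrow> v \<in> \<Union>A"
proof
  assume "p v \<in> picture A"
  then show "v \<in> \<Union>A" using vertex assms unfolding picture_def by blast
next
  assume "v \<in> \<Union>A"
  then obtain e where e: "e \<in> A" "v \<in> e" by blast
  then obtain u where "e = {v, u}" using assms(3)[OF e(1)] by (auto simp: card_2_iff)
  then obtain g where "pathstart g = p v" "path_image g = path_image (c e)" using edge_arc[of v u] e assms(1) by blast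
  then show "p v \<in> picture A" using e pathstart_in_path_image[of g] by (auto simp: picture_def)
qed

lemma path_arc:
  assumes "distinct xs" "length xs \<ge> 2" "path_edges xs \<subseteq> E"
  shows "\<exists>g. arc g \<and> pathstart g = p (hd xs) \<and> pathfinish g = p (last xs) \<and> path_image g = picture (path_edges xs)"
  using assms
proof (induction xs rule: path_edges.induct)
  case (1 x y zs)
  have xy: "{x, y} \<in> E" using 1(4) by simp
  obtain g where g: "arc g" "pathstart g = p x" "pathfinish g = p y" "path_image g = path_image (c {x, y})"
    using edge_arc[OF xy] by blast
  show ?case
  proof (cases zs)
    case Nil
    then show ?thesis using g by (intro exI[of _ g]) (simp add: picture_def)
  next
    case (Cons z zs')
    then obtain g' where g': "arc g'" "pathstart g' = p y" "pathfinish g' = p (last (y # zs))"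
      "path_image g' = picture (path_edges (y # zs))"
      using 1 by auto
    have "{x, y} \<notin> path_edges (y # zs)" using path_edges_subset[of "{x, y}" "y # zs"] 1(2) by auto
    then have "picture {{x, y}} \<inter> picture (path_edges (y # zs)) \<subseteq> p ` (\<Union>{{x, y}} \<inter> \<Union>(path_edges (y # zs)))"
      using 1(4) by (intro picture_inter) auto
    also have "\<dots> \<subseteq> {p y}" using path_edges_subset[of _ "y # zs"] 1(2) by auto
    finally have "path_image g \<inter> path_image g' \<subseteq> {pathstart g'}" using g g' by (simp add: picture_def)
    then have "arc (g +++ g')" using g g' by (intro arc_join) auto
    moreover have "path_image (g +++ g') = picture (path_edges (x # y # zs))"
      using g g' by (simp add: path_image_join picture_def)
    ultimately show ?thesis using g g' by (intro exI[of _ "g +++ g'"]) auto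
  qed
qed auto

lemma cycle_curve:
  assumes "distinct xs" "length xs \<ge> 3" "cycle_edges xs \<subseteq> E"
  shows "\<exists>g. simple_path g \<and> pathfinish g = pathstart g \<and> path_image g = picture (cycle_edges xs)"
proof -
  note ce = cycle_edges_last[OF assms(1,2)]
  have "path_edges xs \<subseteq> E" and e: "{last xs, hd xs} \<in> E" using ce assms(3) by auto
  then obtain g where g: "arc g" "pathstart g = p (hd xs)" "pathfinish g = p (last xs)" "path_image g = picture (path_edges xs)"
    using path_arc[of xs] assms by auto
  obtain g' where g': "arc g'" "pathstart g' = p (last xs)" "pathfinish g' = p (hd xs)"
    "path_image g' = path_image (c {last xs, hd xs})" using edge_arc[OF e] by blast
  have "picture (path_edges xs) \<inter> picture {{last xs, hd xs}} \<subseteq> p ` (\<Union>(path_edges xs) \<inter> \<Union>{{last xs, hd xs}})"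
    by (rule picture_inter) (use ce assms(3) in auto)
  then have "path_image g \<inter> path_image g' \<subseteq> {pathstart g, pathstart g'}"
    using g g' by (auto simp: picture_def)
  then have "simple_path (g +++ g')" using g g' by (subst simple_path_join_loop_eq) auto
  moreover have "path_image (g +++ g') = picture (cycle_edges xs)"
    using g g' by (auto simp: path_image_join picture_def ce(1))
  ultimately show ?thesis using g g' by (intro exI[of _ "g +++ g'"]) simp
qed

text \<open>The label of a face tells on which side of its bounding cycle it lies.\<close>

abbreviation face_region :: "'a set set \<times> bool \<Rightarrow> complex set" where
  "face_region f \<equiv> region (snd f) (picture (fst f))"

definition plane :: "'a set set \<Rightarrow> ('a set set \<times> bool) set \<Rightarrow> bool" where
  "plane F \<Phi> \<longleftrightarrow> F \<subseteq> E \<and> (\<forall>f\<in>\<Phi>. face_region f \<inter> picture F = {}) \<and>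
     (\<forall>f\<in>\<Phi>. \<forall>g\<in>\<Phi>. f \<noteq> g \<longrightarrow> face_region f \<inter> face_region g = {}) \<and> - picture F \<subseteq> (\<Union>f\<in>\<Phi>. face_region f)"

lemma plane_cycle: "C \<subseteq> E \<Longrightarrow> plane C {(C, True), (C, False)}"
proof -
  assume C: "C \<subseteq> E"
  have "- picture C \<subseteq> region True (picture C) \<union> region False (picture C)"
    using inside_Un_outside[of "picture C"] by (auto simp: region_def)
  then show ?thesis
    using C region_disjoint[of _ "picture C"] region_opposite[of "picture C"] unfolding plane_def by auto
qed

text \<open>The open ear is connected and misses the picture, so it lies in one region. The face
  \<open>f\<close> is provided before its cycle is written as a list from \<open>a\<close> through
  \<open>b\<close>, because such a list exists only once both ends are known to lie on it.\<close>

lemma plane_ear: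
  assumes pl: "plane F \<Phi>" and cyc: "\<And>f. f \<in> \<Phi> \<Longrightarrow> \<exists>xs. distinct xs \<and> length xs \<ge> 3 \<and> fst f = cycle_edges xs \<and> fst f \<subseteq> F"
    and F2: "\<And>e. e \<in> F \<Longrightarrow> card e = 2"
    and d: "distinct (a # ps @ [b])" and P: "P = path_edges (a # ps @ [b])" "P \<subseteq> E" "P \<inter> F = {}"
    and ab: "a \<in> \<Union>F" "b \<in> \<Union>F" and ps: "set ps \<inter> \<Union>F = {}"
  obtains f where "f \<in> \<Phi>" "a \<in> \<Union>(fst f)" "b \<in> \<Union>(fst f)"
    "\<And>ys ws. distinct (a # ys @ b # ws) \<Longrightarrow> fst f = cycle_edges (a # ys @ b # ws) \<Longrightarrow>
      \<exists>s1 s2. plane (F \<union> P) (insert (path_edges (a # ys @ [b]) \<union> P, s1)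
        (insert (path_edges (b # ws @ [a]) \<union> P, s2) (\<Phi> - {f})))"
proof -
  have FE: "F \<subseteq> E" using pl by (simp add: plane_def)
  have reg_F: "face_region g \<inter> picture F = {}" if "g \<in> \<Phi>" for g using pl that unfolding plane_def by blast
  have reg_cover: "- picture F \<subseteq> (\<Union>g\<in>\<Phi>. face_region g)" using pl unfolding plane_def by blast
  obtain c3 where c3: "arc c3" "pathstart c3 = p a" "pathfinish c3 = p b" "path_image c3 = picture P"
    using path_arc[OF d] P by auto
  define K where "K = picture P - {p a, p b}"
  have UP: "\<Union>P = set (a # ps @ [b])" unfolding P(1) by (rule Union_path_edges) simp
  have PF: "picture P \<inter> picture F \<subseteq> {p a, p b}"
    using picture_inter[OF P(2) FE P(3)] ps UP by auto
  then have KF: "K \<inter> picture F = {}" by (auto simp: K_def)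
  have Kc: "connected K" using connected_simple_path_endless[OF arc_imp_simple_path[OF c3(1)]] c3 by (simp add: K_def)
  obtain x where x: "x \<in> K"
    using nonempty_simple_path_endless[OF arc_imp_simple_path[OF c3(1)]] c3 by (auto simp: K_def)
  then obtain f where f: "f \<in> \<Phi>" "x \<in> face_region f" using reg_cover KF by blast
  obtain xs where xs: "distinct xs" "length xs \<ge> 3" "fst f = cycle_edges xs" "fst f \<subseteq> F" using cyc[OF f(1)] by blast
  have "picture (fst f) \<subseteq> picture F" using xs(4) by (auto simp: picture_def)
  then have Kf: "K \<subseteq> face_region f" using connected_in_region[OF Kc _ x f(2)] KF by blast
  have fr: "frontier (face_region f) = picture (fst f)"
  proof -
    obtain g where "simple_path g" "pathfinish g = pathstart g" "path_image g = picture (fst f)"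
      using cycle_curve[OF xs(1,2)] xs(3,4) FE by auto
    then show ?thesis using Jordan_inside_outside[of g] by (auto simp: region_def)
  qed
  \<comment> \<open>An end of the ear is a limit of its open part, so it is in the closure of the
    region but not in the region, hence on the frontier, which is the bounding cycle.\<close>
  have end_in: "v \<in> \<Union>(fst f)" if v: "v \<in> {a, b}" for v
  proof -
    have vF: "v \<in> \<Union>F" using v ab by blast
    have vK: "p v \<in> path_image c3" using v c3 pathstart_in_path_image[of c3] pathfinish_in_path_image[of c3] by auto
    have "path_image c3 \<noteq> {y}" for y
    proof
      assume "path_image c3 = {y}"
      moreover have "x \<in> path_image c3" "x \<noteq> p v" using x v c3(4) by (auto simp: K_def)
      ultimately show False using vK by simp
    qed
    then have "p v islimpt path_image c3"
      using connected_imp_perfect[OF connected_arc_image[OF c3(1)] vK] by blast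
    moreover have "path_image c3 \<subseteq> {p a, p b} \<union> K" using c3(4) by (auto simp: K_def)
    ultimately have "p v islimpt K" using islimpt_subset[of "p v" "path_image c3" "{p a, p b} \<union> K"] islimpt_Un_finite[of "{p a, p b}" "p v" K] by simp
    then have "p v \<in> closure K" by (simp add: closure_def)
    then have "p v \<in> closure (face_region f)" using closure_mono[OF Kf] by blast
    moreover have "p v \<in> picture F" using picture_vertex[OF FE _ F2] vF FE by blast
    then have "p v \<notin> face_region f" using reg_F[OF f(1)] by blast
    ultimately have "p v \<in> picture (fst f)"
      using closure_Un_frontier[of "face_region f"] unfolding fr by blast
    then show ?thesis using picture_vertex[of "fst f" v] xs(4) FE F2 vF by blast
  qed
  show thesis
  proof (rule that[OF f(1)])
    show "a \<in> \<Union>(fst f)" "b \<in> \<Union>(fst f)" using end_in by auto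
    fix ys ws assume dyw: "distinct (a # ys @ b # ws)" and fe: "fst f = cycle_edges (a # ys @ b # ws)"
    let ?A1 = "path_edges (a # ys @ [b])" and ?A2 = "path_edges (b # ws @ [a])"
    have fA: "fst f = ?A1 \<union> ?A2"
      unfolding fe cycle_edges_def using path_edges_append[of "a # ys" b "ws @ [a]"] by simp
    have A12E: "?A1 \<subseteq> E" "?A2 \<subseteq> E" "?A1 \<subseteq> F" "?A2 \<subseteq> F" using fA xs(4) FE by auto
    have U1: "\<Union>?A1 = set (a # ys @ [b])" and U2: "\<Union>?A2 = set (b # ws @ [a])" by (rule Union_path_edges, simp)+
    have "set xs = set (a # ys @ b # ws)"
      using Union_cycle_edges[of xs] Union_cycle_edges[of "a # ys @ b # ws"] xs(2) xs(3) fe by simp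
    then have len: "length (a # ys @ b # ws) \<ge> 3" using xs(1,2) dyw by (metis distinct_card)
    have A12: "?A1 \<inter> ?A2 = {}"
    proof (rule ccontr)
      assume "?A1 \<inter> ?A2 \<noteq> {}"
      then obtain e where e: "e \<in> ?A1" "e \<in> ?A2" by blast
      have d12: "distinct (a # ys @ [b])" "distinct (b # ws @ [a])" using dyw by auto
      have "chain ((a # ys @ b # ws) @ [hd (a # ys @ b # ws)]) e = chain (a # ys @ [b]) e + chain (b # ws @ [a]) e"
        using chain_append[of "a # ys" b "ws @ [a]" e] by simp
      also have "\<dots> = 0" using chain_distinct[OF d12(1)] chain_distinct[OF d12(2)] e by simp
      finally show False using chain_cycle[OF dyw len, of e] e fe fA by auto
    qed
    have P_sub: "picture ?A1 \<subseteq> picture F" "picture ?A2 \<subseteq> picture F" using A12E by (auto simp: picture_def)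
    have abF: "p a \<in> picture F" "p b \<in> picture F" using picture_vertex[OF FE _ F2] ab FE by blast+
    have d12: "distinct (a # ys @ [b])" "distinct (a # rev ws @ [b])" using dyw by auto
    have rev_A2: "path_edges (a # rev ws @ [b]) = ?A2" using path_edges_rev[of "b # ws @ [a]"] by simp
    obtain c1 where c1: "arc c1" "pathstart c1 = p a" "pathfinish c1 = p b" "path_image c1 = picture ?A1"
      using path_arc[OF d12(1)] A12E by auto
    obtain c2 where c2: "arc c2" "pathstart c2 = p a" "pathfinish c2 = p b" "path_image c2 = picture ?A2"
      using path_arc[OF d12(2)] A12E rev_A2 by auto
    have ends: "{p a, p b} \<subseteq> path_image g" if "pathstart g = p a" "pathfinish g = p b" for g :: "real \<Rightarrow> complex"
      using that pathstart_in_path_image[of g] pathfinish_in_path_image[of g] by auto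
    have "\<Union>?A1 \<inter> \<Union>?A2 \<subseteq> {a, b}" unfolding U1 U2 using dyw by auto
    then have "p ` (\<Union>?A1 \<inter> \<Union>?A2) \<subseteq> p ` {a, b}" by (rule image_mono)
    then have "picture ?A1 \<inter> picture ?A2 \<subseteq> {p a, p b}" using picture_inter[OF A12E(1,2) A12] by simp
    then have K12: "path_image c1 \<inter> path_image c2 = {p a, p b}" using ends[OF c1(2,3)] ends[OF c2(2,3)] c1(4) c2(4) by auto
    have K13: "path_image c1 \<inter> path_image c3 = {p a, p b}"
    proof (rule equalityI)
      show "path_image c1 \<inter> path_image c3 \<subseteq> {p a, p b}" unfolding c1(4) c3(4) using PF P_sub(1) by fast
      show "{p a, p b} \<subseteq> path_image c1 \<inter> path_image c3"
        using ends[OF c1(2,3)] ends[OF c3(2,3)] by (rule Int_greatest)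
    qed
    have K23: "path_image c2 \<inter> path_image c3 = {p a, p b}"
    proof (rule equalityI)
      show "path_image c2 \<inter> path_image c3 \<subseteq> {p a, p b}" unfolding c2(4) c3(4) using PF P_sub(2) by fast
      show "{p a, p b} \<subseteq> path_image c2 \<inter> path_image c3"
        using ends[OF c2(2,3)] ends[OF c3(2,3)] by (rule Int_greatest)
    qed
    have pf: "picture (fst f) = path_image c1 \<union> path_image c2" unfolding fA picture_Un c1(4) c2(4) ..
    have "path_image c3 - {p a, p b} \<subseteq> region (snd f) (path_image c1 \<union> path_image c2)"
      using Kf unfolding K_def pf c3(4) .
    from theta_regions[OF c1(1-3) c2(1-3) c3(1-3) K12 K13 K23 this] obtain s1 s2 where
      s: "region s1 (path_image c1 \<union> path_image c3) \<inter> region s2 (path_image c2 \<union> path_image c3) = {}"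
      "region (snd f) (path_image c1 \<union> path_image c2) = region s1 (path_image c1 \<union> path_image c3) \<union>
        region s2 (path_image c2 \<union> path_image c3) \<union> (path_image c3 - {p a, p b})" by metis
    define R1 R2 where "R1 = face_region (?A1 \<union> P, s1)" and "R2 = face_region (?A2 \<union> P, s2)"
    have R: "R1 = region s1 (path_image c1 \<union> path_image c3)" "R2 = region s2 (path_image c2 \<union> path_image c3)"
      unfolding R1_def R2_def by (simp_all add: picture_Un c1(4) c2(4) c3(4))
    have fR: "R1 \<inter> R2 = {}" "face_region f = R1 \<union> R2 \<union> K"
      using s(1) s(2)[folded R pf] unfolding R K_def c3(4) by (simp_all only:)
    have RP: "R1 \<inter> picture P = {}" "R2 \<inter> picture P = {}"
      using region_disjoint[of s1 "path_image c1 \<union> path_image c3"] region_disjoint[of s2 "path_image c2 \<union> path_image c3"]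
      unfolding R c3(4) by blast+
    have PK: "picture P \<subseteq> K \<union> picture F" using abF by (auto simp: K_def)
    have fd: "face_region g \<inter> face_region f = {}" if "g \<in> \<Phi> - {f}" for g
      using pl f(1) that unfolding plane_def by blast
    have gP: "face_region g \<inter> picture (F \<union> P) = {}" if "g \<in> \<Phi> - {f}" for g
      using fd[OF that] reg_F[of g] that PK fR(2) unfolding picture_Un by blast
    have RF: "R1 \<inter> picture (F \<union> P) = {}" "R2 \<inter> picture (F \<union> P) = {}"
      using RP reg_F[OF f(1)] fR(2) unfolding picture_Un Int_Un_distrib by auto
    let ?\<Phi> = "insert (?A1 \<union> P, s1) (insert (?A2 \<union> P, s2) (\<Phi> - {f}))"
    have "plane (F \<union> P) ?\<Phi>"
      unfolding plane_def
    proof (intro conjI ballI impI)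
      show "F \<union> P \<subseteq> E" using FE P(2) by blast
      show "face_region g \<inter> picture (F \<union> P) = {}" if "g \<in> ?\<Phi>" for g
        using that RF gP unfolding R1_def R2_def by blast
      show "face_region g \<inter> face_region h = {}" if gh: "g \<in> ?\<Phi>" "h \<in> ?\<Phi>" "g \<noteq> h" for g h
      proof -
        have "R1 \<inter> face_region k = {}" "R2 \<inter> face_region k = {}" if "k \<in> \<Phi> - {f}" for k
          using fd[OF that] fR(2) by blast+
        moreover have "face_region g \<inter> face_region h = {}" if "g \<in> \<Phi>" "h \<in> \<Phi>"
          using pl that gh(3) unfolding plane_def by blast
        ultimately show ?thesis using gh fR(1) unfolding R1_def R2_def by blast
      qed
      show "- picture (F \<union> P) \<subseteq> (\<Union>g\<in>?\<Phi>. face_region g)"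
      proof
        fix x assume x: "x \<in> - picture (F \<union> P)"
        then obtain g where g: "g \<in> \<Phi>" "x \<in> face_region g" using reg_cover unfolding picture_Un by blast
        show "x \<in> (\<Union>g\<in>?\<Phi>. face_region g)"
        proof (cases "g = f")
          case True
          then have "x \<in> R1 \<union> R2" using g(2) fR(2) x unfolding picture_Un K_def by blast
          then show ?thesis unfolding R1_def R2_def by blast
        qed (use g in blast)
      qed
    qed
    then show "\<exists>s1 s2. plane (F \<union> P) (insert (?A1 \<union> P, s1) (insert (?A2 \<union> P, s2) (\<Phi> - {f})))" by blast
  qed
qed

end

section \<open>Ear decompositions of graphs without cut vertices\<close>

section \<open>From planar graphs to combinatorial spheres\<close>

definition edge_set :: "('a \<Rightarrow> 'a \<Rightarrow> bool) \<Rightarrow> 'a set set" where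
  "edge_set E = {{u, v} |u v. E u v}"

text \<open>An empty overlap means a disconnected graph, a single common vertex a cut
  vertex.\<close>

definition separable :: "'a set \<Rightarrow> ('a \<Rightarrow> 'a \<Rightarrow> bool) \<Rightarrow> bool" where
  "separable V E \<longleftrightarrow> (\<exists>V1 V2. V = V1 \<union> V2 \<and> V1 - V2 \<noteq> {} \<and> V2 - V1 \<noteq> {} \<and> card (V1 \<inter> V2) \<le> 1 \<and>
     (\<forall>u\<in>V1 - V2. \<forall>w\<in>V2 - V1. \<not> E u w))"

lemma separableI:
  assumes "V = V1 \<union> V2" "x \<in> V1 - V2" "y \<in> V2 - V1" "card (V1 \<inter> V2) \<le> 1"
    "\<And>u w. u \<in> V1 - V2 \<Longrightarrow> w \<in> V2 - V1 \<Longrightarrow> \<not> E u w"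
  shows "separable V E"
proof -
  have "V1 - V2 \<noteq> {}" "V2 - V1 \<noteq> {}" using assms(2,3) by blast+
  then show ?thesis unfolding separable_def using assms(1,4,5) by metis
qed

lemma rtrancl_distinct_path:
  assumes "(x, y) \<in> R\<^sup>*"
  shows "\<exists>xs. xs \<noteq> [] \<and> distinct xs \<and> hd xs = x \<and> last xs = y \<and> successively (\<lambda>u w. (u, w) \<in> R) xs"
  using assms
proof induction
  case base
  show ?case by (intro exI[of _ "[x]"]) simp
next
  case (step y z)
  then obtain xs where xs: "xs \<noteq> []" "distinct xs" "hd xs = x" "last xs = y" "successively (\<lambda>u w. (u, w) \<in> R) xs" by blast
  show ?case
  proof (cases "z \<in> set xs")
    case True
    then obtain us vs where s: "xs = us @ z # vs" by (meson split_list)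
    have "successively (\<lambda>u w. (u, w) \<in> R) (us @ [z])"
      using xs(5) unfolding s successively_append_iff by auto
    then show ?thesis using xs unfolding s by (intro exI[of _ "us @ [z]"]) (auto simp: hd_append split: if_splits)
  next
    case False
    have "successively (\<lambda>u w. (u, w) \<in> R) (xs @ [z])"
      using xs step(2) unfolding successively_append_iff by auto
    then show ?thesis using xs False by (intro exI[of _ "xs @ [z]"]) auto
  qed
qed

lemma successively_path_edges: "successively E xs \<Longrightarrow> path_edges xs \<subseteq> edge_set E"
  by (induction xs rule: path_edges.induct) (auto simp: edge_set_def)

context
  fixes V :: "'a set" and E :: "'a \<Rightarrow> 'a \<Rightarrow> bool"
  assumes sg: "simple_graph V E" and ns: "\<not> separable V E"
begin

lemma graph_facts: "finite V" "E u v \<Longrightarrow> u \<in> V \<and> v \<in> V" "E u v \<Longrightarrow> E v u" "\<not> E u u"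
  using sg unfolding simple_graph_def by blast+

lemma edge_set_iff: "{u, v} \<in> edge_set E \<longleftrightarrow> E u v"
  using graph_facts(3) by (auto simp: edge_set_def doubleton_eq_iff)

lemma edge_setE:
  assumes "e \<in> edge_set E"
  obtains u v where "e = {u, v}" "E u v" "u \<noteq> v" "u \<in> V" "v \<in> V"
proof -
  obtain u v where "e = {u, v}" "E u v" using assms by (auto simp: edge_set_def)
  moreover have "u \<noteq> v" using calculation(2) graph_facts(4) by blast
  ultimately show thesis using that graph_facts(2) by blast
qed

lemma finite_edge_set: "finite (edge_set E)"
  by (rule finite_subset[of _ "Pow V"]) (use graph_facts in \<open>auto elim!: edge_setE\<close>)

lemma nonseparable_connected:
  assumes "r \<in> V" "v \<in> V"
  shows "(r, v) \<in> {(u, w). {u, w} \<in> edge_set E}\<^sup>*"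
proof (rule ccontr)
  assume no: "(r, v) \<notin> {(u, w). {u, w} \<in> edge_set E}\<^sup>*"
  define Y where "Y = {w \<in> V. (r, w) \<in> {(u, w). {u, w} \<in> edge_set E}\<^sup>*}"
  have "\<not> E u w" if u: "u \<in> Y" and w: "w \<in> V - Y" for u w
  proof
    assume "E u w"
    then have "(u, w) \<in> {(u, w). {u, w} \<in> edge_set E}" by (simp add: edge_set_iff)
    then have "w \<in> Y" using u w unfolding Y_def by (auto intro: rtrancl_into_rtrancl)
    then show False using w by simp
  qed
  moreover have "r \<in> Y" "v \<in> V - Y" "Y \<subseteq> V" using assms no by (auto simp: Y_def)
  moreover have "Y \<inter> (V - Y) = {}" by blast
  ultimately have "separable V E"
    unfolding separable_def by (intro exI[of _ Y] exI[of _ "V - Y"]) (auto simp: Diff_Diff_Int)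
  then show False using ns by blast
qed

text \<open>Let \<open>Y\<close> be the component of \<open>y\<close> after removal of
  \<open>W\<close>. If it had at most one neighbour in \<open>W\<close>, then \<open>Y\<close> and
  that neighbour could be split off. Two neighbours are joined by a path through
  \<open>Y\<close>.\<close>

lemma ear_exists:
  assumes W: "W \<subseteq> V" "card W \<ge> 2" and y: "y \<in> V - W"
  obtains a b ps where "a \<in> W" "b \<in> W" "ps \<noteq> []" "distinct (a # ps @ [b])" "set ps \<inter> W = {}"
    "path_edges (a # ps @ [b]) \<subseteq> edge_set E"
proof -
  define R where "R = {(u, w). E u w \<and> u \<notin> W \<and> w \<notin> W}"
  define Y where "Y = {v. (y, v) \<in> R\<^sup>*}"
  define N where "N = {w \<in> W. \<exists>u\<in>Y. E u w}"
  have YV: "Y \<subseteq> V - W"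
  proof
    fix v assume "v \<in> Y"
    then have "(y, v) \<in> R\<^sup>*" by (simp add: Y_def)
    then show "v \<in> V - W" by induction (use y graph_facts(2) in \<open>auto simp: R_def\<close>)
  qed
  have finN: "finite N" using W(1) graph_facts(1) by (auto simp: N_def intro: finite_subset)
  have "card N \<ge> 2"
  proof (rule ccontr)
    assume "\<not> card N \<ge> 2"
    then have cN: "card N \<le> 1" by simp
    let ?V1 = "Y \<union> N" and ?V2 = "V - Y"
    have NV: "N \<subseteq> V - Y" using W(1) YV by (auto simp: N_def)
    have "N \<noteq> W" using cN W(2) by auto
    then obtain w where w: "w \<in> W" "w \<notin> N" by (auto simp: N_def)
    have "y \<in> Y" by (simp add: Y_def)
    have "V = ?V1 \<union> ?V2" using NV YV by blast
    moreover have "?V1 - ?V2 \<noteq> {}" using \<open>y \<in> Y\<close> by blast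
    moreover have "w \<in> ?V2 - ?V1" using w W(1) YV by blast
    moreover have "?V1 \<inter> ?V2 = N" using NV by blast
    moreover have "\<not> E u x" if u: "u \<in> ?V1 - ?V2" and x: "x \<in> ?V2 - ?V1" for u x
    proof
      assume e: "E u x"
      have uY: "u \<in> Y" using u NV by blast
      show False
      proof (cases "x \<in> W")
        case True
        then have "x \<in> N" using uY e by (auto simp: N_def)
        then show False using x by blast
      next
        case False
        have "(u, x) \<in> R" using e uY YV False by (auto simp: R_def)
        then have "x \<in> Y" using uY by (auto simp: Y_def intro: rtrancl_into_rtrancl)
        then show False using x by blast
      qed
    qed
    ultimately have "separable V E"
      unfolding separable_def using cN by (intro exI[of _ ?V1] exI[of _ ?V2]) auto
    then show False using ns by blast
  qed
  then obtain a b where ab: "a \<in> N" "b \<in> N" "a \<noteq> b"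
    by (metis card_le_Suc0_iff_eq finN not_less_eq_eq numeral_2_eq_2)
  then obtain u1 u2 where u: "u1 \<in> Y" "u2 \<in> Y" "E u1 a" "E u2 b" by (auto simp: N_def)
  have "sym R" using graph_facts(3) by (auto simp: R_def sym_def)
  then have "sym (R\<^sup>*)" by (rule sym_rtrancl)
  then have "(u1, y) \<in> R\<^sup>*" using u(1) by (auto simp: Y_def dest: symD)
  then have "(u1, u2) \<in> R\<^sup>*" using u(2) by (auto simp: Y_def)
  then obtain xs where xs: "xs \<noteq> []" "distinct xs" "hd xs = u1" "last xs = u2" "successively (\<lambda>u w. (u, w) \<in> R) xs"
    using rtrancl_distinct_path by metis
  have xW: "set xs \<inter> W = {}"
  proof -
    have "set xs \<subseteq> - W" using xs(1,3,5) u(1) YV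
    proof (induction xs arbitrary: u1 rule: path_edges.induct)
      case (1 x z zs)
      then have "(x, z) \<in> R" by simp
      then have "z \<notin> W" "x \<notin> W" "z \<in> V" using graph_facts(2) by (auto simp: R_def)
      moreover have "z \<in> Y" using 1 \<open>(x, z) \<in> R\<close> by (auto simp: Y_def intro: rtrancl_into_rtrancl)
      ultimately show ?case using 1(1)[of z] 1 by auto
    qed auto
    then show ?thesis by blast
  qed
  have "successively E xs" using xs(5) by (rule successively_mono) (auto simp: R_def)
  then have "successively E (a # xs @ [b])"
    using xs(1,3,4) u(3,4) graph_facts(3) by (auto simp: successively_append_iff successively_Cons)
  then have "path_edges (a # xs @ [b]) \<subseteq> edge_set E" by (rule successively_path_edges)
  moreover have "distinct (a # xs @ [b])" using xs(2) xW ab by (auto simp: N_def)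
  ultimately show thesis using that[of a b xs] ab xs(1) xW by (auto simp: N_def)
qed

text \<open>A largest edge set that is both a sphere and suitably drawn is the whole graph, since
  any missing vertex or edge would give another ear. \<open>plane\<close> and \<open>sphere\<close>
  are carried together: the drawing finds the face that an ear divides, and the homological
  conditions are what is wanted in the end.\<close>

lemma nonseparable_sphere:
  assumes dr: "drawing p c (edge_set E)" and cV: "card V \<ge> 3"
  shows "\<exists>\<Phi> :: ('a set set \<times> bool) set. sphere (edge_set E) \<Phi> \<and> V \<subseteq> \<Union>(edge_set E)"
proof -
  interpret drawing p c "edge_set E" by (rule dr)
  define good where "good F \<longleftrightarrow> (\<exists>\<Phi>. sphere F \<Phi> \<and> plane F \<Phi>)" for F
  have good_sub: "F \<subseteq> edge_set E" if "good F" for F using that unfolding good_def plane_def by blast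
  have extend: "good (F \<union> path_edges (a # ps @ [b]))"
    if g: "good F" and d: "distinct (a # ps @ [b])" and P: "path_edges (a # ps @ [b]) \<subseteq> edge_set E"
      "path_edges (a # ps @ [b]) \<inter> F = {}" and ab: "a \<in> \<Union>F" "b \<in> \<Union>F" and ps: "set ps \<inter> \<Union>F = {}" for F a ps b
  proof -
    obtain \<Phi> where \<Phi>: "sphere F \<Phi>" "plane F \<Phi>" using g unfolding good_def by blast
    have cyc: "\<exists>xs. distinct xs \<and> length xs \<ge> 3 \<and> fst f = cycle_edges xs \<and> fst f \<subseteq> F" if "f \<in> \<Phi>" for f
      using sphere_face[OF \<Phi>(1) that] by metis
    obtain f where f: "f \<in> \<Phi>" "a \<in> \<Union>(fst f)" "b \<in> \<Union>(fst f)"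
      and pl: "\<And>ys ws. distinct (a # ys @ b # ws) \<Longrightarrow> fst f = cycle_edges (a # ys @ b # ws) \<Longrightarrow>
      \<exists>s1 s2. plane (F \<union> path_edges (a # ps @ [b])) (insert (path_edges (a # ys @ [b]) \<union> path_edges (a # ps @ [b]), s1)
        (insert (path_edges (b # ws @ [a]) \<union> path_edges (a # ps @ [b]), s2) (\<Phi> - {f})))"
      using plane_ear[OF \<Phi>(2) cyc sphere_edge(2)[OF \<Phi>(1)] d refl P ab ps] by metis
    obtain xs where xs: "distinct xs" "length xs \<ge> 3" "fst f = cycle_edges xs" "set xs = \<Union>(fst f)"
      using sphere_face[OF \<Phi>(1) f(1)] by metis
    obtain us vs where s: "xs = us @ a # vs" using f(2) xs(4) by (metis split_list)
    have "b \<in> set (vs @ us)" using f(3) xs(4) s d by auto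
    then obtain ys ws where s': "vs @ us = ys @ b # ws" by (meson split_list)
    have "fst f = cycle_edges (a # vs @ us)"
      using cycle_edges_rotate[of us "a # vs"] xs(3) s by (cases "us = []") auto
    then have fe: "fst f = cycle_edges (a # ys @ b # ws)" by (simp add: s')
    have "distinct (a # vs @ us)" using xs(1) s by auto
    then have dy: "distinct (a # ys @ b # ws)" by (simp only: s')
    obtain s1 s2 where "plane (F \<union> path_edges (a # ps @ [b])) (insert (path_edges (a # ys @ [b]) \<union> path_edges (a # ps @ [b]), s1)
        (insert (path_edges (b # ws @ [a]) \<union> path_edges (a # ps @ [b]), s2) (\<Phi> - {f})))" using pl[OF dy fe] by metis
    then show ?thesis
      unfolding good_def using sphere_ear[OF \<Phi>(1) f(1) dy fe d refl P(2) ps refl refl] by blast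
  qed
  have "\<exists>a b. E a b"
  proof (rule ccontr)
    assume none: "\<not> (\<exists>a b. E a b)"
    have "card V \<noteq> 0" using cV by simp
    then obtain v where v: "v \<in> V" by fastforce
    have "V - {v} \<noteq> {}"
    proof
      assume "V - {v} = {}"
      then have "V = {v}" using v by blast
      then show False using cV by simp
    qed
    then obtain v' where v': "v' \<in> V - {v}" by blast
    have "separable V E"
    proof (rule separableI)
      show "V = {v} \<union> (V - {v})" using v by blast
      show "v \<in> {v} - (V - {v})" by simp
      show "v' \<in> (V - {v}) - {v}" using v' by simp
      have "{v} \<inter> (V - {v}) = {}" by blast
      then show "card ({v} \<inter> (V - {v})) \<le> 1" by (simp only: card.empty zero_le)
      show "\<not> E u w" for u w using none by blast
    qed
    then show False using ns by blast
  qed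
  then obtain a0 b0 where e0: "E a0 b0" by blast
  then have ab0: "a0 \<noteq> b0" "{a0, b0} \<subseteq> V" using graph_facts by blast+
  have "V - {a0, b0} \<noteq> {}"
  proof
    assume "V - {a0, b0} = {}"
    then have "V = {a0, b0}" using ab0 by blast
    then show False using cV ab0(1) by simp
  qed
  then obtain y0 where y0: "y0 \<in> V - {a0, b0}" by blast
  have "card {a0, b0} \<ge> 2" using ab0(1) by simp
  \<comment> \<open>An ear over the two ends of an edge closes up with that edge to the initial
    cycle.\<close>
  from ear_exists[OF ab0(2) this y0]
  obtain a b ps where ear0: "a \<in> {a0, b0}" "b \<in> {a0, b0}" "ps \<noteq> []" "distinct (a # ps @ [b])"
    "set ps \<inter> {a0, b0} = {}" "path_edges (a # ps @ [b]) \<subseteq> edge_set E" by metis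
  have len0: "length (a # ps @ [b]) \<ge> 3" using ear0(3) by (cases ps) auto
  have "{b, a} \<in> edge_set E" using ear0(1,2,4) e0 by (auto simp: edge_set_iff graph_facts(3))
  then have "cycle_edges (a # ps @ [b]) \<subseteq> edge_set E"
    using ear0(6) cycle_edges_last(1)[OF ear0(4) len0] by simp
  then have good0: "good (cycle_edges (a # ps @ [b]))"
    unfolding good_def using sphere_cycle[OF ear0(4) len0] plane_cycle by blast
  then have "\<exists>F. good F \<and> (\<forall>G. good G \<longrightarrow> card G \<le> card F)"
    using good_sub finite_edge_set
  proof -
    have "\<forall>G. good G \<longrightarrow> card G < Suc (card (edge_set E))"
      using good_sub finite_edge_set by (auto simp: less_Suc_eq_le intro: card_mono)
    then show ?thesis using ex_has_greatest_nat[of good _ card "Suc (card (edge_set E))"] good0 by blast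
  qed
  then obtain F where F: "good F" "\<And>G. good G \<Longrightarrow> card G \<le> card F" by blast
  have FE: "F \<subseteq> edge_set E" by (rule good_sub[OF F(1)])
  have FV: "\<Union>F \<subseteq> V" using FE by (auto elim!: edge_setE)
  have finF: "finite F" using FE finite_edge_set by (rule finite_subset)
  have maximal: "False" if "good (F \<union> P)" "P \<noteq> {}" "P \<inter> F = {}" "P \<subseteq> edge_set E" for P
  proof -
    have "finite P" using that(4) finite_edge_set by (rule finite_subset)
    then have "card (F \<union> P) = card F + card P" "card P > 0" using that finF by (auto simp: card_Un_disjoint Int_commute card_gt_0_iff)
    then show False using F(2)[OF that(1)] by simp
  qed
  have cF: "card (\<Union>F) \<ge> 2"
  proof -
    obtain \<Phi> where \<Phi>: "sphere F \<Phi>" "plane F \<Phi>" using F(1) unfolding good_def by blast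
    have "cycle_edges (a # ps @ [b]) \<noteq> {}" using cycle_edges_last(1)[OF ear0(4) len0] by simp
    moreover have "finite (cycle_edges (a # ps @ [b]))" using good_sub[OF good0] finite_edge_set by (rule finite_subset)
    ultimately have "card (cycle_edges (a # ps @ [b])) > 0" by (simp add: card_gt_0_iff)
    then have "card F > 0" using F(2)[OF good0] by linarith
    then obtain e where "e \<in> F" by fastforce
    then obtain f where f: "f \<in> \<Phi>" using sphere_edge(1)[OF \<Phi>(1)] by blast
    obtain xs where xs: "distinct xs" "length xs \<ge> 3" "set xs = \<Union>(fst f)" "fst f \<subseteq> F" using sphere_face[OF \<Phi>(1) f] by metis
    have "card (set xs) \<ge> 3" using xs(2) distinct_card[OF xs(1)] by simp
    moreover have "set xs \<subseteq> \<Union>F" using xs(3,4) by blast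
    moreover have "finite (\<Union>F)" using FV graph_facts(1) by (rule finite_subset)
    ultimately show ?thesis using card_mono[of "\<Union>F" "set xs"] by simp
  qed
  have VF: "V \<subseteq> \<Union>F"
  proof (rule ccontr)
    assume "\<not> V \<subseteq> \<Union>F"
    then obtain y where "y \<in> V - \<Union>F" by blast
    from ear_exists[OF FV cF this] obtain a b ps where ear: "a \<in> \<Union>F" "b \<in> \<Union>F" "ps \<noteq> []" "distinct (a # ps @ [b])"
      "set ps \<inter> \<Union>F = {}" "path_edges (a # ps @ [b]) \<subseteq> edge_set E" by metis
    have meets: "e \<inter> set ps \<noteq> {}" if e: "e \<in> path_edges (a # ps @ [b])" for e
    proof -
      obtain q qs where q: "ps = q # qs" using ear(3) by (meson neq_Nil_conv)
      then have "e = {a, q} \<or> e \<in> path_edges (ps @ [b])" using e by auto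
      then show ?thesis using path_edges_meets[of e ps b] q by auto
    qed
    have dis: "path_edges (a # ps @ [b]) \<inter> F = {}" using meets ear(5) by blast
    have "path_edges (a # ps @ [b]) \<noteq> {}" by (cases ps) auto
    then show False using maximal[OF extend[OF F(1) ear(4,6) dis ear(1,2,5)] _ dis ear(6)] by blast
  qed
  have "edge_set E \<subseteq> F"
  proof
    fix e assume e: "e \<in> edge_set E"
    then obtain u v where uv: "e = {u, v}" "E u v" "u \<noteq> v" "u \<in> V" "v \<in> V" by (rule edge_setE)
    show "e \<in> F"
    proof (rule ccontr)
      assume "e \<notin> F"
      \<comment> \<open>All vertices are present, so a missing edge is an ear without inner
        vertices.\<close>
      have P: "path_edges (u # [] @ [v]) = {e}" using uv by simp
      have "good (F \<union> path_edges (u # [] @ [v]))"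
        by (rule extend[OF F(1)]) (use uv e \<open>e \<notin> F\<close> VF P in auto)
      then show False using maximal[of "{e}"] P e \<open>e \<notin> F\<close> by simp
    qed
  qed
  then have "F = edge_set E" using FE by blast
  then show ?thesis using F(1) VF unfolding good_def by blast
qed

end

section \<open>Gluing product structures at a vertex\<close>

section \<open>Gluing at a vertex and colouring\<close>

lemma product_structured_small:
  assumes "finite V" "card V \<le> 3" "\<And>u. \<not> E u u"
  shows "product_structured V E r"
proof -
  define l where "l v = (if v = r then 0 else 1 :: nat)" for v
  define N :: "nat \<Rightarrow> nat set" where "N = (\<lambda>_. {})(1 := {0})"
  have "elim_order 3 N" by (auto simp: elim_order_def N_def)
  moreover have "near (l u) (l w) \<and> joined N (l u) (l w)" for u w
    by (auto simp: near_def joined_def l_def N_def)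
  moreover have "card {v\<in>V. l v = n \<and> l v = k} \<le> 3" for n k
    using card_mono[OF assms(1), of "{v\<in>V. l v = n \<and> l v = k}"] assms(2) by fastforce
  moreover have "l r = 0" "\<And>v. l v = 0 \<Longrightarrow> v = r" by (auto simp: l_def split: if_splits)
  ultimately show ?thesis unfolding product_structured_def by blast
qed

text \<open>The second structure hangs from \<open>v\<close>: its levels are shifted by the level of
  \<open>v\<close>, its part 0, which holds only \<open>v\<close>, is merged into the part of
  \<open>v\<close>, and its other parts follow all old ones. No further vertex enters an old part,
  so the cells do not grow.\<close>

lemma product_structured_glue:
  assumes Q1: "product_structured V1 E1 r" and Q2: "product_structured V2 E2 v"
    and fin: "finite V1" "finite V2" and r: "r \<in> V1" and v: "v \<in> V2" and cut: "V1 \<inter> V2 \<subseteq> {v}"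
    and E1: "\<And>u w. E1 u w \<Longrightarrow> u \<in> V1 \<and> w \<in> V1" and E2: "\<And>u w. E2 u w \<Longrightarrow> u \<in> V2 \<and> w \<in> V2"
    and E: "\<And>u w. E u w \<Longrightarrow> E1 u w \<or> E2 u w"
  shows "product_structured (V1 \<union> V2) E r"
proof -
  obtain l1 \<pi>1 N1 where 1: "elim_order 3 N1" "\<And>u w. E1 u w \<Longrightarrow> near (l1 u) (l1 w) \<and> joined N1 (\<pi>1 u) (\<pi>1 w)"
    "\<And>n k. card {v\<in>V1. \<pi>1 v = n \<and> l1 v = k} \<le> 3" "l1 r = 0" "\<pi>1 r = 0" "\<And>v. v \<in> V1 \<Longrightarrow> \<pi>1 v = 0 \<Longrightarrow> v = r"
    using Q1 unfolding product_structured_def by blast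
  obtain l2 \<pi>2 N2 where 2: "elim_order 3 N2" "\<And>u w. E2 u w \<Longrightarrow> near (l2 u) (l2 w) \<and> joined N2 (\<pi>2 u) (\<pi>2 w)"
    "\<And>n k. card {v\<in>V2. \<pi>2 v = n \<and> l2 v = k} \<le> 3" "l2 v = 0" "\<pi>2 v = 0" "\<And>u. u \<in> V2 \<Longrightarrow> \<pi>2 u = 0 \<Longrightarrow> u = v"
    using Q2 unfolding product_structured_def by blast
  define M where "M = Suc (Max (\<pi>1 ` V1))"
  have M: "\<pi>1 u < M" if "u \<in> V1" for u
    using Max_ge[of "\<pi>1 ` V1" "\<pi>1 u"] fin that by (simp add: M_def less_Suc_eq_le)
  have M0: "M > 0" by (simp add: M_def)
  \<comment> \<open>If \<open>v\<close> is not in \<open>V1\<close>, the pieces are disjoint and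
    part 0 becomes the new part \<open>M\<close>.\<close>
  define \<tau> where "\<tau> i = (if i = 0 then if v \<in> V1 then \<pi>1 v else M else M + i)" for i
  define off where "off = (if v \<in> V1 then l1 v else 0)"
  define l where "l u = (if u \<in> V1 then l1 u else off + l2 u)" for u
  define \<pi> where "\<pi> u = (if u \<in> V1 then \<pi>1 u else \<tau> (\<pi>2 u))" for u
  define N where "N n = (if n < M then N1 n else \<tau> ` N2 (n - M))" for n
  have \<tau>0: "\<tau> 0 \<le> M" using M[of v] by (auto simp: \<tau>_def)
  have \<tau>pos: "\<tau> i = M + i" if "i > 0" for i using that by (simp add: \<tau>_def)
  have V2: "\<pi> u = \<tau> (\<pi>2 u)" "l u = off + l2 u" if "u \<in> V2" for u
    using that cut 2(4,5) by (auto simp: \<pi>_def l_def \<tau>_def off_def)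
  have V2M: "\<pi> u = M + \<pi>2 u" if "u \<in> V2" "u \<notin> V1" for u
  proof (cases "\<pi>2 u = 0")
    case True
    then have "u = v" using 2(6) that by blast
    then show ?thesis using V2(1)[OF that(1)] True that(2) by (simp add: \<tau>_def)
  qed (use V2(1)[OF that(1)] \<tau>pos in auto)
  have N1: "N1 n \<subseteq> {..<n}" "card (N1 n) \<le> 3" "\<And>a b. a \<in> N1 n \<Longrightarrow> b \<in> N1 n \<Longrightarrow> a < b \<Longrightarrow> a \<in> N1 b" for n
    using 1(1) unfolding elim_order_def by blast+
  have N2: "N2 n \<subseteq> {..<n}" "card (N2 n) \<le> 3" "\<And>a b. a \<in> N2 n \<Longrightarrow> b \<in> N2 n \<Longrightarrow> a < b \<Longrightarrow> a \<in> N2 b" for n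
    using 2(1) unfolding elim_order_def by blast+
  have "N n \<subseteq> {..<n} \<and> card (N n) \<le> 3 \<and> (\<forall>a\<in>N n. \<forall>b\<in>N n. a < b \<longrightarrow> a \<in> N b)" for n
  proof (cases "n < M")
    case True
    have "a \<in> N b" if "a \<in> N1 n" "b \<in> N1 n" "a < b" for a b
      using N1(3)[OF that] N1(1)[of n] that(2) True by (auto simp: N_def)
    moreover have "N n = N1 n" using True by (simp add: N_def)
    ultimately show ?thesis using N1(1,2)[of n] by simp
  next
    case False
    then have Nn: "N n = \<tau> ` N2 (n - M)" by (simp add: N_def)
    have "\<tau> i < n" if "i \<in> N2 (n - M)" for i
      using N2(1)[of "n - M"] that False \<tau>0 \<tau>pos[of i] by (cases "i = 0") auto
    moreover have "card (N n) \<le> 3"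
      using card_image_le[OF finite_subset[OF N2(1) finite_lessThan], of \<tau> "n - M"] N2(2)[of "n - M"] Nn by simp
    moreover have "\<tau> i \<in> N (\<tau> j)" if ij: "i \<in> N2 (n - M)" "j \<in> N2 (n - M)" "\<tau> i < \<tau> j" for i j
    proof -
      have "j > 0" using ij(3) \<tau>0 \<tau>pos[of i] by (cases "j = 0"; cases "i = 0") auto
      moreover have "i < j" using ij(3) \<tau>pos[of i] \<tau>pos[OF \<open>j > 0\<close>] \<open>j > 0\<close> by (cases "i = 0") auto
      then have "i \<in> N2 j" using N2(3) ij by blast
      ultimately show ?thesis by (simp add: N_def \<tau>pos)
    qed
    ultimately show ?thesis using Nn by auto
  qed
  then have "elim_order 3 N" unfolding elim_order_def by blast
  moreover have "near (l u) (l w) \<and> joined N (\<pi> u) (\<pi> w)" if "E u w" for u w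
    using E[OF that]
  proof
    assume e: "E1 u w"
    have "u \<in> V1" "w \<in> V1" using E1[OF e] by auto
    then show ?thesis using 1(2)[OF e] M[of u] M[of w] by (auto simp: l_def \<pi>_def joined_def N_def)
  next
    assume e: "E2 u w"
    have uw: "u \<in> V2" "w \<in> V2" using E2[OF e] by auto
    have N: "\<tau> a \<in> N (\<tau> b)" if "a \<in> N2 b" for a b
    proof -
      have "b > 0" using N2(1)[of b] that by auto
      then show ?thesis using that by (simp add: N_def \<tau>pos)
    qed
    have "joined N (\<tau> (\<pi>2 u)) (\<tau> (\<pi>2 w))" using 2(2)[OF e] N by (auto simp: joined_def)
    then show ?thesis using 2(2)[OF e] V2[OF uw(1)] V2[OF uw(2)] by (auto simp: near_def)
  qed
  moreover have "card {u\<in>V1 \<union> V2. \<pi> u = n \<and> l u = k} \<le> 3" for n k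
  proof (cases "n < M")
    case True
    have "u \<in> {u\<in>V1. \<pi>1 u = n \<and> l1 u = k}" if "u \<in> {u\<in>V1 \<union> V2. \<pi> u = n \<and> l u = k}" for u
    proof -
      have "u \<in> V1" using that V2M[of u] True by auto
      then show ?thesis using that by (simp add: l_def \<pi>_def)
    qed
    then have "{u\<in>V1 \<union> V2. \<pi> u = n \<and> l u = k} \<subseteq> {u\<in>V1. \<pi>1 u = n \<and> l1 u = k}" by blast
    then have "card {u\<in>V1 \<union> V2. \<pi> u = n \<and> l u = k} \<le> card {u\<in>V1. \<pi>1 u = n \<and> l1 u = k}"
      by (rule card_mono[rotated]) (use fin in simp)
    also have "\<dots> \<le> 3" by (rule 1(3))
    finally show ?thesis .
  next
    case False
    have "u \<in> {u\<in>V2. \<pi>2 u = n - M \<and> l2 u = k - off}" if "u \<in> {u\<in>V1 \<union> V2. \<pi> u = n \<and> l u = k}" for u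
    proof -
      have "u \<notin> V1" using that False M[of u] by (auto simp: \<pi>_def)
      then show ?thesis using that V2M[of u] V2(2)[of u] by auto
    qed
    then have "{u\<in>V1 \<union> V2. \<pi> u = n \<and> l u = k} \<subseteq> {u\<in>V2. \<pi>2 u = n - M \<and> l2 u = k - off}" by blast
    then have "card {u\<in>V1 \<union> V2. \<pi> u = n \<and> l u = k} \<le> card {u\<in>V2. \<pi>2 u = n - M \<and> l2 u = k - off}"
      by (rule card_mono[rotated]) (use fin in simp)
    also have "\<dots> \<le> 3" by (rule 2(3))
    finally show ?thesis .
  qed
  moreover have "l r = 0" "\<pi> r = 0" using r 1(4,5) by (simp_all add: l_def \<pi>_def)
  moreover have "u = r" if "u \<in> V1 \<union> V2" "\<pi> u = 0" for u
    using that 1(6)[of u] V2M[of u] M0 by (cases "u \<in> V1") (auto simp: \<pi>_def)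
  ultimately show ?thesis unfolding product_structured_def by blast
qed

definition drawn_by :: "'a set \<Rightarrow> ('a \<Rightarrow> 'a \<Rightarrow> bool) \<Rightarrow> ('a \<Rightarrow> real \<times> real) \<Rightarrow> ('a set \<Rightarrow> real \<Rightarrow> real \<times> real) \<Rightarrow> bool" where
  "drawn_by V E p c \<longleftrightarrow> inj_on p V \<and>
     (\<forall>u v. E u v \<longrightarrow> arc (c {u, v}) \<and>
        {pathstart (c {u, v}), pathfinish (c {u, v})} = {p u, p v} \<and>
        (\<forall>w\<in>V. p w \<in> path_image (c {u, v}) \<longrightarrow> w = u \<or> w = v)) \<and>
     (\<forall>u v x y. E u v \<longrightarrow> E x y \<longrightarrow> {u, v} \<noteq> {x, y} \<longrightarrow>
        path_image (c {u, v}) \<inter> path_image (c {x, y}) \<subseteq> p ` ({u, v} \<inter> {x, y}))"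

lemma planar_iff: "planar V E \<longleftrightarrow> (\<exists>p c. drawn_by V E p c)"
  by (simp only: planar_def drawn_by_def)

lemma drawn_byD:
  assumes "drawn_by V E p c"
  shows "inj_on p V"
    and "E u v \<Longrightarrow> arc (c {u, v}) \<and> {pathstart (c {u, v}), pathfinish (c {u, v})} = {p u, p v}"
    and "E u v \<Longrightarrow> w \<in> V \<Longrightarrow> p w \<in> path_image (c {u, v}) \<Longrightarrow> w = u \<or> w = v"
    and "E u v \<Longrightarrow> E x y \<Longrightarrow> {u, v} \<noteq> {x, y} \<Longrightarrow>
      path_image (c {u, v}) \<inter> path_image (c {x, y}) \<subseteq> p ` ({u, v} \<inter> {x, y})"
proof -
  note D = assms[unfolded drawn_by_def]
  note D2 = conjunct1[OF conjunct2[OF D], rule_format]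
  show "inj_on p V" by (rule conjunct1[OF D])
  show "arc (c {u, v}) \<and> {pathstart (c {u, v}), pathfinish (c {u, v})} = {p u, p v}" if "E u v"
    using D2[OF that] by (elim conjE, intro conjI)
  show "w = u \<or> w = v" if "E u v" "w \<in> V" "p w \<in> path_image (c {u, v})"
    using D2[OF that(1)] that(2,3) by (elim conjE) (drule (1) bspec, drule (1) mp)
  show "path_image (c {u, v}) \<inter> path_image (c {x, y}) \<subseteq> p ` ({u, v} \<inter> {x, y})" if "E u v" "E x y" "{u, v} \<noteq> {x, y}"
    by (rule conjunct2[OF conjunct2[OF D], rule_format, OF that])
qed

lemma planar_restrict:
  assumes "planar V E" "V' \<subseteq> V" "\<And>u v. E' u v \<Longrightarrow> E u v"
  shows "planar V' E'"
proof -
  obtain p c where "drawn_by V E p c" using assms(1) unfolding planar_iff by blast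
  note pc = drawn_byD[OF this]
  have "drawn_by V' E' p c"
    unfolding drawn_by_def
  proof (intro conjI allI impI ballI)
    show "inj_on p V'" using pc(1) assms(2) by (rule inj_on_subset)
    fix u v assume e: "E' u v"
    show "arc (c {u, v})" "{pathstart (c {u, v}), pathfinish (c {u, v})} = {p u, p v}"
      using pc(2)[OF assms(3)[OF e]] by simp_all
    show "w = u \<or> w = v" if "w \<in> V'" "p w \<in> path_image (c {u, v})" for w
      using pc(3)[OF assms(3)[OF e] subsetD[OF assms(2) that(1)] that(2)] .
    show "path_image (c {u, v}) \<inter> path_image (c {x, y}) \<subseteq> p ` ({u, v} \<inter> {x, y})"
      if "E' x y" "{u, v} \<noteq> {x, y}" for x y
      by (rule pc(4)[OF assms(3)[OF e] assms(3)[OF that(1)] that(2)])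
  qed
  then show ?thesis unfolding planar_iff by blast
qed

lemma planar_drawing:
  assumes sg: "simple_graph V E" and pl: "planar V E"
  shows "\<exists>p c. drawing p c (edge_set E)"
proof -
  \<comment> \<open>The plane is moved to \<open>complex\<close>, where winding numbers are
    available.\<close>
  define h :: "real \<times> real \<Rightarrow> complex" where "h = (\<lambda>z. Complex (fst z) (snd z))"
  have lin: "linear h" by (rule linearI) (simp_all add: h_def complex_eq_iff)
  have inj: "inj h" by (auto simp: inj_def h_def prod_eq_iff)
  obtain p c where "drawn_by V E p c" using pl unfolding planar_iff by blast
  note pc = drawn_byD[OF this]
  have V: "\<Union>(edge_set E) \<subseteq> V" and sym: "\<And>u v. {u, v} \<in> edge_set E \<Longrightarrow> E u v"
    using sg unfolding simple_graph_def edge_set_def by (auto simp: doubleton_eq_iff)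
  have "drawing (h \<circ> p) (\<lambda>e. h \<circ> c e) (edge_set E)"
  proof
    show "inj_on (h \<circ> p) (\<Union>(edge_set E))"
      by (intro comp_inj_on inj_on_subset[OF pc(1) V] inj_on_subset[OF inj subset_UNIV])
  next
    fix u v assume "{u, v} \<in> edge_set E"
    then have e: "E u v" by (rule sym)
    have a: "arc (h \<circ> c {u, v})" using pc(2)[OF e] arc_linear_image_eq[OF lin inj] by simp
    have "h ` {pathstart (c {u, v}), pathfinish (c {u, v})} = h ` {p u, p v}" using pc(2)[OF e] by metis
    then show "arc (h \<circ> c {u, v}) \<and> {pathstart (h \<circ> c {u, v}), pathfinish (h \<circ> c {u, v})} = {(h \<circ> p) u, (h \<circ> p) v}"
      using a by (simp add: pathstart_compose pathfinish_compose)
  next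
    fix e w assume "e \<in> edge_set E" and w: "w \<in> \<Union>(edge_set E)" "(h \<circ> p) w \<in> path_image (h \<circ> c e)"
    then obtain u v where e: "e = {u, v}" "E u v" unfolding edge_set_def by blast
    have "p w \<in> path_image (c e)" using w(2) inj by (auto simp: path_image_compose inj_image_mem_iff)
    moreover have "w \<in> V" using w(1) V by blast
    ultimately show "w \<in> e" using pc(3)[OF e(2)] e(1) by simp
  next
    fix e e' assume "e \<in> edge_set E" "e' \<in> edge_set E" and ne: "e \<noteq> e'"
    then obtain u v u' v' where e: "e = {u, v}" "E u v" "e' = {u', v'}" "E u' v'" unfolding edge_set_def by blast
    have "path_image (c e) \<inter> path_image (c e') \<subseteq> p ` (e \<inter> e')"
      unfolding e(1,3) by (rule pc(4)[OF e(2,4)]) (use ne e in simp)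
    then have "h ` (path_image (c e) \<inter> path_image (c e')) \<subseteq> h ` p ` (e \<inter> e')" by (rule image_mono)
    then show "path_image (h \<circ> c e) \<inter> path_image (h \<circ> c e') \<subseteq> (h \<circ> p) ` (e \<inter> e')"
      unfolding path_image_compose image_comp image_Int[OF inj] .
  qed
  then show ?thesis by blast
qed

text \<open>The root is arbitrary because, when the graph is separable, the second piece has to be
  rooted at the common vertex.\<close>

theorem planar_product_structured:
  assumes "simple_graph V E" "planar V E" "r \<in> V"
  shows "product_structured V E r"
  using assms
proof (induction "card V" arbitrary: V E r rule: less_induct)
  case less
  note sg = less.prems(1) and pl = less.prems(2) and r = less.prems(3)
  have fin: "finite V" and E: "\<And>u w. E u w \<Longrightarrow> u \<in> V \<and> w \<in> V" and sym: "\<And>u w. E u w \<Longrightarrow> E w u"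
    and irr: "\<And>u. \<not> E u u"
    using sg unfolding simple_graph_def by blast+
  show ?case
  proof (cases "separable V E")
    case True
    have glue: "product_structured V E r" if V: "V = V1 \<union> V2" "V1 - V2 \<noteq> {}" "V2 - V1 \<noteq> {}" "card (V1 \<inter> V2) \<le> 1"
      "\<forall>u\<in>V1 - V2. \<forall>w\<in>V2 - V1. \<not> E u w" "r \<in> V1" for V1 V2
    proof -
      define R where "R W = (\<lambda>u w. E u w \<and> u \<in> W \<and> w \<in> W)" for W
      have fin12: "finite V1" "finite V2" using fin V(1) by auto
      have IH: "product_structured W (R W) s" if "W \<subset> V" "s \<in> W" for W s
      proof (rule less.hyps)
        show "card W < card V" using that fin by (simp add: psubset_card_mono)
        show "simple_graph W (R W)"
          using sg that(1) finite_subset[of W V] unfolding simple_graph_def R_def by auto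
        show "planar W (R W)" by (rule planar_restrict[OF pl]) (use that R_def in auto)
      qed (rule that(2))
      obtain v where v: "v \<in> V2" "V1 \<inter> V2 \<subseteq> {v}"
      proof (cases "V1 \<inter> V2 = {}")
        case True
        then show thesis using that V(3) by blast
      next
        case False
        then have "card (V1 \<inter> V2) = 1" using V(4) fin12 card_gt_0_iff[of "V1 \<inter> V2"] by force
        then obtain x where "V1 \<inter> V2 = {x}" by (rule card_1_singletonE)
        then show thesis using that[of x] by blast
      qed
      have "product_structured (V1 \<union> V2) E r"
      proof (rule product_structured_glue[OF IH[of V1 r] IH[of V2 v] fin12 V(6) v])
        show "V1 \<subset> V" "V2 \<subset> V" "r \<in> V1" "v \<in> V2" using V v by blast+
        show "R V1 u w \<or> R V2 u w" if "E u w" for u w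
          using that E[OF that] sym[OF that] V(1,5) unfolding R_def by blast
      qed (auto simp: R_def)
      then show ?thesis using V(1) by simp
    qed
    obtain V1 V2 where V: "V = V1 \<union> V2" "V1 - V2 \<noteq> {}" "V2 - V1 \<noteq> {}" "card (V1 \<inter> V2) \<le> 1"
      "\<forall>u\<in>V1 - V2. \<forall>w\<in>V2 - V1. \<not> E u w" using True unfolding separable_def by metis
    show ?thesis
    proof (cases "r \<in> V1")
      case True
      then show ?thesis using glue[OF V] by blast
    next
      case False
      then have "r \<in> V2" using r V(1) by blast
      moreover have "\<forall>u\<in>V2 - V1. \<forall>w\<in>V1 - V2. \<not> E u w" using V(5) sym by blast
      ultimately show ?thesis using glue[of V2 V1] V(1-4) by (simp add: Un_commute Int_commute)
    qed
  next
    case ns: False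
    show ?thesis
    proof (cases "card V \<le> 3")
      case True
      then show ?thesis by (rule product_structured_small[OF fin _ irr])
    next
      case False
      obtain p :: "'a \<Rightarrow> complex" and c where "drawing p c (edge_set E)" using planar_drawing[OF sg pl] by blast
      then obtain \<Phi> :: "('a set set \<times> bool) set" where \<Phi>: "sphere (edge_set E) \<Phi>" "V \<subseteq> \<Union>(edge_set E)"
        using nonseparable_sphere[OF sg ns, of p c] False by auto
      have "\<Union>(edge_set E) \<subseteq> V" using E unfolding edge_set_def by blast
      then have "(r, v) \<in> {(u, w). {u, w} \<in> edge_set E}\<^sup>*" if "v \<in> \<Union>(edge_set E)" for v
        using nonseparable_connected[OF sg ns r] that by blast
      then show ?thesis
      proof (rule sphere_product_structured[OF \<Phi>(1) _ _ \<Phi>(2)])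
        show "r \<in> \<Union>(edge_set E)" using \<Phi>(2) r by blast
        show "{u, w} \<in> edge_set E" if "E u w" for u w using that unfolding edge_set_def by blast
      qed
    qed
  qed
qed

section \<open>The product colouring\<close>

lemma colour_triple_inject:
  fixes a b c :: nat
  assumes "b < 64" "b' < 64" "c < 3" "c' < 3" "(a * 64 + b) * 3 + c = (a' * 64 + b') * 3 + c'"
  shows "a = a' \<and> b = b' \<and> c = c'"
proof -
  have "((a * 64 + b) * 3 + c) mod 3 = c" "((a' * 64 + b') * 3 + c') mod 3 = c'"
    using assms(3,4) by (simp_all only: mod_mult_self3 mod_less)
  then have c: "c = c'" using assms(5) by simp
  then have ab: "a * 64 + b = a' * 64 + b'" using assms(5) by simp
  have "(a * 64 + b) mod 64 = b" "(a' * 64 + b') mod 64 = b'"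
    using assms(1,2) by (simp_all only: mod_mult_self3 mod_less)
  then show ?thesis using ab c by simp
qed

lemma product_structured_colouring:
  assumes fin: "finite V" and Q: "product_structured V E r"
  shows "\<exists>\<phi>. (\<forall>v\<in>V. \<phi> v < 768) \<and> nonrepetitive V E \<phi>"
proof -
  obtain l \<pi> N where Q: "elim_order 3 N" "\<And>u w. E u w \<Longrightarrow> near (l u) (l w) \<and> joined N (\<pi> u) (\<pi> w)"
    "\<And>n k. card {v\<in>V. \<pi> v = n \<and> l v = k} \<le> 3"
    using Q unfolding product_structured_def by blast
  obtain \<psi> :: "nat \<Rightarrow> nat" where \<psi>: "\<And>n. \<psi> n < 4 ^ 3"
    "\<And>t x. t \<ge> 1 \<Longrightarrow> (\<forall>i. Suc i < 2 * t \<longrightarrow> joined N (x i) (x (Suc i))) \<Longrightarrow>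
       (\<forall>i<t. \<psi> (x i) = \<psi> (x (t + i))) \<Longrightarrow> (\<exists>i<t. x i = x (t + i))"
    using elim_order_strongly_nonrepetitive[OF Q(1)] by metis
  have \<psi>64: "\<psi> n < 64" for n using \<psi>(1)[of n] by simp
  define C where "C n k = {v\<in>V. \<pi> v = n \<and> l v = k}" for n k
  have "\<exists>h. bij_betw h (C n k) {0..<card (C n k)}" for n k
    by (rule ex_bij_betw_finite_nat) (use fin C_def in simp)
  then obtain h where h: "\<And>n k. bij_betw (h n k) (C n k) {0..<card (C n k)}" by metis
  define idx where "idx v = h (\<pi> v) (l v) v" for v
  have idx: "idx v < 3" if "v \<in> V" for v
  proof -
    have "v \<in> C (\<pi> v) (l v)" using that by (simp add: C_def)
    then have "idx v \<in> {0..<card (C (\<pi> v) (l v))}" unfolding idx_def using h bij_betwE by blast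
    then show ?thesis using Q(3)[of "\<pi> v" "l v"] by (simp add: C_def)
  qed
  have idx_inj: "v = w" if "v \<in> V" "w \<in> V" "\<pi> v = \<pi> w" "l v = l w" "idx v = idx w" for v w
  proof -
    have "v \<in> C (\<pi> w) (l w)" "w \<in> C (\<pi> w) (l w)" using that by (simp_all add: C_def)
    moreover have "inj_on (h (\<pi> w) (l w)) (C (\<pi> w) (l w))" using h by (rule bij_betw_imp_inj_on)
    ultimately show ?thesis using that(3-5) unfolding idx_def by (metis inj_onD)
  qed
  define \<phi> where "\<phi> v = (quaternary (l v) * 64 + \<psi> (\<pi> v)) * 3 + idx v" for v
  have \<phi>_eq: "quaternary (l v) = quaternary (l w) \<and> \<psi> (\<pi> v) = \<psi> (\<pi> w) \<and> idx v = idx w"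
    if "v \<in> V" "w \<in> V" "\<phi> v = \<phi> w" for v w
    by (rule colour_triple_inject[OF \<psi>64 \<psi>64 idx[OF that(1)] idx[OF that(2)] that(3)[unfolded \<phi>_def]])
  have "\<phi> v < 768" if "v \<in> V" for v
    using idx[OF that] \<psi>64[of "\<pi> v"] quaternary_less[of "l v"] by (simp add: \<phi>_def algebra_simps)
  moreover have "nonrepetitive V E \<phi>"
    unfolding nonrepetitive_def
  proof (intro allI impI notI)
    fix vs assume p: "graph_path V E vs" and rc: "repetitively_coloured \<phi> vs"
    obtain t where t0: "t \<ge> 1" "length vs = 2 * t" "\<forall>i<t. \<phi> (vs ! i) = \<phi> (vs ! (t + i))"
      using rc unfolding repetitively_coloured_def by metis
    note t = t0(1,2) t0(3)[rule_format]
    have V: "vs ! i \<in> V" if "i < 2 * t" for i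
    proof -
      have "vs ! i \<in> set vs" using that t(2) by simp
      then show ?thesis using p unfolding graph_path_def by blast
    qed
    have step: "near (l (vs ! i)) (l (vs ! Suc i)) \<and> joined N (\<pi> (vs ! i)) (\<pi> (vs ! Suc i))" if "Suc i < 2 * t" for i
    proof (rule Q(2))
      show "E (vs ! i) (vs ! Suc i)" using p that t(2) unfolding graph_path_def by simp
    qed
    have eq: "quaternary (l (vs ! i)) = quaternary (l (vs ! (t + i))) \<and> \<psi> (\<pi> (vs ! i)) = \<psi> (\<pi> (vs ! (t + i))) \<and>
        idx (vs ! i) = idx (vs ! (t + i))" if "i < t" for i
      by (rule \<phi>_eq) (use V t(3) that in auto)
    obtain i where i: "i < t" "\<pi> (vs ! i) = \<pi> (vs ! (t + i))"
      using \<psi>(2)[OF t(1), of "\<lambda>i. \<pi> (vs ! i)"] step eq by (metis (no_types))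
    have "l (vs ! i) = l (vs ! (t + i))"
      by (rule quaternary_boring[of t "\<lambda>i. l (vs ! i)"]) (use step eq i in auto)
    then have "vs ! i = vs ! (t + i)"
      using idx_inj[OF V[of i] V[of "t + i"] i(2)] i(1) eq[OF i(1)] by simp
    moreover have "distinct vs" using p unfolding graph_path_def by blast
    ultimately show False using i(1) t(1,2) nth_eq_iff_index_eq[of vs i "t + i"] by simp
  qed
  ultimately show ?thesis by blast
qed

theorem mainTheorem1:
  fixes V :: "'a set" and E :: "'a \<Rightarrow> 'a \<Rightarrow> bool"
  assumes "simple_graph V E" and "planar V E"
  shows "nonrep_chromatic_number V E \<le> 768"
proof -
  have "\<exists>\<phi>. (\<forall>v\<in>V. \<phi> v < 768) \<and> nonrepetitive V E \<phi>"
  proof (cases "V = {}")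
    case True
    then show ?thesis by (auto simp: nonrepetitive_def graph_path_def)
  next
    case False
    then obtain r where r: "r \<in> V" by blast
    have "finite V" using assms(1) unfolding simple_graph_def by (rule conjunct1)
    then show ?thesis by (rule product_structured_colouring[OF _ planar_product_structured[OF assms r]])
  qed
  then show ?thesis by (simp only: nonrep_chromatic_number_def Least_le)
qed

end
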